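(* Let $R$ be a nc rational expression in $x_1,\dots,x_d$ over a field $\mathbb K$, let $s\in\mathbb N$ and let $\underline Y=(Y_1,\dots,Y_d)\in dom_s(R)$. There exists a nc Fornasini--Marchesini realization $\mathcal R$ of $R$ centred at $\underline Y$ such that $\mathcal R$ is a realization of $R$ w.r.t. every unital $\mathbb K$-algebra.
   Context: $\mathbb K$ is a field, $\mathbb N=\{1,2,\dots\}$, $d\in\mathbb N$; underlined letters denote tuples, and operations such as $I_s\otimes\underline{\mathfrak a}=(I_s\otimes\mathfrak a_1,\dots,I_s\otimes\mathfrak a_d)$ act componentwise ($\otimes$ is the Kronecker product). NC rational expressions. A nc rational expression $R$ in $x_1,\dots,x_d$ over $\mathbb K$ is a formal expression obtained from nc polynomials in $\mathbb K\langle x_1,\dots,x_d\rangle$ by successive additions, multiplications and inversions. For a unital $\mathbb K$-algebra $\mathcal A$, its domain $dom^{\mathcal A}(R)\subseteq\mathcal A^d$ and evaluation $R^{\mathcal A}(\underline{\mathfrak a})\in\mathcal A$ are defined recursively: for a nc polynomial the domain is $\mathcal A^d$ and evaluation is substitution; for $R=R_1+R_2$ or $R=R_1R_2$ the domain is $dom^{\mathcal A}(R_1)\cap dom^{\mathcal A}(R_2)$ and the value is the sum, resp. product, of the values; for $R=R_1^{-1}$ the domain is $\{\underline{\mathfrak a}\in dom^{\mathcal A}(R_1): R_1^{\mathcal A}(\underline{\mathfrak a})\text{ invertible in }\mathcal A\}$ and $R^{\mathcal A}(\underline{\mathfrak a})=R_1^{\mathcal A}(\underline{\mathfrak a})^{-1}$.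 For $\mathcal A=\mathbb K^{n\times n}$ write $dom_n(R)$ and $R(\underline X)$. Realizations. Let $\underline Y\in(\mathbb K^{s\times s})^d$. A nc Fornasini--Marchesini realization $\mathcal R$ centred at $\underline Y$, described by $(L,D,C,\underline{\mathbf A},\underline{\mathbf B})$ with $L\in\mathbb N$, consists of linear mappings $\mathbf A_1,\dots,\mathbf A_d:\mathbb K^{s\times s}\to\mathbb K^{L\times L}$, $\mathbf B_1,\dots,\mathbf B_d:\mathbb K^{s\times s}\to\mathbb K^{L\times s}$ and matrices $C\in\mathbb K^{s\times L}$, $D\in\mathbb K^{s\times s}$. A linear mapping $\mathbf T$ on $s\times s$ matrices is extended to $X=[X_{ij}]_{i,j=1}^m\in\mathbb K^{sm\times sm}$ ($X_{ij}\in\mathbb K^{s\times s}$) by $(X)\mathbf T=[\mathbf T(X_{ij})]_{i,j=1}^m$. Put $DOM_{sm}(\mathcal R)=\{\underline X\in(\mathbb K^{sm\times sm})^d:\det(I_{Lm}-\sum_{k=1}^d(X_k-I_m\otimes Y_k)\mathbf A_k)\ne0\}$ and for such $\underline X$ $$\mathcal R(\underline X)=I_m\otimes D+(I_m\otimes C)\Big(I_{Lm}-\sum_{k=1}^d(X_k-I_m\otimes Y_k)\mathbf A_k\Big)^{-1}\sum_{k=1}^d(X_k-I_m\otimes Y_k)\mathbf B_k.$$ For a unital $\mathbb K$-algebra $\mathcal A$, identify $\mathcal A^{p\times q}=\mathbb K^{p\times q}\otimes\mathcal A$ and extend $\mathbf T$ by $(\mathfrak A)\mathbf T^{\mathcal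 A}=\sum_{i,j}\mathbf T(E_{ij})\otimes\mathfrak a_{ij}$ for $\mathfrak A=\sum_{i,j} E_{ij}\otimes\mathfrak a_{ij}$. $DOM^{\mathcal A}(\mathcal R)$ is the set of $\underline{\mathfrak A}\in(\mathcal A^{s\times s})^d$ for which $I_L\otimes1_{\mathcal A}-\sum_k(\mathfrak A_k-Y_k\otimes1_{\mathcal A})\mathbf A_k^{\mathcal A}$ is invertible in $\mathcal A^{L\times L}$, and then $$\mathcal R^{\mathcal A}(\underline{\mathfrak A})=D\otimes1_{\mathcal A}+(C\otimes1_{\mathcal A})\Big(I_L\otimes1_{\mathcal A}-\sum_k(\mathfrak A_k-Y_k\otimes1_{\mathcal A})\mathbf A_k^{\mathcal A}\Big)^{-1}\sum_k(\mathfrak A_k-Y_k\otimes1_{\mathcal A})\mathbf B_k^{\mathcal A}.$$ $\mathcal R$ is a realization of $R$ if for every $m\in\mathbb N$: $dom_{sm}(R)\subseteq DOM_{sm}(\mathcal R)$ and $R(\underline X)=\mathcal R(\underline X)$ for all $\underline X\in dom_{sm}(R)$. $\mathcal R$ is a realization of $R$ w.r.t. $\mathcal A$ if for every $\underline{\mathfrak a}\in dom^{\mathcal A}(R)$: $I_s\otimes\underline{\mathfrak a}\in DOM^{\mathcal A}(\mathcal R)$ and $I_s\otimes R^{\mathcal A}(\underline{\mathfrak a})=\mathcal R^{\mathcal A}(I_s\otimes\underline{\mathfrak a})$. *)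

theory Defs
  imports
    "HOL-Library.Poly_Mapping"
    "Jordan_Normal_Form.VS_Connect"
begin

section \<open>Unital algebras\<close>

text \<open>
  The library locale \<open>algebra\<close> is restricted to commutative algebras, so the noncommutative
  version is stated here, over a field given as a type. The zero ring is allowed.
\<close>

locale unital_algebra = Module.module "class_ring :: 'k::field ring" A + ring A
  for A :: "('k::field, 'a, 'm) module_scheme" (structure) +
  assumes smult_mult_left:
      "x \<in> carrier A \<Longrightarrow> y \<in> carrier A \<Longrightarrow> (c \<odot> x) \<otimes> y = c \<odot> (x \<otimes> y)"
    and smult_mult_right:
      "x \<in> carrier A \<Longrightarrow> y \<in> carrier A \<Longrightarrow> x \<otimes> (c \<odot> y) = c \<odot> (x \<otimes> y)"

abbreviation mat_alg :: "nat \<Rightarrow> ('k::field, 'k mat) module" where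
  "mat_alg n \<equiv> module_mat TYPE('k) n n"

lemma unital_algebra_mat_alg: "unital_algebra (mat_alg n :: ('k::field, 'k mat) module)"
proof -
  interpret abelian_group "mat_alg n :: ('k, 'k mat) module"
    by (rule abelian_group_mat)
  interpret R: ring "ring_mat TYPE('k) n \<lparr>smult = (\<cdot>\<^sub>m) :: 'k \<Rightarrow> 'k mat \<Rightarrow> 'k mat\<rparr>"
    by (rule ring_mat)
  have "ring (mat_alg n :: ('k, 'k mat) module)"
    using R.ring_axioms unfolding ring_mat_def module_mat_def by simp
  then interpret ring "mat_alg n :: ('k, 'k mat) module" .
  show ?thesis
    by (unfold_locales)
       (auto simp: module_mat_simps add_smult_distrib_right_mat add_smult_distrib_left_mat)
qed


section \<open>Noncommutative rational expressions\<close>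

text \<open>
  The indeterminates are indexed by a finite type \<open>'d\<close> (so \<open>d = CARD('d)\<close>), and a noncommutative
  polynomial is a finitely supported function from words to coefficients. Expressions are formal:
  e.g. \<open>Inv (Poly 0)\<close> is an expression, and distinct expressions may define the same function.
\<close>

type_synonym ('k, 'd) nc_poly = "'d list \<Rightarrow>\<^sub>0 'k"

context
  notes [[typedef_overloaded]]
begin

datatype ('k::zero, 'd) nc_rat =
    Poly "('k, 'd) nc_poly"
  | Add "('k, 'd) nc_rat" "('k, 'd) nc_rat"
  | Mul "('k, 'd) nc_rat" "('k, 'd) nc_rat"
  | Inv "('k, 'd) nc_rat"

end

definition word_eval :: "('a, 'm) ring_scheme \<Rightarrow> ('d \<Rightarrow> 'a) \<Rightarrow> 'd list \<Rightarrow> 'a" where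
  "word_eval A a w = foldr (\<lambda>k y. a k \<otimes>\<^bsub>A\<^esub> y) w \<one>\<^bsub>A\<^esub>"

definition poly_eval ::
    "('k::zero, 'a, 'm) module_scheme \<Rightarrow> ('d \<Rightarrow> 'a) \<Rightarrow> ('k, 'd) nc_poly \<Rightarrow> 'a" where
  "poly_eval A a p = (\<Oplus>\<^bsub>A\<^esub>w\<in>Poly_Mapping.keys p. Poly_Mapping.lookup p w \<odot>\<^bsub>A\<^esub> word_eval A a w)"

primrec rat_eval ::
    "('k::zero, 'a, 'm) module_scheme \<Rightarrow> ('k, 'd) nc_rat \<Rightarrow> ('d \<Rightarrow> 'a) \<Rightarrow> 'a" where
  "rat_eval A (Poly p) a = poly_eval A a p"
| "rat_eval A (Add R1 R2) a = rat_eval A R1 a \<oplus>\<^bsub>A\<^esub> rat_eval A R2 a"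
| "rat_eval A (Mul R1 R2) a = rat_eval A R1 a \<otimes>\<^bsub>A\<^esub> rat_eval A R2 a"
| "rat_eval A (Inv R1) a = inv\<^bsub>A\<^esub> (rat_eval A R1 a)"

primrec rat_dom ::
    "('k::zero, 'a, 'm) module_scheme \<Rightarrow> ('k, 'd) nc_rat \<Rightarrow> ('d \<Rightarrow> 'a) set" where
  "rat_dom A (Poly p) = {a. \<forall>k. a k \<in> carrier A}"
| "rat_dom A (Add R1 R2) = rat_dom A R1 \<inter> rat_dom A R2"
| "rat_dom A (Mul R1 R2) = rat_dom A R1 \<inter> rat_dom A R2"
| "rat_dom A (Inv R1) = {a \<in> rat_dom A R1. rat_eval A R1 a \<in> Units A}"


section \<open>Fornasini--Marchesini realizations\<close>

definition linear_on_mats :: "nat \<Rightarrow> nat \<Rightarrow> nat \<Rightarrow> ('k::field mat \<Rightarrow> 'k mat) \<Rightarrow> bool" where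
  "linear_on_mats s p q T \<longleftrightarrow>
     (\<forall>X \<in> carrier_mat s s. T X \<in> carrier_mat p q) \<and>
     (\<forall>X \<in> carrier_mat s s. \<forall>Y \<in> carrier_mat s s. T (X + Y) = T X + T Y) \<and>
     (\<forall>c. \<forall>X \<in> carrier_mat s s. T (c \<cdot>\<^sub>m X) = c \<cdot>\<^sub>m T X)"

record ('k, 'd) fm_real =
  fm_L :: nat
  fm_D :: "'k mat"
  fm_C :: "'k mat"
  fm_A :: "'d \<Rightarrow> 'k mat \<Rightarrow> 'k mat"
  fm_B :: "'d \<Rightarrow> 'k mat \<Rightarrow> 'k mat"

definition fm_realization :: "nat \<Rightarrow> ('k::field, 'd) fm_real \<Rightarrow> bool" where
  "fm_realization s \<R> \<longleftrightarrow>
     fm_L \<R> \<ge> 1 \<and>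
     fm_D \<R> \<in> carrier_mat s s \<and>
     fm_C \<R> \<in> carrier_mat s (fm_L \<R>) \<and>
     (\<forall>k. linear_on_mats s (fm_L \<R>) (fm_L \<R>) (fm_A \<R> k)) \<and>
     (\<forall>k. linear_on_mats s (fm_L \<R>) s (fm_B \<R> k))"


subsection \<open>Evaluation on tuples of block matrices\<close>

definition kron :: "'k::times mat \<Rightarrow> 'k mat \<Rightarrow> 'k mat" where
  "kron M N = mat (dim_row M * dim_row N) (dim_col M * dim_col N)
     (\<lambda>(i, j). M $$ (i div dim_row N, j div dim_col N) * N $$ (i mod dim_row N, j mod dim_col N))"

definition block :: "nat \<Rightarrow> 'k mat \<Rightarrow> nat \<Rightarrow> nat \<Rightarrow> 'k mat" where
  "block s X i j = mat s s (\<lambda>(a, b). X $$ (i * s + a, j * s + b))"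

text \<open>\<open>block_ext m s p q T X\<close> is the block matrix \<open>[T(X\<^sub>i\<^sub>j)]\<close> with \<open>i, j < m\<close>,
  where \<open>T\<close> maps \<open>s \<times> s\<close> matrices to \<open>p \<times> q\<close> matrices.\<close>

definition block_ext ::
    "nat \<Rightarrow> nat \<Rightarrow> nat \<Rightarrow> nat \<Rightarrow> ('k mat \<Rightarrow> 'k mat) \<Rightarrow> 'k mat \<Rightarrow> 'k mat" where
  "block_ext m s p q T X = mat (m * p) (m * q)
     (\<lambda>(r, c). T (block s X (r div p) (c div q)) $$ (r mod p, c mod q))"

text \<open>The matrix \<open>\<Sum>\<^sub>k (X\<^sub>k - I\<^sub>m \<otimes> Y\<^sub>k) T\<^sub>k\<close>, summed entrywise because matrices of a given
  size do not form a type.\<close>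

definition block_sum :: "nat \<Rightarrow> nat \<Rightarrow> nat \<Rightarrow> nat \<Rightarrow> ('d::finite \<Rightarrow> 'k::field mat) \<Rightarrow>
    ('d \<Rightarrow> 'k mat \<Rightarrow> 'k mat) \<Rightarrow> ('d \<Rightarrow> 'k mat) \<Rightarrow> 'k mat" where
  "block_sum m s p q Y T X = mat (m * p) (m * q)
     (\<lambda>rc. \<Sum>k\<in>UNIV. block_ext m s p q (T k) (X k - kron (1\<^sub>m m) (Y k)) $$ rc)"

definition fm_pencil :: "nat \<Rightarrow> nat \<Rightarrow> ('d::finite \<Rightarrow> 'k::field mat) \<Rightarrow> ('k, 'd) fm_real \<Rightarrow>
    ('d \<Rightarrow> 'k mat) \<Rightarrow> 'k mat" where
  "fm_pencil m s Y \<R> X =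
     1\<^sub>m (m * fm_L \<R>) - block_sum m s (fm_L \<R>) (fm_L \<R>) Y (fm_A \<R>) X"

definition fm_dom :: "nat \<Rightarrow> nat \<Rightarrow> ('d::finite \<Rightarrow> 'k::field mat) \<Rightarrow> ('k, 'd) fm_real \<Rightarrow>
    ('d \<Rightarrow> 'k mat) set" where
  "fm_dom m s Y \<R> =
     {X. (\<forall>k. X k \<in> carrier_mat (s * m) (s * m)) \<and> det (fm_pencil m s Y \<R> X) \<noteq> 0}"

definition fm_eval :: "nat \<Rightarrow> nat \<Rightarrow> ('d::finite \<Rightarrow> 'k::field mat) \<Rightarrow> ('k, 'd) fm_real \<Rightarrow>
    ('d \<Rightarrow> 'k mat) \<Rightarrow> 'k mat" where
  "fm_eval m s Y \<R> X =
     kron (1\<^sub>m m) (fm_D \<R>) +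
     kron (1\<^sub>m m) (fm_C \<R>) * inv\<^bsub>mat_alg (m * fm_L \<R>)\<^esub> (fm_pencil m s Y \<R> X) *
       block_sum m s (fm_L \<R>) s Y (fm_B \<R>) X"

definition realization_of :: "nat \<Rightarrow> ('d::finite \<Rightarrow> 'k::field mat) \<Rightarrow> ('k, 'd) fm_real \<Rightarrow>
    ('k, 'd) nc_rat \<Rightarrow> bool" where
  "realization_of s Y \<R> R \<longleftrightarrow>
     (\<forall>m\<ge>1. rat_dom (mat_alg (s * m)) R \<subseteq> fm_dom m s Y \<R> \<and>
       (\<forall>X \<in> rat_dom (mat_alg (s * m)) R. rat_eval (mat_alg (s * m)) R X = fm_eval m s Y \<R> X))"


subsection \<open>Evaluation over a unital algebra\<close>

text \<open>
  Matrices over an algebra \<open>A\<close> use \<open>'a mat\<close> as container; the ring operations come from the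
  record \<open>A\<close>, not from a type class on \<open>'a\<close>.
\<close>

definition amat_carrier :: "('a, 'm) ring_scheme \<Rightarrow> nat \<Rightarrow> nat \<Rightarrow> 'a mat set" where
  "amat_carrier A p q = {M \<in> carrier_mat p q. elements_mat M \<subseteq> carrier A}"

definition amat_add :: "('a, 'm) ring_scheme \<Rightarrow> 'a mat \<Rightarrow> 'a mat \<Rightarrow> 'a mat" where
  "amat_add A M N = mat (dim_row M) (dim_col M) (\<lambda>ij. M $$ ij \<oplus>\<^bsub>A\<^esub> N $$ ij)"

definition amat_minus :: "('a, 'm) ring_scheme \<Rightarrow> 'a mat \<Rightarrow> 'a mat \<Rightarrow> 'a mat" where
  "amat_minus A M N = mat (dim_row M) (dim_col M) (\<lambda>ij. M $$ ij \<ominus>\<^bsub>A\<^esub> N $$ ij)"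

definition amat_mult :: "('a, 'm) ring_scheme \<Rightarrow> 'a mat \<Rightarrow> 'a mat \<Rightarrow> 'a mat" where
  "amat_mult A M N = mat (dim_row M) (dim_col N)
     (\<lambda>(i, j). \<Oplus>\<^bsub>A\<^esub>l\<in>{..<dim_col M}. M $$ (i, l) \<otimes>\<^bsub>A\<^esub> N $$ (l, j))"

definition amat_one :: "('a, 'm) ring_scheme \<Rightarrow> nat \<Rightarrow> 'a mat" where
  "amat_one A n = mat n n (\<lambda>(i, j). if i = j then \<one>\<^bsub>A\<^esub> else \<zero>\<^bsub>A\<^esub>)"

definition amat_ring :: "('a, 'm) ring_scheme \<Rightarrow> nat \<Rightarrow> 'a mat ring" where
  "amat_ring A n =
     \<lparr> carrier = amat_carrier A n n, mult = amat_mult A, one = amat_one A n,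
       zero = mat n n (\<lambda>_. \<zero>\<^bsub>A\<^esub>), add = amat_add A \<rparr>"

text \<open>\<open>tensor A M a\<close> is \<open>M \<otimes> a\<close> for a scalar matrix \<open>M\<close> and \<open>a\<close> in \<open>A\<close>, under the
  identification of \<open>K\<^sup>p\<^sup>\<times>\<^sup>q \<otimes> A\<close> with the \<open>p \<times> q\<close> matrices over \<open>A\<close>.\<close>

definition tensor :: "('k, 'a, 'm) module_scheme \<Rightarrow> 'k mat \<Rightarrow> 'a \<Rightarrow> 'a mat" where
  "tensor A M a = map_mat (\<lambda>c. c \<odot>\<^bsub>A\<^esub> a) M"

definition unit_mat :: "nat \<Rightarrow> nat \<Rightarrow> nat \<Rightarrow> 'k::zero_neq_one mat" where
  "unit_mat s i j = mat s s (\<lambda>ab. if ab = (i, j) then 1 else 0)"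

text \<open>The extension \<open>\<Sum>\<^sub>i\<^sub>j T(E\<^sub>i\<^sub>j) \<otimes> M\<^sub>i\<^sub>j\<close> of a linear map \<open>T\<close> to matrices over \<open>A\<close>.\<close>

definition alg_ext :: "('k::field, 'a, 'm) module_scheme \<Rightarrow> nat \<Rightarrow> nat \<Rightarrow> nat \<Rightarrow>
    ('k mat \<Rightarrow> 'k mat) \<Rightarrow> 'a mat \<Rightarrow> 'a mat" where
  "alg_ext A s p q T M = mat p q
     (\<lambda>rc. \<Oplus>\<^bsub>A\<^esub>ij\<in>{..<s} \<times> {..<s}. tensor A (T (unit_mat s (fst ij) (snd ij))) (M $$ ij) $$ rc)"

definition alg_sum :: "('k::field, 'a, 'm) module_scheme \<Rightarrow> nat \<Rightarrow> nat \<Rightarrow> nat \<Rightarrow>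
    ('d::finite \<Rightarrow> 'k mat) \<Rightarrow> ('d \<Rightarrow> 'k mat \<Rightarrow> 'k mat) \<Rightarrow> ('d \<Rightarrow> 'a mat) \<Rightarrow> 'a mat" where
  "alg_sum A s p q Y T M = mat p q
     (\<lambda>rc. \<Oplus>\<^bsub>A\<^esub>k\<in>UNIV. alg_ext A s p q (T k) (amat_minus A (M k) (tensor A (Y k) \<one>\<^bsub>A\<^esub>)) $$ rc)"

definition alg_pencil :: "('k::field, 'a, 'm) module_scheme \<Rightarrow> nat \<Rightarrow> ('d::finite \<Rightarrow> 'k mat) \<Rightarrow>
    ('k, 'd) fm_real \<Rightarrow> ('d \<Rightarrow> 'a mat) \<Rightarrow> 'a mat" where
  "alg_pencil A s Y \<R> M =
     amat_minus A (tensor A (1\<^sub>m (fm_L \<R>)) \<one>\<^bsub>A\<^esub>)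
       (alg_sum A s (fm_L \<R>) (fm_L \<R>) Y (fm_A \<R>) M)"

definition alg_fm_dom :: "('k::field, 'a, 'm) module_scheme \<Rightarrow> nat \<Rightarrow> ('d::finite \<Rightarrow> 'k mat) \<Rightarrow>
    ('k, 'd) fm_real \<Rightarrow> ('d \<Rightarrow> 'a mat) set" where
  "alg_fm_dom A s Y \<R> =
     {M. (\<forall>k. M k \<in> amat_carrier A s s) \<and> alg_pencil A s Y \<R> M \<in> Units (amat_ring A (fm_L \<R>))}"

definition alg_fm_eval :: "('k::field, 'a, 'm) module_scheme \<Rightarrow> nat \<Rightarrow> ('d::finite \<Rightarrow> 'k mat) \<Rightarrow>
    ('k, 'd) fm_real \<Rightarrow> ('d \<Rightarrow> 'a mat) \<Rightarrow> 'a mat" where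
  "alg_fm_eval A s Y \<R> M =
     amat_add A (tensor A (fm_D \<R>) \<one>\<^bsub>A\<^esub>)
       (amat_mult A
         (amat_mult A (tensor A (fm_C \<R>) \<one>\<^bsub>A\<^esub>)
           (inv\<^bsub>amat_ring A (fm_L \<R>)\<^esub> (alg_pencil A s Y \<R> M)))
         (alg_sum A s (fm_L \<R>) s Y (fm_B \<R>) M))"

definition realization_wrt :: "('k::field, 'a, 'm) module_scheme \<Rightarrow> nat \<Rightarrow>
    ('d::finite \<Rightarrow> 'k mat) \<Rightarrow> ('k, 'd) fm_real \<Rightarrow> ('k, 'd) nc_rat \<Rightarrow> bool" where
  "realization_wrt A s Y \<R> R \<longleftrightarrow>
     (\<forall>a \<in> rat_dom A R.
        (\<lambda>k. tensor A (1\<^sub>m s) (a k)) \<in> alg_fm_dom A s Y \<R> \<and>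
        tensor A (1\<^sub>m s) (rat_eval A R a) = alg_fm_eval A s Y \<R> (\<lambda>k. tensor A (1\<^sub>m s) (a k)))"

text \<open>
  A HOL formula cannot quantify over the carrier type of \<open>A\<close>, and in
  \<open>\<exists>\<R>. \<forall>A :: ('k, 'a) module. \<dots>\<close> the witness may depend on \<open>'a\<close>. To state that one \<open>\<R>\<close>
  serves every unital algebra, one can use the single type \<open>('k, 'd) nc_rat\<close>, which is
  independent of \<open>'a\<close>: assert (1) that some \<open>\<R>\<close> serves all unital algebras carried by a subset
  of this type, and (2) that every such \<open>\<R>\<close> serves all unital algebras carried by a subset of an
  arbitrary type \<open>'a\<close>. The \<open>\<R>\<close> of (1) then serves all unital algebras over all types. The type
  is large enough: for \<open>a\<close> in \<open>rat_dom A R\<close> only the subalgebra of values at \<open>a\<close> of rational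
  expressions matters.
\<close>

end

theory Submission
  imports Defs
begin

text \<open>
  Every rational expression \<open>R\<close> has a linear representation over the field \<open>K\<close>: scalar matrices
  \<open>c\<close>, \<open>b\<close>, \<open>P\<close>, \<open>Q\<^sub>k\<close> such that for each unital algebra and each \<open>a\<close> in the domain of \<open>R\<close> the
  matrix \<open>\<Lambda>(a) = P \<otimes> 1 + \<Sum>\<^sub>k Q\<^sub>k \<otimes> a\<^sub>k\<close> is invertible and \<open>R(a) = c \<Lambda>(a)\<^sup>-\<^sup>1 b\<close>. It is built by recursion
  on \<open>R\<close> from block matrices; for inverses, \<open>R(a)\<close> is the Schur complement of \<open>\<Lambda>(a)\<close> in
  \<open>[\<Lambda>(a), -b; c, 0]\<close>. In particular \<open>\<Lambda>(Y)\<close> is invertible for \<open>Y\<close> in the domain of \<open>R\<close>, and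
  multiplication by its inverse \<open>W\<close> turns the representation, tensored with \<open>I\<^sub>s\<close>, into a
  realization centred at \<open>Y\<close>: its pencil is \<open>W \<Lambda>(X)\<close>, so that \<open>C (W \<Lambda>(X))\<^sup>-\<^sup>1 W b = C \<Lambda>(X)\<^sup>-\<^sup>1 b\<close>.

  For the second half of the theorem, the values at \<open>a\<close> of rational expressions form a subalgebra
  that is closed under inverses and has at most as many elements as there are expressions; it
  has a copy on the type of expressions, and realizations are preserved by homomorphisms.
\<close>

section \<open>Matrices over a ring\<close>

text \<open>A single predicate, \<open>represents\<close>, feeds both kinds of evaluation. For a
  unital algebra it is used over that algebra and amplified by \<open>I_s\<close>; for matrices of
  size \<open>sm\<close> it is used over \<open>mat_alg (s * m)\<close> and the tensor factors are
  reordered. Its instance at the point \<open>Y\<close> yields \<open>W\<close>, and the data of the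
  realization depend on the centre only through \<open>W\<close>.

  Over a noncommutative algebra there is no determinant, and a one-sided inverse of a square matrix
  may fail to be two-sided. Therefore every inverse is given by an explicit formula and checked on
  both sides.

  The normalized pencil \<open>M = W \<Lambda>\<close> and \<open>w = W b\<close> give the value as
  \<open>C M\<^sup>-\<^sup>1 w\<close>, which does not yet have the Fornasini--Marchesini form. But
  \<open>M = 1 - S\<close>, where \<open>S\<close> is the sum with the coefficients
  \<open>A_k\<close>, so \<open>M\<^sup>-\<^sup>1 w = w + M\<^sup>-\<^sup>1 S w\<close>. This is the
  origin of \<open>D = C w\<close> and \<open>B_k(Z) = A_k(Z) w\<close>.\<close>

text \<open>Sizes are kept out of this predicate, so that size conditions become equations between
  \<open>dim_row\<close> and \<open>dim_col\<close>, which the simplifier discharges without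
  guessing the sizes of intermediate products.\<close>

definition entries_in :: "('a, 'm) ring_scheme \<Rightarrow> 'a mat \<Rightarrow> bool" where
  "entries_in A M \<longleftrightarrow> (\<forall>i<dim_row M. \<forall>j<dim_col M. M $$ (i, j) \<in> carrier A)"

lemma amat_carrier_iff:
  "M \<in> amat_carrier A p q \<longleftrightarrow> dim_row M = p \<and> dim_col M = q \<and> entries_in A M"
proof -
  have "elements_mat M \<subseteq> carrier A \<longleftrightarrow> entries_in A M"
    unfolding entries_in_def by (auto dest!: elements_matD intro!: elements_matI)
  then show ?thesis
    by (auto simp: amat_carrier_def)
qed

lemma entries_inD: "entries_in A M \<Longrightarrow> i < dim_row M \<Longrightarrow> j < dim_col M \<Longrightarrow> M $$ (i, j) \<in> carrier A"
  by (simp add: entries_in_def)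

lemma entries_in_mat:
  "(\<And>i j. i < p \<Longrightarrow> j < q \<Longrightarrow> f (i, j) \<in> carrier A) \<Longrightarrow> entries_in A (mat p q f)"
  by (simp add: entries_in_def)

definition amat_zero :: "('a, 'm) ring_scheme \<Rightarrow> nat \<Rightarrow> nat \<Rightarrow> 'a mat" where
  "amat_zero A p q = mat p q (\<lambda>_. \<zero>\<^bsub>A\<^esub>)"

lemma amat_dims [simp]:
  "dim_row (amat_add A M N) = dim_row M" "dim_col (amat_add A M N) = dim_col M"
  "dim_row (amat_minus A M N) = dim_row M" "dim_col (amat_minus A M N) = dim_col M"
  "dim_row (amat_mult A M N) = dim_row M" "dim_col (amat_mult A M N) = dim_col N"
  "dim_row (amat_one A n) = n" "dim_col (amat_one A n) = n"
  "dim_row (amat_zero A p q) = p" "dim_col (amat_zero A p q) = q"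
  "dim_row (tensor B K a) = dim_row K" "dim_col (tensor B K a) = dim_col K"
  by (simp_all add: amat_add_def amat_minus_def amat_mult_def amat_one_def amat_zero_def
      tensor_def)

lemma amat_index [simp]:
  "i < dim_row M \<Longrightarrow> j < dim_col M \<Longrightarrow> amat_add A M N $$ (i, j) = M $$ (i, j) \<oplus>\<^bsub>A\<^esub> N $$ (i, j)"
  "i < dim_row M \<Longrightarrow> j < dim_col M \<Longrightarrow> amat_minus A M N $$ (i, j) = M $$ (i, j) \<ominus>\<^bsub>A\<^esub> N $$ (i, j)"
  "i < n \<Longrightarrow> j < n \<Longrightarrow> amat_one A n $$ (i, j) = (if i = j then \<one>\<^bsub>A\<^esub> else \<zero>\<^bsub>A\<^esub>)"
  "i < p \<Longrightarrow> j < q \<Longrightarrow> amat_zero A p q $$ (i, j) = \<zero>\<^bsub>A\<^esub>"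
  "i < dim_row K \<Longrightarrow> j < dim_col K \<Longrightarrow> tensor B K a $$ (i, j) = K $$ (i, j) \<odot>\<^bsub>B\<^esub> a"
  by (simp_all add: amat_add_def amat_minus_def amat_one_def amat_zero_def tensor_def)

lemma amat_mult_index:
  "i < dim_row M \<Longrightarrow> j < dim_col N \<Longrightarrow>
     amat_mult A M N $$ (i, j) = (\<Oplus>\<^bsub>A\<^esub>l\<in>{..<dim_col M}. M $$ (i, l) \<otimes>\<^bsub>A\<^esub> N $$ (l, j))"
  by (simp add: amat_mult_def)

section \<open>Finite sums in an abelian monoid\<close>

lemma (in abelian_monoid) finsum_swap:
  assumes "finite I" "finite J" "\<And>i j. i \<in> I \<Longrightarrow> j \<in> J \<Longrightarrow> f i j \<in> carrier G"
  shows "(\<Oplus>i\<in>I. \<Oplus>j\<in>J. f i j) = (\<Oplus>j\<in>J. \<Oplus>i\<in>I. f i j)"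
  using assms(1,3)
proof (induction I rule: finite_induct)
  case (insert i I)
  have "(\<Oplus>i\<in>insert i I. \<Oplus>j\<in>J. f i j) = (\<Oplus>j\<in>J. f i j) \<oplus> (\<Oplus>i\<in>I. \<Oplus>j\<in>J. f i j)"
    using insert by (intro finsum_insert) (auto intro!: finsum_closed)
  also have "(\<Oplus>i\<in>I. \<Oplus>j\<in>J. f i j) = (\<Oplus>j\<in>J. \<Oplus>i\<in>I. f i j)"
    using insert by simp
  also have "(\<Oplus>j\<in>J. f i j) \<oplus> (\<Oplus>j\<in>J. \<Oplus>i\<in>I. f i j) = (\<Oplus>j\<in>J. f i j \<oplus> (\<Oplus>i\<in>I. f i j))"
    using insert by (intro finsum_addf [symmetric]) (auto intro!: finsum_closed)
  also have "\<dots> = (\<Oplus>j\<in>J. \<Oplus>i\<in>insert i I. f i j)"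
    using insert by (intro finsum_cong' finsum_insert [symmetric]) (auto intro!: finsum_closed)
  finally show ?case .
qed (simp add: finsum_zero)

lemma (in abelian_monoid) finsum_lessThan_add:
  fixes m n :: nat
  assumes "\<And>i. i < m + n \<Longrightarrow> f i \<in> carrier G"
  shows "finsum G f {..<m + n} = finsum G f {..<m} \<oplus> (\<Oplus>i\<in>{..<n}. f (m + i))"
proof -
  have "(+) m ` {..<n} = {m..<m + n}"
    by (simp add: lessThan_atLeast0 add.commute)
  then have "{..<m + n} = {..<m} \<union> (+) m ` {..<n}"
    by auto
  then have "finsum G f {..<m + n} = finsum G f ({..<m} \<union> (+) m ` {..<n})"
    by simp
  also have "\<dots> = finsum G f {..<m} \<oplus> finsum G f ((+) m ` {..<n})"
    using assms by (intro finsum_Un_disjoint) auto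
  also have "finsum G f ((+) m ` {..<n}) = (\<Oplus>i\<in>{..<n}. f (m + i))"
    using assms by (intro finsum_reindex) auto
  finally show ?thesis .
qed

text \<open>Every index below \<open>n * s\<close> is \<open>i * s + p\<close> for a unique block
  number \<open>i\<close> and offset \<open>p < s\<close>; products of amplified matrices are summed
  along this splitting.\<close>

lemma (in abelian_monoid) finsum_lessThan_mult:
  fixes n s :: nat
  assumes "\<And>i. i < n * s \<Longrightarrow> f i \<in> carrier G"
  shows "finsum G f {..<n * s} = (\<Oplus>i\<in>{..<n}. \<Oplus>p\<in>{..<s}. f (i * s + p))"
  using assms
proof (induction n)
  case (Suc n)
  have *: "i * s + p < Suc n * s" if "i < Suc n" "p < s" for i p
  proof -
    have "i * s + p < i * s + s" using that by simp
    also have "\<dots> = Suc i * s" by simp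
    also have "\<dots> \<le> Suc n * s" using that by (intro mult_right_mono) auto
    finally show ?thesis .
  qed
  have "finsum G f {..<Suc n * s} = finsum G f {..<n * s + s}"
    by (simp add: add.commute)
  also have "\<dots> = finsum G f {..<n * s} \<oplus> (\<Oplus>p\<in>{..<s}. f (n * s + p))"
    using Suc.prems by (intro finsum_lessThan_add) (simp add: add.commute)
  also have "finsum G f {..<n * s} = (\<Oplus>i\<in>{..<n}. \<Oplus>p\<in>{..<s}. f (i * s + p))"
    using Suc by simp
  also have "\<dots> \<oplus> (\<Oplus>p\<in>{..<s}. f (n * s + p)) = (\<Oplus>p\<in>{..<s}. f (n * s + p)) \<oplus> \<dots>"
    using Suc.prems * by (intro a_comm finsum_closed) (auto intro!: finsum_closed)
  also have "\<dots> = (\<Oplus>i\<in>{..<Suc n}. \<Oplus>p\<in>{..<s}. f (i * s + p))"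
    unfolding lessThan_Suc using Suc.prems *
    by (intro finsum_insert [symmetric]) (auto intro!: finsum_closed)
  finally show ?case .
qed simp

lemma (in abelian_monoid) finsum_lessThan_delta:
  fixes i n :: nat
  assumes "i < n" "f i \<in> carrier G"
  shows "(\<Oplus>j\<in>{..<n}. if j = i then f j else \<zero>) = f i"
    "(\<Oplus>j\<in>{..<n}. if i = j then f j else \<zero>) = f i"
proof -
  have "(\<Oplus>j\<in>{..<n}. if i = j then f j else \<zero>) = (\<Oplus>j\<in>{i}. f j)"
    using assms by (intro add.finprod_mono_neutral_cong_right) auto
  also have "\<dots> = f i"
    using assms by simp
  finally show "(\<Oplus>j\<in>{..<n}. if i = j then f j else \<zero>) = f i" .
  moreover have "(\<Oplus>j\<in>{..<n}. if j = i then f j else \<zero>) = (\<Oplus>j\<in>{..<n}. if i = j then f j else \<zero>)"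
    using assms by (intro finsum_cong') auto
  ultimately show "(\<Oplus>j\<in>{..<n}. if j = i then f j else \<zero>) = f i" by simp
qed


context ring
begin

lemma entries_in_amat:
  "entries_in R M \<Longrightarrow> entries_in R N \<Longrightarrow> dim_row M = dim_row N \<Longrightarrow> dim_col M = dim_col N \<Longrightarrow>
     entries_in R (amat_add R M N)"
  "entries_in R M \<Longrightarrow> entries_in R N \<Longrightarrow> dim_row M = dim_row N \<Longrightarrow> dim_col M = dim_col N \<Longrightarrow>
     entries_in R (amat_minus R M N)"
  "entries_in R M \<Longrightarrow> entries_in R N \<Longrightarrow> dim_col M = dim_row N \<Longrightarrow> entries_in R (amat_mult R M N)"
  "entries_in R (amat_one R n)"
  "entries_in R (amat_zero R p q)"
  by (auto simp: entries_in_def amat_mult_index intro!: finsum_closed)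

lemma amat_mult_assoc:
  assumes "entries_in R M" "entries_in R N" "entries_in R P"
    and "dim_col M = dim_row N" "dim_col N = dim_row P"
  shows "amat_mult R (amat_mult R M N) P = amat_mult R M (amat_mult R N P)"
proof (rule eq_matI)
  fix i j
  assume "i < dim_row (amat_mult R M (amat_mult R N P))"
    and "j < dim_col (amat_mult R M (amat_mult R N P))"
  then have ij: "i < dim_row M" "j < dim_col P" by auto
  note c = entries_inD [OF assms(1)] entries_inD [OF assms(2)] entries_inD [OF assms(3)]
  let ?r = "dim_row N" and ?q = "dim_row P"
  have "amat_mult R (amat_mult R M N) P $$ (i, j)
      = (\<Oplus>l\<in>{..<?q}. (\<Oplus>k\<in>{..<?r}. M $$ (i, k) \<otimes> N $$ (k, l)) \<otimes> P $$ (l, j))"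
    using ij assms c by (auto simp: amat_mult_index intro!: finsum_cong' finsum_closed)
  also have "\<dots> = (\<Oplus>l\<in>{..<?q}. \<Oplus>k\<in>{..<?r}. M $$ (i, k) \<otimes> N $$ (k, l) \<otimes> P $$ (l, j))"
    using ij assms c by (intro finsum_cong' finsum_ldistr) (auto intro!: finsum_closed)
  also have "\<dots> = (\<Oplus>k\<in>{..<?r}. \<Oplus>l\<in>{..<?q}. M $$ (i, k) \<otimes> N $$ (k, l) \<otimes> P $$ (l, j))"
    using ij assms c by (intro finsum_swap) auto
  also have "\<dots> = (\<Oplus>k\<in>{..<?r}. \<Oplus>l\<in>{..<?q}. M $$ (i, k) \<otimes> (N $$ (k, l) \<otimes> P $$ (l, j)))"
    using ij assms c by (intro finsum_cong') (auto intro!: finsum_closed simp: m_assoc)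
  also have "\<dots> = (\<Oplus>k\<in>{..<?r}. M $$ (i, k) \<otimes> (\<Oplus>l\<in>{..<?q}. N $$ (k, l) \<otimes> P $$ (l, j)))"
    using ij assms c by (intro finsum_cong' finsum_rdistr [symmetric]) (auto intro!: finsum_closed)
  also have "\<dots> = amat_mult R M (amat_mult R N P) $$ (i, j)"
    using ij assms c by (auto simp: amat_mult_index intro!: finsum_cong' finsum_closed)
  finally show "amat_mult R (amat_mult R M N) P $$ (i, j)
      = amat_mult R M (amat_mult R N P) $$ (i, j)" .
qed auto

lemma amat_mult_one:
  assumes "entries_in R M"
  shows "n = dim_row M \<Longrightarrow> amat_mult R (amat_one R n) M = M"
    and "n = dim_col M \<Longrightarrow> amat_mult R M (amat_one R n) = M"
proof -
  note c = entries_inD [OF assms]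
  show "amat_mult R (amat_one R n) M = M" if "n = dim_row M"
  proof (rule eq_matI)
    fix i j assume ij: "i < dim_row M" "j < dim_col M"
    have "amat_mult R (amat_one R n) M $$ (i, j)
        = (\<Oplus>l\<in>{..<n}. if i = l then M $$ (l, j) else \<zero>)"
      using ij that c by (auto simp: amat_mult_index intro!: finsum_cong')
    then show "amat_mult R (amat_one R n) M $$ (i, j) = M $$ (i, j)"
      using ij that c by (simp add: finsum_lessThan_delta)
  qed (use that in auto)
  show "amat_mult R M (amat_one R n) = M" if "n = dim_col M"
  proof (rule eq_matI)
    fix i j assume ij: "i < dim_row M" "j < dim_col M"
    have "amat_mult R M (amat_one R n) $$ (i, j)
        = (\<Oplus>l\<in>{..<n}. if l = j then M $$ (i, l) else \<zero>)"
      using ij that c by (auto simp: amat_mult_index intro!: finsum_cong')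
    then show "amat_mult R M (amat_one R n) $$ (i, j) = M $$ (i, j)"
      using ij that c by (simp add: finsum_lessThan_delta)
  qed (use that in auto)
qed

lemma amat_mult_zero:
  assumes "entries_in R M"
  shows "q = dim_row M \<Longrightarrow> amat_mult R (amat_zero R p q) M = amat_zero R p (dim_col M)"
    and "p = dim_col M \<Longrightarrow> amat_mult R M (amat_zero R p q) = amat_zero R (dim_row M) q"
proof -
  note c = entries_inD [OF assms]
  show "amat_mult R (amat_zero R p q) M = amat_zero R p (dim_col M)" if "q = dim_row M"
    using that c by (intro eq_matI) (auto simp: amat_mult_index intro!: add.finprod_one_eqI)
  show "amat_mult R M (amat_zero R p q) = amat_zero R (dim_row M) q" if "p = dim_col M"
    using that c by (intro eq_matI) (auto simp: amat_mult_index intro!: add.finprod_one_eqI)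
qed

lemma amat_add_mult_distrib:
  assumes "entries_in R M" "entries_in R N" "entries_in R P"
    and "dim_row M = dim_row N" "dim_col M = dim_col N"
  shows "dim_col M = dim_row P \<Longrightarrow>
      amat_mult R (amat_add R M N) P = amat_add R (amat_mult R M P) (amat_mult R N P)"
    and "dim_col P = dim_row M \<Longrightarrow>
      amat_mult R P (amat_add R M N) = amat_add R (amat_mult R P M) (amat_mult R P N)"
proof -
  note c = entries_inD [OF assms(1)] entries_inD [OF assms(2)] entries_inD [OF assms(3)]
  show "amat_mult R (amat_add R M N) P = amat_add R (amat_mult R M P) (amat_mult R N P)"
    if "dim_col M = dim_row P"
  proof (rule eq_matI)
    fix i j
    assume "i < dim_row (amat_add R (amat_mult R M P) (amat_mult R N P))"
      and "j < dim_col (amat_add R (amat_mult R M P) (amat_mult R N P))"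
    then have ij: "i < dim_row M" "j < dim_col P" by auto
    have "amat_mult R (amat_add R M N) P $$ (i, j)
        = (\<Oplus>l\<in>{..<dim_row P}. M $$ (i, l) \<otimes> P $$ (l, j) \<oplus> N $$ (i, l) \<otimes> P $$ (l, j))"
      using ij c assms that by (auto simp: amat_mult_index l_distr simp del: finsum_addf intro!: finsum_cong')
    also have "\<dots> = (\<Oplus>l\<in>{..<dim_row P}. M $$ (i, l) \<otimes> P $$ (l, j))
        \<oplus> (\<Oplus>l\<in>{..<dim_row P}. N $$ (i, l) \<otimes> P $$ (l, j))"
      using ij c assms that by (intro finsum_addf) auto
    also have "\<dots> = amat_add R (amat_mult R M P) (amat_mult R N P) $$ (i, j)"
      using ij assms that by (simp add: amat_mult_index)
    finally show "amat_mult R (amat_add R M N) P $$ (i, j)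
        = amat_add R (amat_mult R M P) (amat_mult R N P) $$ (i, j)" .
  qed auto
  show "amat_mult R P (amat_add R M N) = amat_add R (amat_mult R P M) (amat_mult R P N)"
    if "dim_col P = dim_row M"
  proof (rule eq_matI)
    fix i j
    assume "i < dim_row (amat_add R (amat_mult R P M) (amat_mult R P N))"
      and "j < dim_col (amat_add R (amat_mult R P M) (amat_mult R P N))"
    then have ij: "i < dim_row P" "j < dim_col M" by auto
    have "amat_mult R P (amat_add R M N) $$ (i, j)
        = (\<Oplus>l\<in>{..<dim_col P}. P $$ (i, l) \<otimes> M $$ (l, j) \<oplus> P $$ (i, l) \<otimes> N $$ (l, j))"
      using ij c assms that by (auto simp: amat_mult_index r_distr simp del: finsum_addf intro!: finsum_cong')
    also have "\<dots> = (\<Oplus>l\<in>{..<dim_col P}. P $$ (i, l) \<otimes> M $$ (l, j))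
        \<oplus> (\<Oplus>l\<in>{..<dim_col P}. P $$ (i, l) \<otimes> N $$ (l, j))"
      using ij c assms that by (intro finsum_addf) auto
    also have "\<dots> = amat_add R (amat_mult R P M) (amat_mult R P N) $$ (i, j)"
      using ij assms that by (simp add: amat_mult_index)
    finally show "amat_mult R P (amat_add R M N) $$ (i, j)
        = amat_add R (amat_mult R P M) (amat_mult R P N) $$ (i, j)" .
  qed auto
qed

section \<open>Block matrices over a ring\<close>

lemma entries_in_four_block:
  assumes "entries_in R M1" "entries_in R M2" "entries_in R M3" "entries_in R M4"
    and "dim_row M2 = dim_row M1" "dim_col M2 = dim_col M4"
    and "dim_row M3 = dim_row M4" "dim_col M3 = dim_col M1"
  shows "entries_in R (four_block_mat M1 M2 M3 M4)"
  using assms unfolding entries_in_def by (auto simp: Let_def)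

lemma amat_mult_four_block:
  assumes "entries_in R M1" "entries_in R M2" "entries_in R M3" "entries_in R M4"
    and "dim_row M2 = dim_row M1" "dim_col M2 = dim_col M4"
    and "dim_row M3 = dim_row M4" "dim_col M3 = dim_col M1"
    and "entries_in R N1" "entries_in R N2" "entries_in R N3" "entries_in R N4"
    and "dim_row N2 = dim_row N1" "dim_col N2 = dim_col N4"
    and "dim_row N3 = dim_row N4" "dim_col N3 = dim_col N1"
    and "dim_col M1 = dim_row N1" "dim_col M4 = dim_row N4"
  shows "amat_mult R (four_block_mat M1 M2 M3 M4) (four_block_mat N1 N2 N3 N4)
    = four_block_mat
       (amat_add R (amat_mult R M1 N1) (amat_mult R M2 N3))
       (amat_add R (amat_mult R M1 N2) (amat_mult R M2 N4))
       (amat_add R (amat_mult R M3 N1) (amat_mult R M4 N3))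
       (amat_add R (amat_mult R M3 N2) (amat_mult R M4 N4))" (is "?L = ?R")
proof (rule eq_matI)
  let ?M = "four_block_mat M1 M2 M3 M4" and ?N = "four_block_mat N1 N2 N3 N4"
  have M: "entries_in R ?M" and N: "entries_in R ?N"
    using assms by (auto intro!: entries_in_four_block)
  note c = entries_inD [OF M] entries_inD [OF N]
    assms(1-4,9-12) [THEN entries_inD]
  fix i j
  assume "i < dim_row ?R" "j < dim_col ?R"
  then have ij: "i < dim_row M1 + dim_row M4" "j < dim_col N1 + dim_col N4"
    using assms by auto
  have "?L $$ (i, j) = (\<Oplus>l\<in>{..<dim_row N1 + dim_row N4}. ?M $$ (i, l) \<otimes> ?N $$ (l, j))"
    using ij assms by (simp add: amat_mult_index del: index_mat_four_block(1))
  also have "\<dots> = (\<Oplus>l\<in>{..<dim_row N1}. ?M $$ (i, l) \<otimes> ?N $$ (l, j))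
      \<oplus> (\<Oplus>l\<in>{..<dim_row N4}. ?M $$ (i, dim_row N1 + l) \<otimes> ?N $$ (dim_row N1 + l, j))"
    using ij assms by (intro finsum_lessThan_add m_closed c) auto
  also have "\<dots> = ?R $$ (i, j)"
  proof -
    \<comment> \<open>The four quadrants are treated at once: \<open>M'\<close> and
      \<open>M''\<close> are the blocks in the strip of row \<open>i\<close>, \<open>N'\<close> and
      \<open>N''\<close> those in the strip of column \<open>j\<close>, and \<open>i'\<close>,
      \<open>j'\<close> are the positions inside the strips.\<close>
    define M' where "M' = (if i < dim_row M1 then M1 else M3)"
    define M'' where "M'' = (if i < dim_row M1 then M2 else M4)"
    define i' where "i' = (if i < dim_row M1 then i else i - dim_row M1)"
    define N' where "N' = (if j < dim_col N1 then N1 else N2)"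
    define N'' where "N'' = (if j < dim_col N1 then N3 else N4)"
    define j' where "j' = (if j < dim_col N1 then j else j - dim_col N1)"
    note defs = M'_def M''_def i'_def N'_def N''_def j'_def
    have props: "entries_in R M'" "entries_in R M''" "entries_in R N'" "entries_in R N''"
      "i' < dim_row M'" "i' < dim_row M''" "j' < dim_col N'" "j' < dim_col N''"
      "dim_col M' = dim_row N1" "dim_col M'' = dim_row N4"
      "dim_row N' = dim_row N1" "dim_row N'' = dim_row N4"
      using assms ij by (auto simp: defs)
    have M: "?M $$ (i, l) = M' $$ (i', l)" if "l < dim_row N1" for l
      using assms ij that by (simp add: Let_def defs)
    have M2: "?M $$ (i, dim_row N1 + l) = M'' $$ (i', l)" if "l < dim_row N4" for l
      using assms ij that by (simp add: Let_def defs)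
    have N: "?N $$ (l, j) = N' $$ (l, j')" if "l < dim_row N1" for l
      using assms ij that by (simp add: Let_def defs)
    have N2: "?N $$ (dim_row N1 + l, j) = N'' $$ (l, j')" if "l < dim_row N4" for l
      using assms ij that by (simp add: Let_def defs)
    have "?R $$ (i, j) = amat_mult R M' N' $$ (i', j') \<oplus> amat_mult R M'' N'' $$ (i', j')"
      using assms ij by (simp add: Let_def defs)
    moreover have "(\<Oplus>l\<in>{..<dim_row N1}. ?M $$ (i, l) \<otimes> ?N $$ (l, j)) = amat_mult R M' N' $$ (i', j')"
      using props by (auto simp: amat_mult_index entries_in_def M N intro!: finsum_cong')
    moreover have "(\<Oplus>l\<in>{..<dim_row N4}. ?M $$ (i, dim_row N1 + l) \<otimes> ?N $$ (dim_row N1 + l, j))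
        = amat_mult R M'' N'' $$ (i', j')"
      using props by (auto simp: amat_mult_index entries_in_def M2 N2 intro!: finsum_cong')
    ultimately show ?thesis by simp
  qed
  finally show "?L $$ (i, j) = ?R $$ (i, j)" .
qed (use assms in auto)

lemma amat_one_four_block:
  "four_block_mat (amat_one R m) (amat_zero R m n) (amat_zero R n m) (amat_one R n)
     = amat_one R (m + n)"
proof (rule eq_matI)
  fix i j assume "i < dim_row (amat_one R (m + n))" "j < dim_col (amat_one R (m + n))"
  then have "i < m + n" "j < m + n" by simp_all
  then show "four_block_mat (amat_one R m) (amat_zero R m n) (amat_zero R n m) (amat_one R n) $$ (i, j)
      = amat_one R (m + n) $$ (i, j)"
    by (cases "i < m"; cases "j < m") (auto simp: Let_def)
qed simp_all

end


section \<open>Linear representations\<close>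

context unital_algebra
begin

lemma smult_class [simp]:
  "x \<in> carrier A \<Longrightarrow> c \<odot> x \<in> carrier A"
  "x \<in> carrier A \<Longrightarrow> (1::'k) \<odot> x = x"
  "x \<in> carrier A \<Longrightarrow> (0::'k) \<odot> x = \<zero>"
  "c \<odot> \<zero> = \<zero>"
  using smult_closed smult_one smult_l_null smult_r_null
  by (simp_all add: class_ring_simps)

lemma smult_class_distrib:
  "x \<in> carrier A \<Longrightarrow> (c + d) \<odot> x = c \<odot> x \<oplus> d \<odot> x"
  "x \<in> carrier A \<Longrightarrow> y \<in> carrier A \<Longrightarrow> c \<odot> (x \<oplus> y) = c \<odot> x \<oplus> c \<odot> y"
  "x \<in> carrier A \<Longrightarrow> (c * d) \<odot> x = c \<odot> (d \<odot> x)"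
  using smult_l_distr [of c d x] smult_r_distr [of c x y] smult_assoc1 [of c d x]
  by (simp_all add: class_ring_simps)

lemma smult_uminus:
  assumes "x \<in> carrier A" shows "(- c) \<odot> x = \<ominus> (c \<odot> x)"
proof -
  have "(- c) \<odot> x \<oplus> c \<odot> x = \<zero>"
    using assms by (simp flip: smult_class_distrib(1))
  then show ?thesis
    using assms by (intro minus_equality [symmetric]) auto
qed

lemma sum_smult:
  "finite I \<Longrightarrow> x \<in> carrier A \<Longrightarrow> (\<Sum>i\<in>I. f i) \<odot> x = (\<Oplus>i\<in>I. f i \<odot> x)"
  by (induction I rule: finite_induct) (simp_all add: smult_class_distrib(1) finsum_insert)

lemma smult_finsum:
  assumes "finite I" "\<And>i. i \<in> I \<Longrightarrow> f i \<in> carrier A"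
  shows "c \<odot> (\<Oplus>i\<in>I. f i) = (\<Oplus>i\<in>I. c \<odot> f i)"
  using assms by (induction I rule: finite_induct)
    (simp_all add: smult_class_distrib(2) finsum_insert Pi_iff finsum_closed)

lemma entries_in_tensor: "x \<in> carrier A \<Longrightarrow> entries_in A (tensor A M x)"
  by (simp add: entries_in_def)

lemma tensor_mult:
  assumes "dim_col M = dim_row N" "x \<in> carrier A" "y \<in> carrier A"
  shows "amat_mult A (tensor A M x) (tensor A N y) = tensor A (M * N) (x \<otimes> y)"
proof (rule eq_matI)
  fix i j assume "i < dim_row (tensor A (M * N) (x \<otimes> y))" "j < dim_col (tensor A (M * N) (x \<otimes> y))"
  then have ij: "i < dim_row M" "j < dim_col N" by simp_all
  have "amat_mult A (tensor A M x) (tensor A N y) $$ (i, j)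
      = (\<Oplus>l\<in>{..<dim_row N}. (M $$ (i, l) * N $$ (l, j)) \<odot> (x \<otimes> y))"
    using ij assms
    by (auto simp: amat_mult_index smult_mult_left smult_mult_right mult.commute
        simp flip: smult_class_distrib(3) intro!: finsum_cong')
  also have "\<dots> = (M * N) $$ (i, j) \<odot> (x \<otimes> y)"
    using ij assms by (simp add: sum_smult [symmetric] scalar_prod_def atLeast0LessThan)
  finally show "amat_mult A (tensor A M x) (tensor A N y) $$ (i, j) = tensor A (M * N) (x \<otimes> y) $$ (i, j)"
    using ij by simp
qed simp_all

lemma tensor_zero: "x \<in> carrier A \<Longrightarrow> tensor A (0\<^sub>m p q) x = amat_zero A p q"
  by (intro eq_matI) auto

lemma tensor_one: "tensor A (1\<^sub>m n) \<one> = amat_one A n"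
  by (intro eq_matI) auto

lemma tensor_four_block:
  assumes "dim_row M2 = dim_row M1" "dim_col M2 = dim_col M4"
    and "dim_row M3 = dim_row M4" "dim_col M3 = dim_col M1"
  shows "tensor A (four_block_mat M1 M2 M3 M4) x
    = four_block_mat (tensor A M1 x) (tensor A M2 x) (tensor A M3 x) (tensor A M4 x)"
  unfolding tensor_def using assms
  by (intro map_four_block_mat [of _ "dim_row M1" "dim_col M1" _ "dim_col M4" _ "dim_row M4"]) auto

end

text \<open>The pencil \<open>\<Lambda>(a)\<close>. It may be rectangular, because the sums with the
  coefficients \<open>fm_A\<close> and \<open>fm_B\<close> at a point \<open>I_s \<otimes> a\<close>
  will be recognized as pencils too.\<close>

definition linear_form ::
    "('k, 'a, 'm) module_scheme \<Rightarrow> 'k mat \<Rightarrow> ('d::finite \<Rightarrow> 'k mat) \<Rightarrow> ('d \<Rightarrow> 'a) \<Rightarrow> 'a mat" where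
  "linear_form A P Q a = mat (dim_row P) (dim_col P)
     (\<lambda>ij. P $$ ij \<odot>\<^bsub>A\<^esub> \<one>\<^bsub>A\<^esub> \<oplus>\<^bsub>A\<^esub> (\<Oplus>\<^bsub>A\<^esub>k\<in>UNIV. Q k $$ ij \<odot>\<^bsub>A\<^esub> a k))"

lemma linear_form_dims [simp]:
  "dim_row (linear_form A P Q a) = dim_row P" "dim_col (linear_form A P Q a) = dim_col P"
  by (simp_all add: linear_form_def)

lemma linear_form_four_block:
  assumes "dim_row P2 = dim_row P1" "dim_col P2 = dim_col P4"
    and "dim_row P3 = dim_row P4" "dim_col P3 = dim_col P1"
    and "\<And>k. dim_row (Q1 k) = dim_row P1" "\<And>k. dim_col (Q1 k) = dim_col P1"
    and "\<And>k. dim_row (Q4 k) = dim_row P4" "\<And>k. dim_col (Q4 k) = dim_col P4"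
  shows "linear_form A (four_block_mat P1 P2 P3 P4) (\<lambda>k. four_block_mat (Q1 k) (Q2 k) (Q3 k) (Q4 k)) a
    = four_block_mat (linear_form A P1 Q1 a) (linear_form A P2 Q2 a)
        (linear_form A P3 Q3 a) (linear_form A P4 Q4 a)"
  using assms by (intro eq_matI) (auto simp: linear_form_def Let_def)

context unital_algebra
begin

lemma entries_in_linear_form:
  "(\<And>k. a k \<in> carrier A) \<Longrightarrow> entries_in A (linear_form A P Q a)"
  by (auto simp: linear_form_def intro!: entries_in_mat finsum_closed)

lemma linear_form_const:
  assumes "\<And>k. a k \<in> carrier A" "p = dim_row P" "q = dim_col P"
  shows "linear_form A P (\<lambda>_. 0\<^sub>m p q) a = tensor A P \<one>"
  using assms by (intro eq_matI) (auto simp: linear_form_def)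

end


section \<open>Linear representations and the operations on them\<close>

text \<open>The fields are the size and then \<open>c\<close>, \<open>P\<close>, the
  \<open>Q_k\<close> and \<open>b\<close>. All of them are scalar, so one record serves every
  algebra.\<close>

record ('k, 'd) lin_rep =
  lr_dim :: nat
  lr_row :: "'k mat"
  lr_const :: "'k mat"
  lr_lin :: "'d \<Rightarrow> 'k mat"
  lr_col :: "'k mat"

definition lin_rep_wf :: "('k, 'd) lin_rep \<Rightarrow> bool" where
  "lin_rep_wf \<rho> \<longleftrightarrow> lr_dim \<rho> \<ge> 1 \<and> lr_row \<rho> \<in> carrier_mat 1 (lr_dim \<rho>) \<and>
     lr_const \<rho> \<in> carrier_mat (lr_dim \<rho>) (lr_dim \<rho>) \<and>
     (\<forall>k. lr_lin \<rho> k \<in> carrier_mat (lr_dim \<rho>) (lr_dim \<rho>)) \<and>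
     lr_col \<rho> \<in> carrier_mat (lr_dim \<rho>) 1"

abbreviation lr_form :: "('k, 'a, 'm) module_scheme \<Rightarrow> ('k, 'd::finite) lin_rep \<Rightarrow> ('d \<Rightarrow> 'a) \<Rightarrow> 'a mat" where
  "lr_form A \<rho> a \<equiv> linear_form A (lr_const \<rho>) (lr_lin \<rho>) a"

text \<open>Existence of a two-sided inverse is part of the claim; it later becomes membership in
  the domain of the realization. The value is wrapped in a 1 by 1 matrix so that matrix identities
  apply to it.\<close>

definition represents ::
    "('k, 'a, 'm) module_scheme \<Rightarrow> ('k, 'd::finite) lin_rep \<Rightarrow> ('d \<Rightarrow> 'a) \<Rightarrow> 'a \<Rightarrow> bool" where
  "represents A \<rho> a r \<longleftrightarrow> (\<exists>V \<in> amat_carrier A (lr_dim \<rho>) (lr_dim \<rho>).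
     amat_mult A (lr_form A \<rho> a) V = amat_one A (lr_dim \<rho>) \<and>
     amat_mult A V (lr_form A \<rho> a) = amat_one A (lr_dim \<rho>) \<and>
     amat_mult A (amat_mult A (tensor A (lr_row \<rho>) \<one>\<^bsub>A\<^esub>) V) (tensor A (lr_col \<rho>) \<one>\<^bsub>A\<^esub>)
       = mat 1 1 (\<lambda>_. r))"

text \<open>Concatenation is encoded as a four-block matrix with an empty second block row (for
  \<open>col_append\<close>, block column), so that the product rule for block matrices also
  evaluates \<open>c V b\<close>.\<close>

abbreviation row_append :: "'k::zero mat \<Rightarrow> 'k mat \<Rightarrow> 'k mat" where
  "row_append M N \<equiv> four_block_mat M N (0\<^sub>m 0 (dim_col M)) (0\<^sub>m 0 (dim_col N))"

abbreviation col_append :: "'k::zero mat \<Rightarrow> 'k mat \<Rightarrow> 'k mat" where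
  "col_append M N \<equiv> four_block_mat M (0\<^sub>m (dim_row M) 0) N (0\<^sub>m (dim_row N) 0)"

definition rep_const :: "'k::field \<Rightarrow> ('k, 'd) lin_rep" where
  "rep_const t = \<lparr>lr_dim = 1, lr_row = mat 1 1 (\<lambda>_. t), lr_const = 1\<^sub>m 1,
     lr_lin = (\<lambda>_. 0\<^sub>m 1 1), lr_col = 1\<^sub>m 1\<rparr>"

text \<open>The pencil is \<open>[1, -x_j; 0, 1]\<close> with inverse \<open>[1, x_j; 0, 1]\<close>;
  the row \<open>(1, 0)\<close> and the column \<open>(0, 1)\<close> select the upper right entry.
  The size is written \<open>1 + 1\<close> to match the block lemmas.\<close>

definition rep_var :: "'d \<Rightarrow> ('k::field, 'd) lin_rep" where
  "rep_var j = \<lparr>lr_dim = 1 + 1, lr_row = row_append (1\<^sub>m 1) (0\<^sub>m 1 1),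
     lr_const = four_block_mat (1\<^sub>m 1) (0\<^sub>m 1 1) (0\<^sub>m 1 1) (1\<^sub>m 1),
     lr_lin = (\<lambda>k. four_block_mat (0\<^sub>m 1 1) (if k = j then - 1\<^sub>m 1 else 0\<^sub>m 1 1) (0\<^sub>m 1 1) (0\<^sub>m 1 1)),
     lr_col = col_append (0\<^sub>m 1 1) (1\<^sub>m 1)\<rparr>"

definition rep_add :: "('k::field, 'd) lin_rep \<Rightarrow> ('k, 'd) lin_rep \<Rightarrow> ('k, 'd) lin_rep" where
  "rep_add \<rho> \<sigma> = (let m = lr_dim \<rho>; n = lr_dim \<sigma> in
     \<lparr>lr_dim = m + n, lr_row = row_append (lr_row \<rho>) (lr_row \<sigma>),
      lr_const = four_block_mat (lr_const \<rho>) (0\<^sub>m m n) (0\<^sub>m n m) (lr_const \<sigma>),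
      lr_lin = (\<lambda>k. four_block_mat (lr_lin \<rho> k) (0\<^sub>m m n) (0\<^sub>m n m) (lr_lin \<sigma> k)),
      lr_col = col_append (lr_col \<rho>) (lr_col \<sigma>)\<rparr>)"

text \<open>The block \<open>-b\<^sub>1 c\<^sub>2\<close> makes
  \<open>V\<^sub>1 b\<^sub>1 c\<^sub>2 V\<^sub>2\<close> the upper right block of the inverse, so
  that the outer row and column yield the product of the two values.\<close>

definition rep_mul :: "('k::field, 'd) lin_rep \<Rightarrow> ('k, 'd) lin_rep \<Rightarrow> ('k, 'd) lin_rep" where
  "rep_mul \<rho> \<sigma> = (let m = lr_dim \<rho>; n = lr_dim \<sigma> in
     \<lparr>lr_dim = m + n, lr_row = row_append (lr_row \<rho>) (0\<^sub>m 1 n),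
      lr_const = four_block_mat (lr_const \<rho>) (- (lr_col \<rho> * lr_row \<sigma>)) (0\<^sub>m n m) (lr_const \<sigma>),
      lr_lin = (\<lambda>k. four_block_mat (lr_lin \<rho> k) (0\<^sub>m m n) (0\<^sub>m n m) (lr_lin \<sigma> k)),
      lr_col = col_append (0\<^sub>m m 1) (lr_col \<sigma>)\<rparr>)"

text \<open>The new row and column select the lower right entry of the inverse of the bordered
  pencil; that entry is the inverse of the Schur complement
  \<open>0 - c V (-b) = c V b\<close>.\<close>

definition rep_inv :: "('k::field, 'd) lin_rep \<Rightarrow> ('k, 'd) lin_rep" where
  "rep_inv \<rho> = (let n = lr_dim \<rho> in
     \<lparr>lr_dim = n + 1, lr_row = row_append (0\<^sub>m 1 n) (1\<^sub>m 1),
      lr_const = four_block_mat (lr_const \<rho>) (- lr_col \<rho>) (lr_row \<rho>) (0\<^sub>m 1 1),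
      lr_lin = (\<lambda>k. four_block_mat (lr_lin \<rho> k) (0\<^sub>m n 1) (0\<^sub>m 1 n) (0\<^sub>m 1 1)),
      lr_col = col_append (0\<^sub>m n 1) (1\<^sub>m 1)\<rparr>)"

lemma lin_rep_wf_const: "lin_rep_wf (rep_const t)"
  by (simp add: lin_rep_wf_def rep_const_def)

lemma lin_rep_wf_var: "lin_rep_wf (rep_var j)"
  by (auto simp: lin_rep_wf_def rep_var_def)

lemma lin_rep_wf_add: "lin_rep_wf \<rho> \<Longrightarrow> lin_rep_wf \<sigma> \<Longrightarrow> lin_rep_wf (rep_add \<rho> \<sigma>)"
  by (auto simp: lin_rep_wf_def rep_add_def Let_def)

lemma lin_rep_wf_mul: "lin_rep_wf \<rho> \<Longrightarrow> lin_rep_wf \<sigma> \<Longrightarrow> lin_rep_wf (rep_mul \<rho> \<sigma>)"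
  by (auto simp: lin_rep_wf_def rep_mul_def Let_def)

lemma lin_rep_wf_inv: "lin_rep_wf \<rho> \<Longrightarrow> lin_rep_wf (rep_inv \<rho>)"
  by (auto simp: lin_rep_wf_def rep_inv_def Let_def simp del: One_nat_def)


section \<open>Explicit inverses of block matrices\<close>

context ring
begin

lemma amat_add_zero:
  assumes "entries_in R M" "p = dim_row M" "q = dim_col M"
  shows "amat_add R M (amat_zero R p q) = M" "amat_add R (amat_zero R p q) M = M"
  using assms by (auto intro!: eq_matI simp: entries_in_def)

lemma amat_add_comm:
  "entries_in R M \<Longrightarrow> entries_in R N \<Longrightarrow> dim_row M = dim_row N \<Longrightarrow> dim_col M = dim_col N \<Longrightarrow>
     amat_add R M N = amat_add R N M"
  by (intro eq_matI) (auto simp: entries_inD a_comm)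

lemma amat_add_assoc:
  "entries_in R M \<Longrightarrow> entries_in R N \<Longrightarrow> entries_in R P \<Longrightarrow> dim_row M = dim_row N \<Longrightarrow>
     dim_col M = dim_col N \<Longrightarrow> dim_row N = dim_row P \<Longrightarrow> dim_col N = dim_col P \<Longrightarrow>
     amat_add R (amat_add R M N) P = amat_add R M (amat_add R N P)"
  by (intro eq_matI) (auto simp: entries_inD a_assoc)

text \<open>Negatives are handled as pairs of matrices with sum zero, and this is their uniqueness.
  It yields \<open>(-c) V (-b) = c V b\<close> without expanding products into entries.\<close>

lemma amat_neg_unique:
  assumes "amat_add R M P = amat_zero R p q" "amat_add R N P = amat_zero R p q"
    and "entries_in R M" "entries_in R N" "entries_in R P"
    and "M \<in> carrier_mat p q" "N \<in> carrier_mat p q" "P \<in> carrier_mat p q"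
  shows "M = N"
proof (rule eq_matI)
  fix i j assume "i < dim_row N" "j < dim_col N"
  then have ij: "i < p" "j < q" using assms by auto
  have "M $$ (i, j) \<oplus> P $$ (i, j) = N $$ (i, j) \<oplus> P $$ (i, j)"
    using assms ij amat_index(1) [of i M j R P] amat_index(1) [of i N j R P] by auto
  then show "M $$ (i, j) = N $$ (i, j)"
    using ij assms by (auto simp: entries_in_def)
qed (use assms in auto)

text \<open>The nesting to the right lets an inverse pair be cancelled inside a longer product that
  \<open>amat_mult_assoc\<close> has reassociated.\<close>

lemma amat_inverse_cancel:
  assumes "amat_mult R M N = amat_one R n" "entries_in R M" "entries_in R N" "entries_in R X"
    and "dim_col M = dim_row N" "dim_col N = dim_row X" "dim_row X = n"
  shows "amat_mult R M (amat_mult R N X) = X"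
  using assms by (simp add: amat_mult_one flip: amat_mult_assoc)

text \<open>Here \<open>B = -C\<close>. The upper right block of \<open>L V\<close> is
  \<open>C V2 + B V2 = 0\<close>, that of \<open>V L\<close> is \<open>V1 B + V1 C = 0\<close>.
  Variables, sums and products use it with \<open>C\<close> equal to the value of the variable, to
  zero and to \<open>b\<^sub>1 c\<^sub>2\<close>.\<close>

lemma amat_block_triangular_inverse:
  assumes "L1 \<in> amat_carrier R m m" "V1 \<in> amat_carrier R m m"
    and "L2 \<in> amat_carrier R n n" "V2 \<in> amat_carrier R n n"
    and "B \<in> amat_carrier R m n" "C \<in> amat_carrier R m n"
    and inv: "amat_mult R L1 V1 = amat_one R m" "amat_mult R V1 L1 = amat_one R m"
      "amat_mult R L2 V2 = amat_one R n" "amat_mult R V2 L2 = amat_one R n"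
    and BC: "amat_add R C B = amat_zero R m n"
  defines "L \<equiv> four_block_mat L1 B (amat_zero R n m) L2"
    and "V \<equiv> four_block_mat V1 (amat_mult R V1 (amat_mult R C V2)) (amat_zero R n m) V2"
  shows "amat_mult R L V = amat_one R (m + n)" "amat_mult R V L = amat_one R (m + n)"
proof -
  have d [simp]: "dim_row L1 = m" "dim_col L1 = m" "dim_row L2 = n" "dim_col L2 = n"
    "dim_row V1 = m" "dim_col V1 = m" "dim_row V2 = n" "dim_col V2 = n"
    "dim_row B = m" "dim_col B = n" "dim_row C = m" "dim_col C = n"
    and e [simp]: "entries_in R L1" "entries_in R L2" "entries_in R V1" "entries_in R V2"
      "entries_in R B" "entries_in R C"
    using assms by (auto simp: amat_carrier_iff)
  have "amat_add R (amat_mult R L1 (amat_mult R V1 (amat_mult R C V2))) (amat_mult R B V2)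
      = amat_mult R (amat_add R C B) V2"
    by (simp add: amat_inverse_cancel [OF inv(1)] entries_in_amat amat_add_mult_distrib)
  then have "amat_add R (amat_mult R L1 (amat_mult R V1 (amat_mult R C V2))) (amat_mult R B V2)
      = amat_zero R m n"
    by (simp add: BC amat_mult_zero)
  then show "amat_mult R L V = amat_one R (m + n)"
    unfolding L_def V_def
    by (simp add: amat_mult_four_block entries_in_amat amat_mult_zero amat_add_zero inv
        amat_one_four_block)
  have "amat_mult R (amat_mult R V1 (amat_mult R C V2)) L2
      = amat_mult R V1 C"
    by (simp add: amat_mult_assoc entries_in_amat inv amat_mult_one)
  then have "amat_add R (amat_mult R V1 B) (amat_mult R (amat_mult R V1 (amat_mult R C V2)) L2)
      = amat_mult R V1 (amat_add R B C)"
    by (simp add: entries_in_amat amat_add_mult_distrib)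
  also have "amat_add R B C = amat_add R C B"
    by (simp add: amat_add_comm)
  also have "amat_mult R V1 (amat_add R C B) = amat_zero R m n"
    by (simp add: BC amat_mult_zero)
  finally show "amat_mult R V L = amat_one R (m + n)"
    unfolding L_def V_def
    by (simp add: amat_mult_four_block entries_in_amat amat_mult_zero amat_add_zero inv
        amat_one_four_block)
qed

text \<open>The Schur complement of \<open>L\<close> in the matrix \<open>[L, -b; c, 0]\<close> is \<open>r = c V b\<close>, where \<open>V\<close>
  is the inverse of \<open>L\<close>.\<close>

lemma amat_schur_inverse:
  assumes "L \<in> amat_carrier R n n" "V \<in> amat_carrier R n n"
    and "b \<in> amat_carrier R n p" "b' \<in> amat_carrier R n p"
    and "c \<in> amat_carrier R p n" "c' \<in> amat_carrier R p n"
    and "q \<in> amat_carrier R p p"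
    and LV: "amat_mult R L V = amat_one R n" "amat_mult R V L = amat_one R n"
    and bb: "amat_add R b b' = amat_zero R n p" and cc: "amat_add R c c' = amat_zero R p n"
    and rq: "amat_mult R (amat_mult R (amat_mult R c V) b) q = amat_one R p"
      "amat_mult R q (amat_mult R (amat_mult R c V) b) = amat_one R p"
  defines "M \<equiv> four_block_mat L b' c (amat_zero R p p)"
    and "W \<equiv> four_block_mat
      (amat_add R V (amat_mult R V (amat_mult R b (amat_mult R q (amat_mult R c' V)))))
      (amat_mult R V (amat_mult R b q)) (amat_mult R q (amat_mult R c' V)) q"
  shows "amat_mult R M W = amat_one R (n + p)" "amat_mult R W M = amat_one R (n + p)"
proof -
  have d [simp]: "dim_row L = n" "dim_col L = n" "dim_row V = n" "dim_col V = n"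
    "dim_row b = n" "dim_col b = p" "dim_row b' = n" "dim_col b' = p"
    "dim_row c = p" "dim_col c = n" "dim_row c' = p" "dim_col c' = n" "dim_row q = p" "dim_col q = p"
    and e [simp]: "entries_in R L" "entries_in R V" "entries_in R b" "entries_in R b'"
      "entries_in R c" "entries_in R c'" "entries_in R q"
    using assms by (auto simp: amat_carrier_iff)
  note [simp] = entries_in_amat
  note zero = amat_mult_zero amat_add_zero
  note LV' = amat_inverse_cancel [OF LV(1)] amat_inverse_cancel [OF LV(2)]
  have cVbq: "amat_mult R c (amat_mult R V (amat_mult R b q)) = amat_one R p"
    using rq(1) by (simp add: amat_mult_assoc)
  have cVbq': "amat_mult R c (amat_mult R V (amat_mult R b (amat_mult R q X))) = X"
    if "entries_in R X" "dim_row X = p" for X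
    using amat_inverse_cancel [OF rq(1), of X] that by (simp add: amat_mult_assoc)
  have qcVb: "amat_mult R q (amat_mult R c (amat_mult R V b)) = amat_one R p"
    using rq(2) by (simp add: amat_mult_assoc)
  have bb': "amat_add R (amat_mult R b X) (amat_mult R b' X) = amat_zero R n (dim_col X)"
    if "entries_in R X" "dim_row X = p" for X
    using that by (simp add: bb amat_mult_zero flip: amat_add_mult_distrib)
  have cc': "amat_add R (amat_mult R c X) (amat_mult R c' X) = amat_zero R p (dim_col X)"
    if "entries_in R X" "dim_row X = n" for X
    using that by (simp add: cc amat_mult_zero flip: amat_add_mult_distrib)
  \<comment> \<open>With \<open>b' = -b\<close> and \<open>c' = -c\<close>, both sides are the
    negative of \<open>c V b'\<close>.\<close>
  have c'Vb': "amat_mult R c' (amat_mult R V b') = amat_mult R c (amat_mult R V b)"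
  proof (rule amat_neg_unique)
    show "amat_add R (amat_mult R c' (amat_mult R V b')) (amat_mult R c (amat_mult R V b')) = amat_zero R p p"
      using cc' [of "amat_mult R V b'"] by (simp add: amat_add_comm)
    show "amat_add R (amat_mult R c (amat_mult R V b)) (amat_mult R c (amat_mult R V b')) = amat_zero R p p"
      by (simp add: bb amat_mult_zero flip: amat_add_mult_distrib)
  qed auto
  \<comment> \<open>Since \<open>q\<close> inverts the Schur complement, the lower right block is
    \<open>c V b q = 1\<close>. The upper right block is \<open>b q + b' q = 0\<close>, the lower
    left one \<open>c V + c' V = 0\<close>, and in the upper left one the terms in \<open>b\<close>
    and \<open>b'\<close> cancel.\<close>
  show "amat_mult R M W = amat_one R (n + p)"
    unfolding M_def W_def amat_one_four_block [symmetric]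
    by (subst amat_mult_four_block)
       (simp_all add: amat_add_mult_distrib amat_add_assoc amat_mult_assoc LV LV' bb' cc' cVbq cVbq' zero)
  \<comment> \<open>The cancellations for \<open>W M\<close>: fact \<open>1\<close> serves the upper
    left block, \<open>3\<close> the lower left one, and \<open>2\<close> the upper right one after
    \<open>q c' V b'\<close> has been reduced to the identity.\<close>
  have 1: "amat_add R (amat_mult R V (amat_mult R b (amat_mult R q c')))
      (amat_mult R V (amat_mult R b (amat_mult R q c))) = amat_zero R n n"
    using cc by (simp add: amat_add_comm [of c'] zero flip: amat_add_mult_distrib)
  have 2: "amat_add R (amat_mult R V b') (amat_mult R V b) = amat_zero R n p"
    using bb by (simp add: amat_add_comm [of b'] zero flip: amat_add_mult_distrib)
  have 3: "amat_add R (amat_mult R q c') (amat_mult R q c) = amat_zero R p n"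
    using cc by (simp add: amat_add_comm [of c'] zero flip: amat_add_mult_distrib)
  show "amat_mult R W M = amat_one R (n + p)"
    unfolding M_def W_def amat_one_four_block [symmetric]
    by (subst amat_mult_four_block)
       (simp_all add: amat_add_mult_distrib amat_add_assoc amat_mult_assoc LV amat_mult_one
          c'Vb' qcVb 1 2 3 zero)
qed

lemma amat_mult_singleton:
  assumes "x \<in> carrier R" "y \<in> carrier R"
  shows "amat_mult R (mat 1 1 (\<lambda>_. x)) (mat 1 1 (\<lambda>_. y)) = mat 1 1 (\<lambda>_. x \<otimes> y)"
  using assms by (intro eq_matI) (auto simp: amat_mult_index lessThan_Suc)

end

lemma four_block_mat_degenerate:
  assumes "dim_row M4 = 0" "dim_col M4 = 0"
  shows "four_block_mat M1 M2 M3 M4 = M1"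
  using assms by (intro eq_matI) (auto simp: Let_def)

text \<open>The value \<open>c V b\<close> splits into the four terms \<open>c_i V_ij b_j\<close>;
  \<open>Z1\<close> to \<open>Z4\<close> are the empty blocks of the concatenations.\<close>

lemma (in unital_algebra) amat_mult_append:
  assumes c: "dim_row c1 = dim_row c2" "dim_col c1 = dim_row V1" "dim_col c2 = dim_row V4"
    and b: "dim_col b1 = dim_col b2" "dim_row b1 = dim_col V1" "dim_row b2 = dim_col V4"
    and V: "dim_row V2 = dim_row V1" "dim_col V2 = dim_col V4"
       "dim_row V3 = dim_row V4" "dim_col V3 = dim_col V1"
    and Z: "dim_row Z1 = 0" "dim_col Z1 = dim_col c1" "dim_row Z2 = 0" "dim_col Z2 = dim_col c2"
       "dim_row Z3 = dim_row b1" "dim_col Z3 = 0" "dim_row Z4 = dim_row b2" "dim_col Z4 = 0"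
    and e: "entries_in A V1" "entries_in A V2" "entries_in A V3" "entries_in A V4"
  shows "amat_mult A (amat_mult A (tensor A (four_block_mat c1 c2 Z1 Z2) \<one>) (four_block_mat V1 V2 V3 V4))
      (tensor A (four_block_mat b1 Z3 b2 Z4) \<one>)
    = amat_add A
       (amat_add A (amat_mult A (amat_mult A (tensor A c1 \<one>) V1) (tensor A b1 \<one>))
         (amat_mult A (amat_mult A (tensor A c2 \<one>) V3) (tensor A b1 \<one>)))
       (amat_add A (amat_mult A (amat_mult A (tensor A c1 \<one>) V2) (tensor A b2 \<one>))
         (amat_mult A (amat_mult A (tensor A c2 \<one>) V4) (tensor A b2 \<one>)))"
  using assms
  by (simp add: tensor_four_block amat_mult_four_block entries_in_amat entries_in_tensor
      four_block_mat_degenerate amat_add_mult_distrib)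


lemma lin_rep_wf_dims:
  assumes "lin_rep_wf \<rho>"
  shows "dim_row (lr_row \<rho>) = 1" "dim_col (lr_row \<rho>) = lr_dim \<rho>"
    "dim_row (lr_const \<rho>) = lr_dim \<rho>" "dim_col (lr_const \<rho>) = lr_dim \<rho>"
    "dim_row (lr_lin \<rho> k) = lr_dim \<rho>" "dim_col (lr_lin \<rho> k) = lr_dim \<rho>"
    "dim_row (lr_col \<rho>) = lr_dim \<rho>" "dim_col (lr_col \<rho>) = 1"
  using assms by (auto simp: lin_rep_wf_def)

section \<open>Representations of constants, variables, sums, products and inverses\<close>

context unital_algebra
begin

lemma represents_const:
  assumes "\<And>k. a k \<in> carrier A"
  shows "represents A (rep_const t) a (t \<odot> \<one>)"
  unfolding represents_def
proof (intro bexI conjI)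
  have 1: "tensor A (1\<^sub>m 1) \<one> = amat_one A 1"
    by (rule tensor_one)
  show "amat_one A 1 \<in> amat_carrier A (lr_dim (rep_const t)) (lr_dim (rep_const t))"
    by (simp add: amat_carrier_iff rep_const_def entries_in_amat)
  show "amat_mult A (lr_form A (rep_const t) a) (amat_one A 1) = amat_one A (lr_dim (rep_const t))"
    "amat_mult A (amat_one A 1) (lr_form A (rep_const t) a) = amat_one A (lr_dim (rep_const t))"
    using assms 1 by (simp_all add: rep_const_def linear_form_const amat_mult_one entries_in_amat)
  show "amat_mult A (amat_mult A (tensor A (lr_row (rep_const t)) \<one>) (amat_one A 1))
      (tensor A (lr_col (rep_const t)) \<one>) = mat 1 1 (\<lambda>_. t \<odot> \<one>)"
    using 1 by (simp add: rep_const_def amat_mult_one entries_in_tensor) (auto intro!: eq_matI)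
qed

lemma represents_var:
  assumes a: "\<And>k. a k \<in> carrier A"
  shows "represents A (rep_var j) a (a j)"
  unfolding represents_def
proof (intro bexI conjI)
  define \<xi> where "\<xi> = mat 1 1 (\<lambda>_. a j)"
  \<comment> \<open>The shape required by \<open>amat_block_triangular_inverse\<close>, with
    identities as diagonal inverses and \<open>\<xi>\<close> as \<open>C\<close>.\<close>
  define V where "V = four_block_mat (amat_one A 1)
    (amat_mult A (amat_one A 1) (amat_mult A \<xi> (amat_one A 1))) (amat_zero A 1 1) (amat_one A 1)"
  define B where "B = linear_form A (0\<^sub>m 1 1) (\<lambda>k. if k = j then - 1\<^sub>m 1 else 0\<^sub>m 1 1) a"
  have one: "tensor A (1\<^sub>m 1) \<one> = amat_one A 1"
    by (rule tensor_one)
  have \<xi>: "\<xi> \<in> amat_carrier A 1 1"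
    using a by (simp add: amat_carrier_iff \<xi>_def entries_in_def)
  have V_eq: "V = four_block_mat (amat_one A 1) \<xi> (amat_zero A 1 1) (amat_one A 1)"
    using \<xi> by (simp add: V_def amat_carrier_iff amat_mult_one)
  have L: "lr_form A (rep_var j) a = four_block_mat (amat_one A 1) B (amat_zero A 1 1) (amat_one A 1)"
    using a one by (simp add: rep_var_def linear_form_four_block linear_form_const tensor_zero B_def
        del: four_block_one_mat One_nat_def)
  have "B = mat 1 1 (\<lambda>_. \<ominus> a j)"
  proof (rule eq_matI)
    fix p q assume "p < dim_row (mat 1 1 (\<lambda>_. \<ominus> a j))" "q < dim_col (mat 1 1 (\<lambda>_. \<ominus> a j))"
    then have [simp]: "p = 0" "q = 0" by auto
    have "B $$ (p, q) = (\<Oplus>k\<in>UNIV. if j = k then \<ominus> a k else \<zero>)"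
      using a by (auto simp: B_def linear_form_def smult_uminus finsum_closed intro!: finsum_cong' trans [OF l_zero])
    also have "\<dots> = \<ominus> a j"
      using a by (intro add.finprod_singleton) auto
    finally show "B $$ (p, q) = mat 1 1 (\<lambda>_. \<ominus> a j) $$ (p, q)" by simp
  qed (simp_all add: B_def)
  then have B: "B \<in> amat_carrier A 1 1" and \<xi>B: "amat_add A \<xi> B = amat_zero A 1 1"
    using a by (auto simp: amat_carrier_iff entries_in_def \<xi>_def r_neg intro!: eq_matI)
  show "V \<in> amat_carrier A (lr_dim (rep_var j)) (lr_dim (rep_var j))"
    using \<xi> unfolding V_eq rep_var_def by (auto simp: amat_carrier_iff entries_in_amat intro!: entries_in_four_block)
  have *: "amat_mult A (lr_form A (rep_var j) a) V = amat_one A (1 + 1)"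
    "amat_mult A V (lr_form A (rep_var j) a) = amat_one A (1 + 1)"
    unfolding L V_def using \<xi> B \<xi>B
    by (intro amat_block_triangular_inverse; simp add: amat_carrier_iff amat_mult_one entries_in_amat)+
  show "amat_mult A (lr_form A (rep_var j) a) V = amat_one A (lr_dim (rep_var j))"
    "amat_mult A V (lr_form A (rep_var j) a) = amat_one A (lr_dim (rep_var j))"
    using * by (simp_all add: rep_var_def)
  show "amat_mult A (amat_mult A (tensor A (lr_row (rep_var j)) \<one>) V) (tensor A (lr_col (rep_var j)) \<one>)
      = mat 1 1 (\<lambda>_. a j)"
    using \<xi> one unfolding rep_var_def V_eq
    by (simp add: amat_mult_append amat_carrier_iff entries_in_amat tensor_zero amat_mult_one
        amat_mult_zero amat_add_zero \<xi>_def)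
qed

lemma represents_add:
  assumes wf: "lin_rep_wf \<rho>" "lin_rep_wf \<sigma>"
    and rep: "represents A \<rho> a r" "represents A \<sigma> a t"
    and a: "\<And>k. a k \<in> carrier A" and rt: "r \<in> carrier A" "t \<in> carrier A"
  shows "represents A (rep_add \<rho> \<sigma>) a (r \<oplus> t)"
proof -
  define m n where "m = lr_dim \<rho>" and "n = lr_dim \<sigma>"
  obtain V where V: "V \<in> amat_carrier A m m"
    "amat_mult A (lr_form A \<rho> a) V = amat_one A m" "amat_mult A V (lr_form A \<rho> a) = amat_one A m"
    "amat_mult A (amat_mult A (tensor A (lr_row \<rho>) \<one>) V) (tensor A (lr_col \<rho>) \<one>) = mat 1 1 (\<lambda>_. r)"
    using rep(1) unfolding represents_def m_def by blast
  obtain W where W: "W \<in> amat_carrier A n n"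
    "amat_mult A (lr_form A \<sigma> a) W = amat_one A n" "amat_mult A W (lr_form A \<sigma> a) = amat_one A n"
    "amat_mult A (amat_mult A (tensor A (lr_row \<sigma>) \<one>) W) (tensor A (lr_col \<sigma>) \<one>) = mat 1 1 (\<lambda>_. t)"
    using rep(2) unfolding represents_def n_def by blast
  note dims [simp] = lin_rep_wf_dims [OF wf(1), folded m_def] lin_rep_wf_dims [OF wf(2), folded n_def]
  have [simp]: "dim_row V = m" "dim_col V = m" "dim_row W = n" "dim_col W = n"
    and [simp]: "entries_in A V" "entries_in A W"
    using V(1) W(1) by (auto simp: amat_carrier_iff)
  note [simp] = entries_in_amat entries_in_tensor
  \<comment> \<open>The same shape with the zero matrix as \<open>C\<close>.\<close>
  define U where "U = four_block_mat V (amat_mult A V (amat_mult A (amat_zero A m n) W)) (amat_zero A n m) W"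
  have U: "U = four_block_mat V (amat_zero A m n) (amat_zero A n m) W"
    by (simp add: U_def amat_mult_zero)
  have L: "lr_form A (rep_add \<rho> \<sigma>) a
      = four_block_mat (lr_form A \<rho> a) (amat_zero A m n) (amat_zero A n m) (lr_form A \<sigma> a)"
    using a by (simp add: rep_add_def Let_def linear_form_four_block linear_form_const tensor_zero
        flip: m_def n_def)
  have dim: "lr_dim (rep_add \<rho> \<sigma>) = m + n"
    by (simp add: rep_add_def Let_def m_def n_def)
  have "amat_mult A (lr_form A (rep_add \<rho> \<sigma>) a) U = amat_one A (m + n)"
    "amat_mult A U (lr_form A (rep_add \<rho> \<sigma>) a) = amat_one A (m + n)"
    unfolding L U_def using V W a
    by (intro amat_block_triangular_inverse;
        simp add: amat_carrier_iff entries_in_linear_form amat_add_zero)+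
  moreover have "U \<in> amat_carrier A (m + n) (m + n)"
    by (auto simp: U amat_carrier_iff intro!: entries_in_four_block)
  moreover have "amat_mult A (amat_mult A (tensor A (lr_row (rep_add \<rho> \<sigma>)) \<one>) U)
      (tensor A (lr_col (rep_add \<rho> \<sigma>)) \<one>) = mat 1 1 (\<lambda>_. r \<oplus> t)"
    using V(4) W(4) unfolding U rep_add_def Let_def
    by (simp add: amat_mult_append amat_mult_zero amat_add_zero del: One_nat_def)
       (use rt in \<open>auto intro!: eq_matI\<close>)
  ultimately show ?thesis
    unfolding represents_def dim by blast
qed

lemma represents_mul:
  assumes wf: "lin_rep_wf \<rho>" "lin_rep_wf \<sigma>"
    and rep: "represents A \<rho> a r" "represents A \<sigma> a t"
    and a: "\<And>k. a k \<in> carrier A" and rt: "r \<in> carrier A" "t \<in> carrier A"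
  shows "represents A (rep_mul \<rho> \<sigma>) a (r \<otimes> t)"
proof -
  define m n where "m = lr_dim \<rho>" and "n = lr_dim \<sigma>"
  obtain V where V: "V \<in> amat_carrier A m m"
    "amat_mult A (lr_form A \<rho> a) V = amat_one A m" "amat_mult A V (lr_form A \<rho> a) = amat_one A m"
    "amat_mult A (amat_mult A (tensor A (lr_row \<rho>) \<one>) V) (tensor A (lr_col \<rho>) \<one>) = mat 1 1 (\<lambda>_. r)"
    using rep(1) unfolding represents_def m_def by blast
  obtain W where W: "W \<in> amat_carrier A n n"
    "amat_mult A (lr_form A \<sigma> a) W = amat_one A n" "amat_mult A W (lr_form A \<sigma> a) = amat_one A n"
    "amat_mult A (amat_mult A (tensor A (lr_row \<sigma>) \<one>) W) (tensor A (lr_col \<sigma>) \<one>) = mat 1 1 (\<lambda>_. t)"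
    using rep(2) unfolding represents_def n_def by blast
  note dims [simp] = lin_rep_wf_dims [OF wf(1), folded m_def] lin_rep_wf_dims [OF wf(2), folded n_def]
  have [simp]: "dim_row V = m" "dim_col V = m" "dim_row W = n" "dim_col W = n"
    and [simp]: "entries_in A V" "entries_in A W"
    using V(1) W(1) by (auto simp: amat_carrier_iff)
  note [simp] = entries_in_amat entries_in_tensor
  define C where "C = amat_mult A (tensor A (lr_col \<rho>) \<one>) (tensor A (lr_row \<sigma>) \<one>)"
  define B where "B = tensor A (- (lr_col \<rho> * lr_row \<sigma>)) \<one>"
  have C_eq: "C = tensor A (lr_col \<rho> * lr_row \<sigma>) \<one>"
    by (simp add: C_def tensor_mult)
  have BC: "amat_add A C B = amat_zero A m n"
    by (auto simp: C_eq B_def smult_uminus r_neg intro!: eq_matI)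
  have [simp]: "entries_in A B" "entries_in A C" "dim_row B = m" "dim_col B = n"
    "dim_row C = m" "dim_col C = n"
    by (simp_all add: B_def C_def)
  define U where "U = four_block_mat V (amat_mult A V (amat_mult A C W)) (amat_zero A n m) W"
  have L: "lr_form A (rep_mul \<rho> \<sigma>) a
      = four_block_mat (lr_form A \<rho> a) B (amat_zero A n m) (lr_form A \<sigma> a)"
    using a by (simp add: rep_mul_def Let_def linear_form_four_block linear_form_const tensor_zero
        B_def flip: m_def n_def)
  have dim: "lr_dim (rep_mul \<rho> \<sigma>) = m + n"
    by (simp add: rep_mul_def Let_def m_def n_def)
  have "amat_mult A (lr_form A (rep_mul \<rho> \<sigma>) a) U = amat_one A (m + n)"
    "amat_mult A U (lr_form A (rep_mul \<rho> \<sigma>) a) = amat_one A (m + n)"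
    unfolding L U_def using V W a
    by (intro amat_block_triangular_inverse;
        simp add: amat_carrier_iff entries_in_linear_form BC)+
  moreover have "U \<in> amat_carrier A (m + n) (m + n)"
    by (auto simp: U_def amat_carrier_iff intro!: entries_in_four_block)
  moreover have "amat_mult A (amat_mult A (tensor A (lr_row (rep_mul \<rho> \<sigma>)) \<one>) U)
      (tensor A (lr_col (rep_mul \<rho> \<sigma>)) \<one>) = mat 1 1 (\<lambda>_. r \<otimes> t)"
  proof -
    have "amat_mult A (amat_mult A (tensor A (lr_row (rep_mul \<rho> \<sigma>)) \<one>) U)
        (tensor A (lr_col (rep_mul \<rho> \<sigma>)) \<one>)
      = amat_mult A (amat_mult A (tensor A (lr_row \<rho>) \<one>) (amat_mult A V (amat_mult A C W)))
          (tensor A (lr_col \<sigma>) \<one>)"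
      unfolding U_def rep_mul_def Let_def
      by (simp add: amat_mult_append tensor_zero amat_mult_zero amat_add_zero
          flip: m_def n_def del: One_nat_def)
    \<comment> \<open>Reassociation cuts \<open>c\<^sub>1 V b\<^sub>1 c\<^sub>2 W b\<^sub>2\<close>
      in the middle, into the 1 by 1 matrices of the two values.\<close>
    also have "\<dots> = amat_mult A (amat_mult A (amat_mult A (tensor A (lr_row \<rho>) \<one>) V) (tensor A (lr_col \<rho>) \<one>))
        (amat_mult A (amat_mult A (tensor A (lr_row \<sigma>) \<one>) W) (tensor A (lr_col \<sigma>) \<one>))"
      by (simp add: C_def amat_mult_assoc)
    also have "\<dots> = mat 1 1 (\<lambda>_. r \<otimes> t)"
      using rt by (simp only: V(4) W(4) amat_mult_singleton)
    finally show ?thesis .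
  qed
  ultimately show ?thesis
    unfolding represents_def dim by blast
qed

lemma represents_inv:
  assumes wf: "lin_rep_wf \<rho>" and rep: "represents A \<rho> a r"
    and a: "\<And>k. a k \<in> carrier A" and r: "r \<in> Units A"
  shows "represents A (rep_inv \<rho>) a (inv r)"
proof -
  define n where "n = lr_dim \<rho>"
  obtain V where V: "V \<in> amat_carrier A n n"
    "amat_mult A (lr_form A \<rho> a) V = amat_one A n" "amat_mult A V (lr_form A \<rho> a) = amat_one A n"
    "amat_mult A (amat_mult A (tensor A (lr_row \<rho>) \<one>) V) (tensor A (lr_col \<rho>) \<one>) = mat 1 1 (\<lambda>_. r)"
    using rep unfolding represents_def n_def by blast
  note dims [simp] = lin_rep_wf_dims [OF wf, folded n_def]
  have [simp]: "dim_row V = n" "dim_col V = n" "entries_in A V"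
    using V(1) by (auto simp: amat_carrier_iff)
  note [simp] = entries_in_amat entries_in_tensor
  define b where "b = tensor A (lr_col \<rho>) \<one>"
  define b' where "b' = tensor A (- lr_col \<rho>) \<one>"
  define c where "c = tensor A (lr_row \<rho>) \<one>"
  define c' where "c' = tensor A (- lr_row \<rho>) \<one>"
  define q where "q = mat 1 1 (\<lambda>_. inv r)"
  have [simp]: "entries_in A b" "entries_in A b'" "entries_in A c" "entries_in A c'"
    "dim_row b = n" "dim_col b = 1" "dim_row b' = n" "dim_col b' = 1"
    "dim_row c = 1" "dim_col c = n" "dim_row c' = 1" "dim_col c' = n"
    by (simp_all add: b_def b'_def c_def c'_def)
  have [simp]: "entries_in A q" "dim_row q = 1" "dim_col q = 1"
    using r by (simp_all add: q_def entries_in_def)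
  have bb: "amat_add A b b' = amat_zero A n 1" and cc: "amat_add A c c' = amat_zero A 1 n"
    by (auto simp: b_def b'_def c_def c'_def smult_uminus r_neg intro!: eq_matI)
  have one: "mat 1 1 (\<lambda>_. \<one>) = amat_one A 1"
    by (auto intro!: eq_matI)
  have r': "r \<in> carrier A" "inv r \<in> carrier A" using r by auto
  \<comment> \<open>The 1 by 1 matrix \<open>c V b\<close> is invertible because its entry
    \<open>r\<close> is a unit.\<close>
  have rq: "amat_mult A (amat_mult A (amat_mult A c V) b) q = amat_one A 1"
      "amat_mult A q (amat_mult A (amat_mult A c V) b) = amat_one A 1"
    using r r' unfolding b_def c_def V(4) q_def
    by (simp_all only: amat_mult_singleton Units_r_inv Units_l_inv one)
  define U where "U = four_block_mat
      (amat_add A V (amat_mult A V (amat_mult A b (amat_mult A q (amat_mult A c' V)))))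
      (amat_mult A V (amat_mult A b q)) (amat_mult A q (amat_mult A c' V)) q"
  have L: "lr_form A (rep_inv \<rho>) a = four_block_mat (lr_form A \<rho> a) b' c (amat_zero A 1 1)"
    using a by (simp add: rep_inv_def Let_def linear_form_four_block linear_form_const tensor_zero
        b'_def c_def flip: n_def)
  have dim: "lr_dim (rep_inv \<rho>) = n + 1"
    by (simp add: rep_inv_def Let_def n_def)
  have "amat_mult A (lr_form A (rep_inv \<rho>) a) U = amat_one A (n + 1)"
    "amat_mult A U (lr_form A (rep_inv \<rho>) a) = amat_one A (n + 1)"
    unfolding L U_def
    by (rule amat_schur_inverse [OF _ V(1) _ _ _ _ _ V(2,3) bb cc rq];
        simp add: amat_carrier_iff entries_in_linear_form a)+
  moreover have "U \<in> amat_carrier A (n + 1) (n + 1)"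
    by (auto simp: U_def amat_carrier_iff intro!: entries_in_four_block)
  moreover have "amat_mult A (amat_mult A (tensor A (lr_row (rep_inv \<rho>)) \<one>) U)
      (tensor A (lr_col (rep_inv \<rho>)) \<one>) = mat 1 1 (\<lambda>_. inv r)"
    using tensor_one [of 1] unfolding U_def rep_inv_def Let_def q_def [symmetric]
    by (simp add: amat_mult_append tensor_zero amat_mult_zero amat_add_zero amat_mult_one
          flip: n_def)
  ultimately show ?thesis
    unfolding represents_def dim by blast
qed

end


section \<open>Representations of rational expressions\<close>

definition rep_word :: "'d list \<Rightarrow> ('k::field, 'd) lin_rep" where
  "rep_word w = foldr (\<lambda>k. rep_mul (rep_var k)) w (rep_const 1)"

text \<open>The recursion needs the words in some order, so an enumeration of the support is chosen.
  The representation depends on it, but its value does not, since sums in an algebra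
  commute.\<close>

definition rep_poly :: "('k::field, 'd) nc_poly \<Rightarrow> ('k, 'd) lin_rep" where
  "rep_poly p = foldr (\<lambda>w. rep_add (rep_mul (rep_const (Poly_Mapping.lookup p w)) (rep_word w)))
     (SOME ws. distinct ws \<and> set ws = Poly_Mapping.keys p) (rep_const 0)"

primrec rep_rat :: "('k::field, 'd) nc_rat \<Rightarrow> ('k, 'd) lin_rep" where
  "rep_rat (Poly p) = rep_poly p"
| "rep_rat (Add R1 R2) = rep_add (rep_rat R1) (rep_rat R2)"
| "rep_rat (Mul R1 R2) = rep_mul (rep_rat R1) (rep_rat R2)"
| "rep_rat (Inv R1) = rep_inv (rep_rat R1)"

lemmas lin_rep_wf_ops =
  lin_rep_wf_const lin_rep_wf_var lin_rep_wf_add lin_rep_wf_mul lin_rep_wf_inv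

lemma lin_rep_wf_word: "lin_rep_wf (rep_word w)"
  by (induction w) (auto simp: rep_word_def intro: lin_rep_wf_ops)

lemma lin_rep_wf_rat: "lin_rep_wf (rep_rat R)"
proof (induction R)
  case (Poly p)
  have "lin_rep_wf (foldr (\<lambda>w. rep_add (rep_mul (rep_const (f w)) (rep_word w))) ws (rep_const 0))"
    for f :: "'b list \<Rightarrow> 'a" and ws
    by (induction ws) (auto intro: lin_rep_wf_ops lin_rep_wf_word)
  then show ?case
    by (simp add: rep_poly_def)
qed (auto intro: lin_rep_wf_ops)

lemma rat_dom_carrier: "a \<in> rat_dom A R \<Longrightarrow> a k \<in> carrier A"
  by (induction R) auto

context unital_algebra
begin

lemma word_eval_closed: "(\<And>k. a k \<in> carrier A) \<Longrightarrow> word_eval A a w \<in> carrier A"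
  by (induction w) (auto simp: word_eval_def)

lemma poly_eval_closed: "(\<And>k. a k \<in> carrier A) \<Longrightarrow> poly_eval A a p \<in> carrier A"
  by (auto simp: poly_eval_def word_eval_closed intro!: finsum_closed)

lemma rat_eval_closed: "a \<in> rat_dom A R \<Longrightarrow> rat_eval A R a \<in> carrier A"
  by (induction R) (auto intro: poly_eval_closed)

lemma represents_word:
  "(\<And>k. a k \<in> carrier A) \<Longrightarrow> represents A (rep_word w) a (word_eval A a w)"
proof (induction w)
  case Nil
  then show ?case using represents_const [of a 1] by (simp add: rep_word_def word_eval_def)
next
  case (Cons k w)
  have "represents A (rep_mul (rep_var k) (rep_word w)) a (a k \<otimes> word_eval A a w)"
    using Cons by (intro represents_mul represents_var lin_rep_wf_var lin_rep_wf_word word_eval_closed) auto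
  then show ?case by (simp add: rep_word_def word_eval_def)
qed

lemma represents_poly:
  assumes a: "\<And>k. a k \<in> carrier A"
  shows "represents A (rep_poly p) a (poly_eval A a p)"
proof -
  let ?rep = "\<lambda>ws. foldr (\<lambda>w. rep_add (rep_mul (rep_const (Poly_Mapping.lookup p w)) (rep_word w)))
    ws (rep_const 0) :: ('k, 'b) lin_rep"
  have *: "lin_rep_wf (?rep ws) \<and>
      represents A (?rep ws) a (\<Oplus>w\<in>set ws. Poly_Mapping.lookup p w \<odot> word_eval A a w)"
    if "distinct ws" for ws
    using that
  proof (induction ws)
    case Nil
    then show ?case
      using represents_const [of a 0] a by (simp add: lin_rep_wf_const)
  next
    case (Cons w ws)
    let ?c = "Poly_Mapping.lookup p w"
    have wf: "lin_rep_wf (?rep ws)"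
      and IH: "represents A (?rep ws) a (\<Oplus>w\<in>set ws. Poly_Mapping.lookup p w \<odot> word_eval A a w)"
      using Cons by auto
    have "represents A (rep_mul (rep_const ?c) (rep_word w)) a ((?c \<odot> \<one>) \<otimes> word_eval A a w)"
      using a by (intro represents_mul represents_const represents_word lin_rep_wf_const
          lin_rep_wf_word word_eval_closed) auto
    also have "(?c \<odot> \<one>) \<otimes> word_eval A a w = ?c \<odot> word_eval A a w"
      using a by (simp add: smult_mult_left word_eval_closed)
    finally have "represents A (rep_mul (rep_const ?c) (rep_word w)) a (?c \<odot> word_eval A a w)" .
    then have "represents A (?rep (w # ws)) a ((?c \<odot> word_eval A a w)
        \<oplus> (\<Oplus>w\<in>set ws. Poly_Mapping.lookup p w \<odot> word_eval A a w))"
      unfolding foldr_Cons o_apply using wf IH a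
      by (intro represents_add lin_rep_wf_mul lin_rep_wf_const lin_rep_wf_word finsum_closed)
         (simp_all add: word_eval_closed)
    also have "(?c \<odot> word_eval A a w) \<oplus> (\<Oplus>w\<in>set ws. Poly_Mapping.lookup p w \<odot> word_eval A a w)
        = (\<Oplus>w\<in>set (w # ws). Poly_Mapping.lookup p w \<odot> word_eval A a w)"
      using Cons.prems a by (simp add: finsum_insert Pi_iff word_eval_closed)
    finally have "represents A (?rep (w # ws)) a
        (\<Oplus>w\<in>set (w # ws). Poly_Mapping.lookup p w \<odot> word_eval A a w)" .
    moreover have "lin_rep_wf (?rep (w # ws))"
      unfolding foldr_Cons o_apply
      by (intro lin_rep_wf_add lin_rep_wf_mul lin_rep_wf_const lin_rep_wf_word wf)
    ultimately show ?case by blast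
  qed
  define ws where "ws = (SOME ws. distinct ws \<and> set ws = Poly_Mapping.keys p)"
  have "distinct ws \<and> set ws = Poly_Mapping.keys p"
    unfolding ws_def
    using someI_ex [of "\<lambda>ws. distinct ws \<and> set ws = Poly_Mapping.keys p"]
      finite_distinct_list [OF finite_keys, of p] by blast
  with * [of ws] show ?thesis
    by (simp add: rep_poly_def poly_eval_def flip: ws_def)
qed

text \<open>By induction on the expression; the domain of an inverse supplies the unit that
  \<open>represents_inv\<close> asks for. The same \<open>rep_rat R\<close> occurs for all algebras,
  which is what makes the realization uniform.\<close>

lemma represents_rat:
  "a \<in> rat_dom A R \<Longrightarrow> represents A (rep_rat R) a (rat_eval A R a)"
proof (induction R)
  case (Inv R)
  then show ?case
    by (auto intro!: represents_inv lin_rep_wf_rat dest: rat_dom_carrier)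
qed (auto intro!: represents_poly represents_add represents_mul lin_rep_wf_rat
  intro: rat_dom_carrier rat_eval_closed)

end


section \<open>Kronecker products and linear maps on matrices\<close>

lemma div_mod_lessThan_mult:
  fixes r n s :: nat
  assumes "r < n * s"
  shows "r div s < n" "r mod s < s"
  using assms by (simp_all add: less_mult_imp_div_less) (metis less_nat_zero_code mod_less_divisor mult_is_0 not_gr_zero)

lemma mult_add_less_mult:
  fixes i n p s :: nat
  assumes "i < n" "p < s"
  shows "i * s + p < n * s"
proof -
  have "i * s + p < Suc i * s" using assms by simp
  also have "\<dots> \<le> n * s" using assms by (intro mult_right_mono) auto
  finally show ?thesis .
qed

lemma kron_dims [simp]:
  "dim_row (kron M N) = dim_row M * dim_row N" "dim_col (kron M N) = dim_col M * dim_col N"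
  by (simp_all add: kron_def)

lemma kron_index:
  "i < dim_row M * dim_row N \<Longrightarrow> j < dim_col M * dim_col N \<Longrightarrow> kron M N $$ (i, j) =
     M $$ (i div dim_row N, j div dim_col N) * N $$ (i mod dim_row N, j mod dim_col N)"
  by (simp add: kron_def)

lemma linear_on_matsD:
  assumes "linear_on_mats s p q T" "X \<in> carrier_mat s s"
  shows "T X \<in> carrier_mat p q"
    and "Y \<in> carrier_mat s s \<Longrightarrow> T (X + Y) = T X + T Y"
    and "T (c \<cdot>\<^sub>m X) = c \<cdot>\<^sub>m T X"
  using assms by (auto simp: linear_on_mats_def)

lemma linear_on_mats_kron:
  assumes "M \<in> carrier_mat p q"
  shows "linear_on_mats s (p * s) (q * s) (kron M :: 'k::field mat \<Rightarrow> _)"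
  using assms unfolding linear_on_mats_def
  by (auto intro!: eq_matI simp: kron_index algebra_simps div_mod_lessThan_mult)

lemma linear_on_mats_mult:
  assumes "linear_on_mats s p q T" "M \<in> carrier_mat r p" "N \<in> carrier_mat q t"
  shows "linear_on_mats s r q (\<lambda>X. M * T X)" "linear_on_mats s p t (\<lambda>X. T X * N)"
    "linear_on_mats s p q (\<lambda>X. - T X)"
proof -
  note T = linear_on_matsD [OF assms(1)]
  have *: "M * (T X + T Y) = M * T X + M * T Y" "(T X + T Y) * N = T X * N + T Y * N"
    "- (T X + T Y) = - T X + - T Y"
    if "X \<in> carrier_mat s s" "Y \<in> carrier_mat s s" for X Y
    using T(1) [OF that(1)] T(1) [OF that(2)] assms(2,3)
    by (auto intro: mult_add_distrib_mat add_mult_distrib_mat)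
  have **: "M * (c \<cdot>\<^sub>m T X) = c \<cdot>\<^sub>m (M * T X)" "(c \<cdot>\<^sub>m T X) * N = c \<cdot>\<^sub>m (T X * N)"
    "- (c \<cdot>\<^sub>m T X) = c \<cdot>\<^sub>m - T X" if "X \<in> carrier_mat s s" for c X
    using T(1) [OF that] assms(2,3)
    by (auto intro: mult_smult_distrib mult_smult_assoc_mat)
  show "linear_on_mats s r q (\<lambda>X. M * T X)" "linear_on_mats s p t (\<lambda>X. T X * N)"
    "linear_on_mats s p q (\<lambda>X. - T X)"
    unfolding linear_on_mats_def using T(1) assms(2,3)
    by (auto simp: T(2,3) * ** intro: mult_carrier_mat)
qed

text \<open>Over an algebra, \<open>T\<close> is applied through its values at the unit matrices;
  this expansion identifies such a sum with \<open>T\<close> of an ordinary matrix.\<close>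

lemma linear_on_mats_expand:
  assumes T: "linear_on_mats s p q T" and X: "X \<in> carrier_mat s s" and rc: "r < p" "c < q"
  shows "T X $$ (r, c) = (\<Sum>ij\<in>{..<s} \<times> {..<s}. X $$ ij * T (unit_mat s (fst ij) (snd ij)) $$ (r, c))"
proof -
  let ?E = "\<lambda>ij. unit_mat s (fst ij) (snd ij)"
  \<comment> \<open>\<open>Z F\<close> keeps the entries of \<open>X\<close> at the positions in
    \<open>F\<close>; the induction adds one position at a time.\<close>
  define Z where "Z F = mat s s (\<lambda>ij. if ij \<in> F then X $$ ij else 0)" for F
  have E: "?E ij \<in> carrier_mat s s" for ij
    by (simp add: unit_mat_def)
  have Zc: "Z F \<in> carrier_mat s s" for F
    by (simp add: Z_def)
  have "T (Z F) $$ (r, c) = (\<Sum>ij\<in>F. X $$ ij * T (?E ij) $$ (r, c))"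
    if "F \<subseteq> {..<s} \<times> {..<s}" for F
  proof -
    have "finite F" using that by (rule finite_subset) simp
    then show ?thesis using that
    proof (induction F rule: finite_induct)
      case empty
      have "Z {} = 0 \<cdot>\<^sub>m Z {}"
        by (intro eq_matI) (auto simp: Z_def)
      then have "T (Z {}) = 0 \<cdot>\<^sub>m T (Z {})"
        using T Zc [of "{}"] unfolding linear_on_mats_def by metis
      moreover have "T (Z {}) \<in> carrier_mat p q"
        using T Zc unfolding linear_on_mats_def by blast
      ultimately have "T (Z {}) $$ (r, c) = 0 * T (Z {}) $$ (r, c)"
        using rc by (metis carrier_matD index_smult_mat(1))
      then show ?case by simp
    next
      case (insert ij F)
      have "Z (insert ij F) = X $$ ij \<cdot>\<^sub>m ?E ij + Z F"
        using insert by (intro eq_matI) (auto simp: Z_def unit_mat_def)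
      then have "T (Z (insert ij F)) = X $$ ij \<cdot>\<^sub>m T (?E ij) + T (Z F)"
        using linear_on_matsD [OF T smult_carrier_mat [OF E]] linear_on_matsD [OF T E] Zc [of F] by simp
      moreover have "T (?E ij) \<in> carrier_mat p q" "T (Z F) \<in> carrier_mat p q"
        using T E Zc unfolding linear_on_mats_def by blast+
      ultimately show ?case
        using insert rc by auto
    qed
  qed
  from this [of "{..<s} \<times> {..<s}"] have "T (Z ({..<s} \<times> {..<s})) $$ (r, c)
      = (\<Sum>ij\<in>{..<s} \<times> {..<s}. X $$ ij * T (?E ij) $$ (r, c))"
    by simp
  also have "Z ({..<s} \<times> {..<s}) = X"
    using X by (intro eq_matI) (auto simp: Z_def)
  finally show ?thesis .
qed

lemma mult_mat_sum:
  fixes W :: "'k::comm_ring_1 mat" and Q :: "'d::finite \<Rightarrow> 'k mat"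
  assumes "W \<in> carrier_mat t p" "P \<in> carrier_mat p q" "\<And>k. Q k \<in> carrier_mat p q"
  shows "W * mat p q (\<lambda>ij. P $$ ij + (\<Sum>k\<in>UNIV. Q k $$ ij))
    = mat t q (\<lambda>ij. (W * P) $$ ij + (\<Sum>k\<in>UNIV. (W * Q k) $$ ij))"
proof (rule eq_matI)
  fix i j assume "i < dim_row (mat t q (\<lambda>ij. (W * P) $$ ij + (\<Sum>k\<in>UNIV. (W * Q k) $$ ij)))"
    "j < dim_col (mat t q (\<lambda>ij. (W * P) $$ ij + (\<Sum>k\<in>UNIV. (W * Q k) $$ ij)))"
  then have ij: "i < t" "j < q" by auto
  have d: "dim_row (Q k) = p" "dim_col (Q k) = q" for k using assms(3) [of k] by auto
  have "(W * mat p q (\<lambda>ij. P $$ ij + (\<Sum>k\<in>UNIV. Q k $$ ij))) $$ (i, j)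
      = (\<Sum>l<p. W $$ (i, l) * P $$ (l, j)) + (\<Sum>l<p. \<Sum>k\<in>UNIV. W $$ (i, l) * Q k $$ (l, j))"
    using ij assms by (auto simp: scalar_prod_def atLeast0LessThan algebra_simps sum.distrib sum_distrib_left)
  also have "(\<Sum>l<p. \<Sum>k\<in>UNIV. W $$ (i, l) * Q k $$ (l, j)) = (\<Sum>k\<in>UNIV. \<Sum>l<p. W $$ (i, l) * Q k $$ (l, j))"
    by (rule sum.swap)
  also have "(\<Sum>l<p. W $$ (i, l) * P $$ (l, j)) + \<dots> = (W * P) $$ (i, j) + (\<Sum>k\<in>UNIV. (W * Q k) $$ (i, j))"
    using ij assms d by (auto simp: scalar_prod_def atLeast0LessThan)
  finally show "(W * mat p q (\<lambda>ij. P $$ ij + (\<Sum>k\<in>UNIV. Q k $$ ij))) $$ (i, j)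
      = mat t q (\<lambda>ij. (W * P) $$ ij + (\<Sum>k\<in>UNIV. (W * Q k) $$ ij)) $$ (i, j)"
    using ij by simp
qed (use assms in auto)


section \<open>The realization attached to a linear representation\<close>

text \<open>The pencil at the centre as a scalar matrix, with the coefficients as outer and the
  \<open>s \<times> s\<close> matrices as inner factor. The maps \<open>fm_A\<close> below keep this
  order, so that the two match at \<open>Z = Y_k\<close>.\<close>

definition rep_pencil :: "nat \<Rightarrow> ('k::field, 'd::finite) lin_rep \<Rightarrow> ('d \<Rightarrow> 'k mat) \<Rightarrow> 'k mat" where
  "rep_pencil s \<rho> Y = mat (lr_dim \<rho> * s) (lr_dim \<rho> * s)
     (\<lambda>ij. kron (lr_const \<rho>) (1\<^sub>m s) $$ ij + (\<Sum>k\<in>UNIV. kron (lr_lin \<rho> k) (Y k) $$ ij))"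

text \<open>The matrix \<open>W\<close> is meant to be the inverse of the value of the pencil of \<open>\<rho>\<close> at the centre.
  Multiplying the pencil by it from the left normalizes the constant term to the identity.\<close>

definition rep_realization :: "nat \<Rightarrow> ('k::field, 'd::finite) lin_rep \<Rightarrow> 'k mat \<Rightarrow> ('k, 'd) fm_real" where
  "rep_realization s \<rho> W =
     \<lparr>fm_L = lr_dim \<rho> * s,
      fm_D = kron (lr_row \<rho>) (1\<^sub>m s) * (W * kron (lr_col \<rho>) (1\<^sub>m s)),
      fm_C = kron (lr_row \<rho>) (1\<^sub>m s),
      fm_A = (\<lambda>k Z. - (W * kron (lr_lin \<rho> k) Z)),
      fm_B = (\<lambda>k Z. - (W * kron (lr_lin \<rho> k) Z) * (W * kron (lr_col \<rho>) (1\<^sub>m s)))\<rparr>"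

lemma fm_realization_rep:
  assumes wf: "lin_rep_wf \<rho>" and W: "W \<in> carrier_mat (lr_dim \<rho> * s) (lr_dim \<rho> * s)" and s: "s \<ge> 1"
  shows "fm_realization s (rep_realization s \<rho> W)"
proof -
  note d = lin_rep_wf_dims [OF wf]
  have w: "W * kron (lr_col \<rho>) (1\<^sub>m s) \<in> carrier_mat (lr_dim \<rho> * s) s"
    using W d by (intro carrier_matI) auto
  have c: "kron (lr_row \<rho>) (1\<^sub>m s) \<in> carrier_mat s (lr_dim \<rho> * s)"
    using d by (intro carrier_matI) auto
  have A: "linear_on_mats s (lr_dim \<rho> * s) (lr_dim \<rho> * s) (\<lambda>Z. - (W * kron (lr_lin \<rho> k) Z))" for k
    by (rule linear_on_mats_mult(3) [OF linear_on_mats_mult(1) [OF linear_on_mats_kron W W] W W])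
       (use d in auto)
  moreover have "linear_on_mats s (lr_dim \<rho> * s) s
      (\<lambda>Z. - (W * kron (lr_lin \<rho> k) Z) * (W * kron (lr_col \<rho>) (1\<^sub>m s)))" for k
    by (rule linear_on_mats_mult(2) [OF A W w])
  moreover have "lr_dim \<rho> * s \<ge> 1"
    using wf s by (simp add: lin_rep_wf_def)
  ultimately show ?thesis
    using w c by (auto simp: fm_realization_def rep_realization_def)
qed

text \<open>Here \<open>Q k\<close> and \<open>K k\<close> are the coefficients of the pencil tensored with \<open>1\<close> and with the
  centre. The diagonal blocks of the pencil of the realization arise for \<open>t = 1\<close>, the others
  for \<open>t = 0\<close>.\<close>

lemma pencil_normalization:
  fixes W :: "'k::field mat" and K :: "'d::finite \<Rightarrow> 'k mat"
  assumes W: "W \<in> carrier_mat p p" and P: "P \<in> carrier_mat p p"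
    and K: "\<And>k. K k \<in> carrier_mat p p" and Q: "\<And>k. Q k \<in> carrier_mat p p"
    and inv: "W * mat p p (\<lambda>ij. P $$ ij + (\<Sum>k\<in>UNIV. K k $$ ij)) = 1\<^sub>m p"
    and ij: "i < p" "j < p"
  shows "t * (1\<^sub>m p) $$ (i, j) + (\<Sum>k\<in>UNIV. (W * Q k) $$ (i, j) - t * (W * K k) $$ (i, j))
    = t * (W * P) $$ (i, j) + (\<Sum>k\<in>UNIV. (W * Q k) $$ (i, j))"
proof -
  \<comment> \<open>One entry of \<open>W \<Lambda>(Y) = 1\<close>; substituted for the identity, it
    cancels the terms in \<open>K k\<close>.\<close>
  have "(1\<^sub>m p) $$ (i, j) = (W * P) $$ (i, j) + (\<Sum>k\<in>UNIV. (W * K k) $$ (i, j))"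
    using ij unfolding inv [symmetric] mult_mat_sum [OF W P K] by simp
  then show ?thesis
    by (simp add: sum_subtractf algebra_simps sum_distrib_left)
qed

section \<open>Amplification by the identity and evaluation over an algebra\<close>

text \<open>This is \<open>M \<otimes> I_s\<close>. A realization is evaluated at
  \<open>I_s \<otimes> a\<close>, whereas a representation yields a single element of the algebra,
  so the representation is amplified. The inner position of \<open>I_s\<close> agrees with
  \<open>kron M (1\<^sub>m s)\<close>.\<close>

definition amat_kron :: "('a, 'm) ring_scheme \<Rightarrow> nat \<Rightarrow> 'a mat \<Rightarrow> 'a mat" where
  "amat_kron A s M = mat (dim_row M * s) (dim_col M * s)
     (\<lambda>(i, j). if i mod s = j mod s then M $$ (i div s, j div s) else \<zero>\<^bsub>A\<^esub>)"

lemma amat_kron_dims [simp]: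
  "dim_row (amat_kron A s M) = dim_row M * s" "dim_col (amat_kron A s M) = dim_col M * s"
  by (simp_all add: amat_kron_def)

context ring
begin

lemma entries_in_amat_kron: "entries_in R M \<Longrightarrow> entries_in R (amat_kron R s M)"
  unfolding amat_kron_def by (intro entries_in_mat) (auto simp: entries_in_def div_mod_lessThan_mult)

text \<open>The amplifying factor has only the entries 0 and 1, so no entries of \<open>M\<close>
  and \<open>N\<close> have to change places, and noncommutativity does no harm.\<close>

lemma amat_kron_mult:
  assumes "entries_in R M" "entries_in R N" "dim_col M = dim_row N"
  shows "amat_mult R (amat_kron R s M) (amat_kron R s N) = amat_kron R s (amat_mult R M N)"
proof (rule eq_matI)
  fix i j
  assume "i < dim_row (amat_kron R s (amat_mult R M N))" "j < dim_col (amat_kron R s (amat_mult R M N))"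
  then have ij: "i < dim_row M * s" "j < dim_col N * s" by auto
  note ij' = div_mod_lessThan_mult [OF ij(1)] div_mod_lessThan_mult [OF ij(2)]
  note c = entries_inD [OF assms(1)] entries_inD [OF assms(2)]
  note c' = entries_inD [OF entries_in_amat_kron [OF assms(1), of s]]
    entries_inD [OF entries_in_amat_kron [OF assms(2), of s]]
  let ?f = "\<lambda>l. M $$ (i div s, l) \<otimes> N $$ (l, j div s)"
  have "amat_mult R (amat_kron R s M) (amat_kron R s N) $$ (i, j)
      = (\<Oplus>l\<in>{..<dim_row N * s}. amat_kron R s M $$ (i, l) \<otimes> amat_kron R s N $$ (l, j))"
    using ij assms by (simp add: amat_mult_index)
  also have "\<dots> = (\<Oplus>l\<in>{..<dim_row N}. \<Oplus>q\<in>{..<s}.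
      amat_kron R s M $$ (i, l * s + q) \<otimes> amat_kron R s N $$ (l * s + q, j))"
    using ij assms by (intro finsum_lessThan_mult m_closed c') auto
  \<comment> \<open>The first factor forces \<open>q = i mod s\<close>, the second
    \<open>q = j mod s\<close>.\<close>
  also have "\<dots> = (\<Oplus>l\<in>{..<dim_row N}. \<Oplus>q\<in>{..<s}.
      if i mod s = q then (if q = j mod s then ?f l else \<zero>) else \<zero>)"
    using ij ij' assms c
    by (intro finsum_cong') (auto simp: amat_kron_def mult_add_less_mult intro!: finsum_closed finsum_cong')
  also have "\<dots> = (\<Oplus>l\<in>{..<dim_row N}. if i mod s = j mod s then ?f l else \<zero>)"
    using ij ij' assms c by (intro finsum_cong' finsum_lessThan_delta(2)) auto
  also have "\<dots> = amat_kron R s (amat_mult R M N) $$ (i, j)"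
    using ij ij' by (auto simp: amat_kron_def amat_mult_index assms intro!: add.finprod_one_eqI)
  finally show "amat_mult R (amat_kron R s M) (amat_kron R s N) $$ (i, j)
      = amat_kron R s (amat_mult R M N) $$ (i, j)" .
qed auto

lemma amat_kron_one: "amat_kron R s (amat_one R n) = amat_one R (n * s)"
proof (rule eq_matI)
  fix i j assume "i < dim_row (amat_one R (n * s))" "j < dim_col (amat_one R (n * s))"
  then have ij: "i < n * s" "j < n * s" by auto
  have "i = j \<longleftrightarrow> i div s = j div s \<and> i mod s = j mod s"
    by (metis div_mult_mod_eq)
  then show "amat_kron R s (amat_one R n) $$ (i, j) = amat_one R (n * s) $$ (i, j)"
    using ij by (auto simp: amat_kron_def div_mod_lessThan_mult)
qed auto

lemma monoid_amat_ring: "monoid (amat_ring R n)"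
  by (rule monoidI)
     (auto simp: amat_ring_def amat_carrier_iff entries_in_amat amat_mult_assoc amat_mult_one)

lemma amat_ring_UnitsI:
  assumes "M \<in> amat_carrier R n n" "N \<in> amat_carrier R n n"
    and "amat_mult R M N = amat_one R n" "amat_mult R N M = amat_one R n"
  shows "M \<in> Units (amat_ring R n)" "inv\<^bsub>amat_ring R n\<^esub> M = N"
proof -
  interpret M: monoid "amat_ring R n" by (rule monoid_amat_ring)
  show "M \<in> Units (amat_ring R n)"
    using assms by (auto simp: Units_def amat_ring_def)
  then show "inv\<^bsub>amat_ring R n\<^esub> M = N"
    using assms by (intro M.inv_unique' [symmetric]) (auto simp: amat_ring_def)
qed

end

context unital_algebra
begin

lemma amat_kron_tensor:
  assumes "x \<in> carrier A"
  shows "amat_kron A s (tensor A M x) = tensor A (kron M (1\<^sub>m s)) x"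
proof (rule eq_matI)
  fix i j assume "i < dim_row (tensor A (kron M (1\<^sub>m s)) x)" "j < dim_col (tensor A (kron M (1\<^sub>m s)) x)"
  then have "i < dim_row M * s" "j < dim_col M * s" by auto
  then show "amat_kron A s (tensor A M x) $$ (i, j) = tensor A (kron M (1\<^sub>m s)) x $$ (i, j)"
    using assms by (auto simp: amat_kron_def kron_index div_mod_lessThan_mult)
qed auto

lemma amat_kron_linear_form:
  assumes a: "\<And>k. a k \<in> carrier A"
    and Q: "\<And>k. dim_row (Q k) = dim_row P" "\<And>k. dim_col (Q k) = dim_col P"
  shows "amat_kron A s (linear_form A P Q a)
    = linear_form A (kron P (1\<^sub>m s)) (\<lambda>k. kron (Q k) (1\<^sub>m s)) a"
proof (rule eq_matI)
  fix i j assume "i < dim_row (linear_form A (kron P (1\<^sub>m s)) (\<lambda>k. kron (Q k) (1\<^sub>m s)) a)"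
    "j < dim_col (linear_form A (kron P (1\<^sub>m s)) (\<lambda>k. kron (Q k) (1\<^sub>m s)) a)"
  then have ij: "i < dim_row P * s" "j < dim_col P * s" by auto
  then show "amat_kron A s (linear_form A P Q a) $$ (i, j)
      = linear_form A (kron P (1\<^sub>m s)) (\<lambda>k. kron (Q k) (1\<^sub>m s)) a $$ (i, j)"
    using a Q by (auto simp: amat_kron_def linear_form_def kron_index div_mod_lessThan_mult)
qed auto

text \<open>Scalars are central in the algebra, so a scalar matrix acts on the coefficients of a
  pencil, from the left here and from the right in \<open>linear_form_mult_tensor\<close>.\<close>

lemma tensor_mult_linear_form:
  assumes a: "\<And>k. a k \<in> carrier A" and W: "dim_col W = dim_row P"
    and Q: "\<And>k. dim_row (Q k) = dim_row P" "\<And>k. dim_col (Q k) = dim_col P"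
  shows "amat_mult A (tensor A W \<one>) (linear_form A P Q a) = linear_form A (W * P) (\<lambda>k. W * Q k) a"
proof (rule eq_matI)
  fix i j assume "i < dim_row (linear_form A (W * P) (\<lambda>k. W * Q k) a)"
    "j < dim_col (linear_form A (W * P) (\<lambda>k. W * Q k) a)"
  then have ij: "i < dim_row W" "j < dim_col P" by auto
  let ?L = "{..<dim_row P}"
  have "amat_mult A (tensor A W \<one>) (linear_form A P Q a) $$ (i, j)
      = (\<Oplus>l\<in>?L. (W $$ (i, l) * P $$ (l, j)) \<odot> \<one> \<oplus> (\<Oplus>k\<in>UNIV. (W $$ (i, l) * Q k $$ (l, j)) \<odot> a k))"
    using ij a W
    by (auto simp: amat_mult_index linear_form_def smult_mult_left smult_class_distrib smult_finsum
        finsum_closed simp del: finsum_addf intro!: finsum_cong')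
  also have "\<dots> = (\<Oplus>l\<in>?L. (W $$ (i, l) * P $$ (l, j)) \<odot> \<one>)
      \<oplus> (\<Oplus>l\<in>?L. \<Oplus>k\<in>UNIV. (W $$ (i, l) * Q k $$ (l, j)) \<odot> a k)"
    using a by (intro finsum_addf) (auto intro!: finsum_closed)
  also have "(\<Oplus>l\<in>?L. \<Oplus>k\<in>UNIV. (W $$ (i, l) * Q k $$ (l, j)) \<odot> a k)
      = (\<Oplus>k\<in>UNIV. \<Oplus>l\<in>?L. (W $$ (i, l) * Q k $$ (l, j)) \<odot> a k)"
    using a by (intro finsum_swap) auto
  also have "(\<Oplus>l\<in>?L. (W $$ (i, l) * P $$ (l, j)) \<odot> \<one>) = (W * P) $$ (i, j) \<odot> \<one>"
    using ij W by (simp add: sum_smult [symmetric] scalar_prod_def atLeast0LessThan)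
  also have "(\<Oplus>k\<in>UNIV. \<Oplus>l\<in>?L. (W $$ (i, l) * Q k $$ (l, j)) \<odot> a k)
      = (\<Oplus>k\<in>UNIV. (W * Q k) $$ (i, j) \<odot> a k)"
    using ij W Q a by (intro finsum_cong') (auto simp: sum_smult [symmetric] scalar_prod_def atLeast0LessThan)
  finally show "amat_mult A (tensor A W \<one>) (linear_form A P Q a) $$ (i, j)
      = linear_form A (W * P) (\<lambda>k. W * Q k) a $$ (i, j)"
    using ij by (simp add: linear_form_def)
qed auto

lemma linear_form_mult_tensor:
  assumes a: "\<And>k. a k \<in> carrier A" and W: "dim_row W = dim_col P"
    and Q: "\<And>k. dim_row (Q k) = dim_row P" "\<And>k. dim_col (Q k) = dim_col P"
  shows "amat_mult A (linear_form A P Q a) (tensor A W \<one>) = linear_form A (P * W) (\<lambda>k. Q k * W) a"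
proof (rule eq_matI)
  fix i j assume "i < dim_row (linear_form A (P * W) (\<lambda>k. Q k * W) a)"
    "j < dim_col (linear_form A (P * W) (\<lambda>k. Q k * W) a)"
  then have ij: "i < dim_row P" "j < dim_col W" by auto
  let ?L = "{..<dim_col P}"
  have "amat_mult A (linear_form A P Q a) (tensor A W \<one>) $$ (i, j)
      = (\<Oplus>l\<in>?L. (W $$ (l, j) * P $$ (i, l)) \<odot> \<one> \<oplus> (\<Oplus>k\<in>UNIV. (W $$ (l, j) * Q k $$ (i, l)) \<odot> a k))"
    using ij a W
    by (auto simp: amat_mult_index linear_form_def smult_mult_right smult_class_distrib smult_finsum
        finsum_closed simp del: finsum_addf intro!: finsum_cong')
  also have "\<dots> = (\<Oplus>l\<in>?L. (W $$ (l, j) * P $$ (i, l)) \<odot> \<one>)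
      \<oplus> (\<Oplus>l\<in>?L. \<Oplus>k\<in>UNIV. (W $$ (l, j) * Q k $$ (i, l)) \<odot> a k)"
    using a by (intro finsum_addf) (auto intro!: finsum_closed)
  also have "(\<Oplus>l\<in>?L. \<Oplus>k\<in>UNIV. (W $$ (l, j) * Q k $$ (i, l)) \<odot> a k)
      = (\<Oplus>k\<in>UNIV. \<Oplus>l\<in>?L. (W $$ (l, j) * Q k $$ (i, l)) \<odot> a k)"
    using a by (intro finsum_swap) auto
  also have "(\<Oplus>l\<in>?L. (W $$ (l, j) * P $$ (i, l)) \<odot> \<one>) = (P * W) $$ (i, j) \<odot> \<one>"
    using ij W by (simp add: sum_smult [symmetric] scalar_prod_def atLeast0LessThan mult.commute)
  also have "(\<Oplus>k\<in>UNIV. \<Oplus>l\<in>?L. (W $$ (l, j) * Q k $$ (i, l)) \<odot> a k)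
      = (\<Oplus>k\<in>UNIV. (Q k * W) $$ (i, j) \<odot> a k)"
    using ij W Q a by (intro finsum_cong')
      (auto simp: sum_smult [symmetric] scalar_prod_def atLeast0LessThan mult.commute)
  finally show "amat_mult A (linear_form A P Q a) (tensor A W \<one>) $$ (i, j)
      = linear_form A (P * W) (\<lambda>k. Q k * W) a $$ (i, j)"
    using ij by (simp add: linear_form_def)
qed auto

text \<open>All entries of the argument are scalar combinations of \<open>a\<close> and the unit of
  the algebra, so \<open>linear_on_mats_expand\<close> collects the values at unit matrices into
  \<open>T (1\<^sub>m s)\<close> and \<open>T Y\<close>.\<close>

lemma alg_ext_scalar:
  assumes T: "linear_on_mats s p q T" and Y: "Y \<in> carrier_mat s s" and a: "a \<in> carrier A"
    and rc: "r < p" "c < q"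
  shows "alg_ext A s p q T (amat_minus A (tensor A (1\<^sub>m s) a) (tensor A Y \<one>)) $$ (r, c)
    = (- T Y $$ (r, c)) \<odot> \<one> \<oplus> T (1\<^sub>m s) $$ (r, c) \<odot> a"
proof -
  let ?S = "{..<s} \<times> {..<s}" and ?E = "\<lambda>ij. unit_mat s (fst ij) (snd ij) :: 'k mat"
  define e where "e ij = T (?E ij) $$ (r, c)" for ij
  have E: "T (?E ij) \<in> carrier_mat p q" for ij
    by (rule linear_on_matsD(1) [OF T]) (simp add: unit_mat_def)
  have "alg_ext A s p q T (amat_minus A (tensor A (1\<^sub>m s) a) (tensor A Y \<one>)) $$ (r, c)
      = (\<Oplus>ij\<in>?S. tensor A (T (?E ij)) (amat_minus A (tensor A (1\<^sub>m s) a) (tensor A Y \<one>) $$ ij) $$ (r, c))"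
    using rc by (simp add: alg_ext_def)
  also have "\<dots> = (\<Oplus>ij\<in>?S. (- (Y $$ ij * e ij)) \<odot> \<one> \<oplus> ((1\<^sub>m s) $$ ij * e ij) \<odot> a)"
  proof (rule finsum_cong')
    show "tensor A (T (?E ij)) (amat_minus A (tensor A (1\<^sub>m s) a) (tensor A Y \<one>) $$ ij) $$ (r, c)
        = (- (Y $$ ij * e ij)) \<odot> \<one> \<oplus> ((1\<^sub>m s) $$ ij * e ij) \<odot> a"
      if ij: "ij \<in> ?S" for ij
    proof -
      obtain i j where [simp]: "ij = (i, j)" by (cases ij)
      have "tensor A (T (?E ij)) (amat_minus A (tensor A (1\<^sub>m s) a) (tensor A Y \<one>) $$ ij) $$ (r, c)
          = e ij \<odot> ((1\<^sub>m s) $$ ij \<odot> a \<oplus> (- Y $$ ij) \<odot> \<one>)"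
        using ij rc E [of ij] Y a by (simp add: e_def minus_eq smult_uminus)
      also have "\<dots> = (e ij * (1\<^sub>m s) $$ ij) \<odot> a \<oplus> (e ij * (- Y $$ ij)) \<odot> \<one>"
        using a smult_class_distrib(3) [of \<one> "e ij" "- Y $$ ij"]
          smult_class_distrib(3) [of a "e ij" "(1\<^sub>m s) $$ ij"]
        by (simp add: smult_class_distrib(2))
      also have "\<dots> = (e ij * (- Y $$ ij)) \<odot> \<one> \<oplus> (e ij * (1\<^sub>m s) $$ ij) \<odot> a"
        using a by (intro a_comm) auto
      finally show ?thesis
        by (simp only: mult.commute [of "e ij"] mult_minus_left mult_minus_right)
    qed
  qed (use a in auto)
  also have "\<dots> = (\<Oplus>ij\<in>?S. (- (Y $$ ij * e ij)) \<odot> \<one>) \<oplus> (\<Oplus>ij\<in>?S. ((1\<^sub>m s) $$ ij * e ij) \<odot> a)"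
    using a by (intro finsum_addf) auto
  also have "\<dots> = (\<Sum>ij\<in>?S. - (Y $$ ij * e ij)) \<odot> \<one> \<oplus> (\<Sum>ij\<in>?S. (1\<^sub>m s) $$ ij * e ij) \<odot> a"
    using a by (simp add: sum_smult)
  also have "(\<Sum>ij\<in>?S. - (Y $$ ij * e ij)) = - T Y $$ (r, c)"
    by (simp add: linear_on_mats_expand [OF T Y rc] e_def sum_negf)
  also have "(\<Sum>ij\<in>?S. (1\<^sub>m s) $$ ij * e ij) = T (1\<^sub>m s) $$ (r, c)"
    by (simp add: linear_on_mats_expand [OF T one_carrier_mat rc] e_def)
  finally show ?thesis .
qed

lemma alg_sum_scalar:
  assumes T: "\<And>k. linear_on_mats s p q (T k)" and Y: "\<And>k. Y k \<in> carrier_mat s s"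
    and a: "\<And>k. a k \<in> carrier A"
  shows "alg_sum A s p q Y T (\<lambda>k. tensor A (1\<^sub>m s) (a k))
    = linear_form A (mat p q (\<lambda>rc. - (\<Sum>k\<in>UNIV. T k (Y k) $$ rc))) (\<lambda>k. T k (1\<^sub>m s)) a"
proof (rule eq_matI)
  fix r c
  assume "r < dim_row (linear_form A (mat p q (\<lambda>rc. - (\<Sum>k\<in>UNIV. T k (Y k) $$ rc))) (\<lambda>k. T k (1\<^sub>m s)) a)"
    "c < dim_col (linear_form A (mat p q (\<lambda>rc. - (\<Sum>k\<in>UNIV. T k (Y k) $$ rc))) (\<lambda>k. T k (1\<^sub>m s)) a)"
  then have rc: "r < p" "c < q" by auto
  have "alg_sum A s p q Y T (\<lambda>k. tensor A (1\<^sub>m s) (a k)) $$ (r, c)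
      = (\<Oplus>k\<in>UNIV. (- T k (Y k) $$ (r, c)) \<odot> \<one> \<oplus> T k (1\<^sub>m s) $$ (r, c) \<odot> a k)"
    using rc by (simp add: alg_sum_def alg_ext_scalar [OF T Y a rc] del: finsum_addf)
  also have "\<dots> = (\<Oplus>k\<in>UNIV. (- T k (Y k) $$ (r, c)) \<odot> \<one>) \<oplus> (\<Oplus>k\<in>UNIV. T k (1\<^sub>m s) $$ (r, c) \<odot> a k)"
    using a by (intro finsum_addf) auto
  finally show "alg_sum A s p q Y T (\<lambda>k. tensor A (1\<^sub>m s) (a k)) $$ (r, c)
      = linear_form A (mat p q (\<lambda>rc. - (\<Sum>k\<in>UNIV. T k (Y k) $$ rc))) (\<lambda>k. T k (1\<^sub>m s)) a $$ (r, c)"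
    using rc by (simp add: linear_form_def sum_smult [symmetric] sum_negf)
qed (auto simp: alg_sum_def)

lemma tensor_one_minus_linear_form:
  assumes "\<And>k. a k \<in> carrier A" "P \<in> carrier_mat n n" "\<And>k. Q k \<in> carrier_mat n n"
  shows "amat_minus A (tensor A (1\<^sub>m n) \<one>) (linear_form A P Q a)
    = linear_form A (1\<^sub>m n - P) (\<lambda>k. - Q k) a"
proof (rule eq_matI)
  fix i j assume "i < dim_row (linear_form A (1\<^sub>m n - P) (\<lambda>k. - Q k) a)"
    "j < dim_col (linear_form A (1\<^sub>m n - P) (\<lambda>k. - Q k) a)"
  then have ij: "i < n" "j < n" using assms by auto
  let ?q = "\<lambda>k. Q k $$ (i, j) \<odot> a k"
  have "(\<Oplus>k\<in>UNIV. ?q k) \<oplus> (\<Oplus>k\<in>UNIV. \<ominus> ?q k) = (\<Oplus>k\<in>UNIV. ?q k \<oplus> (\<ominus> ?q k))"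
    using assms by (intro finsum_addf [symmetric]) auto
  also have "\<dots> = \<zero>"
    using assms by (intro add.finprod_one_eqI r_neg) auto
  finally have neg: "(\<Oplus>k\<in>UNIV. \<ominus> ?q k) = \<ominus> (\<Oplus>k\<in>UNIV. ?q k)"
    using assms by (intro minus_equality [symmetric]) (auto simp: a_comm finsum_closed)
  have "dim_row (Q k) = n" "dim_col (Q k) = n" for k
    using assms(3) [of k] by auto
  then have "linear_form A (1\<^sub>m n - P) (\<lambda>k. - Q k) a $$ (i, j)
      = ((1\<^sub>m n) $$ (i, j) + (- P $$ (i, j))) \<odot> \<one> \<oplus> (\<Oplus>k\<in>UNIV. \<ominus> ?q k)"
    using ij assms by (simp add: linear_form_def smult_uminus)
  also have "\<dots> = (1\<^sub>m n) $$ (i, j) \<odot> \<one> \<ominus> (P $$ (i, j) \<odot> \<one> \<oplus> (\<Oplus>k\<in>UNIV. ?q k))"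
    unfolding neg smult_class_distrib(1) [OF one_closed] smult_uminus [OF one_closed]
    using assms by (simp add: minus_eq minus_add a_assoc finsum_closed)
  also have "\<dots> = amat_minus A (tensor A (1\<^sub>m n) \<one>) (linear_form A P Q a) $$ (i, j)"
    using ij assms by (simp add: linear_form_def)
  finally show "amat_minus A (tensor A (1\<^sub>m n) \<one>) (linear_form A P Q a) $$ (i, j)
      = linear_form A (1\<^sub>m n - P) (\<lambda>k. - Q k) a $$ (i, j)" by simp
qed (use assms in auto)

end


lemma rep_pencil_carrier [simp]:
  "rep_pencil s \<rho> Y \<in> carrier_mat (lr_dim \<rho> * s) (lr_dim \<rho> * s)"
  by (simp add: rep_pencil_def)

text \<open>In the proof, \<open>M\<close> is the pencil of the realization,
  \<open>G = \<Lambda>(a) \<otimes> I_s\<close> has the inverse \<open>U\<close>, and the pencil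
  \<open>N\<close> at the centre has the inverse \<open>W\<close>. The core is
  \<open>M = W G\<close>; hence \<open>M\<close> has the inverse \<open>J = U N\<close>, and
  \<open>C J W b = C U b = (c V b) \<otimes> I_s\<close>.\<close>

lemma (in unital_algebra) realization_wrt_rep:
  assumes wf: "lin_rep_wf \<rho>" and Y: "\<And>k. Y k \<in> carrier_mat s s"
    and s: "s \<ge> 1"
    and W: "W \<in> carrier_mat (lr_dim \<rho> * s) (lr_dim \<rho> * s)"
      "W * rep_pencil s \<rho> Y = 1\<^sub>m (lr_dim \<rho> * s)" "rep_pencil s \<rho> Y * W = 1\<^sub>m (lr_dim \<rho> * s)"
    and a: "\<And>k. a k \<in> carrier A" and r: "r \<in> carrier A" and rep: "represents A \<rho> a r"
  defines "\<R> \<equiv> rep_realization s \<rho> W"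
  shows "(\<lambda>k. tensor A (1\<^sub>m s) (a k)) \<in> alg_fm_dom A s Y \<R>"
    and "alg_fm_eval A s Y \<R> (\<lambda>k. tensor A (1\<^sub>m s) (a k)) = tensor A (1\<^sub>m s) r"
proof -
  define L where "L = lr_dim \<rho> * s"
  define P where "P = kron (lr_const \<rho>) (1\<^sub>m s)"
  define C where "C = kron (lr_row \<rho>) (1\<^sub>m s)"
  define b where "b = kron (lr_col \<rho>) (1\<^sub>m s)"
  define w where "w = W * b"
  define T where "T = (\<lambda>k Z. - (W * kron (lr_lin \<rho> k) Z))"
  define N where "N = rep_pencil s \<rho> Y"
  note d = lin_rep_wf_dims [OF wf]
  note W' = W [folded L_def N_def]
  have N: "N \<in> carrier_mat L L" by (simp add: N_def L_def)
  have \<R>: "fm_L \<R> = L" "fm_A \<R> = T" "fm_B \<R> = (\<lambda>k Z. T k Z * w)" "fm_C \<R> = C" "fm_D \<R> = C * w"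
    by (simp_all add: \<R>_def rep_realization_def L_def T_def C_def b_def w_def)
  have fm: "fm_realization s \<R>"
    unfolding \<R>_def by (rule fm_realization_rep [OF wf W(1) s])
  have c: "P \<in> carrier_mat L L" "C \<in> carrier_mat s L" "b \<in> carrier_mat L s" "w \<in> carrier_mat L s"
    using d W' by (auto simp: P_def C_def b_def w_def L_def intro!: carrier_matI)
  have K: "kron (lr_lin \<rho> k) Z \<in> carrier_mat L L" if "Z \<in> carrier_mat s s" for k Z
    using d that by (auto simp: L_def intro!: carrier_matI)
  have T: "linear_on_mats s L L (T k)" and B: "linear_on_mats s L s (\<lambda>Z. T k Z * w)" for k
    using fm \<R> unfolding fm_realization_def by auto
  let ?X = "\<lambda>k. tensor A (1\<^sub>m s) (a k)"
  define S where "S = alg_sum A s L L Y T ?X"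
  have S: "S = linear_form A (mat L L (\<lambda>rc. - (\<Sum>k\<in>UNIV. T k (Y k) $$ rc))) (\<lambda>k. T k (1\<^sub>m s)) a"
    unfolding S_def by (rule alg_sum_scalar [OF T Y a])
  have Tc: "T k Z \<in> carrier_mat L L" if "Z \<in> carrier_mat s s" for k Z
    by (rule linear_on_matsD(1) [OF T that])
  have Td: "dim_row (T k Z) = L" "dim_col (T k Z) = L" if "Z \<in> carrier_mat s s" for k Z
    using Tc [OF that] by auto
  \<comment> \<open>Each \<open>B_k\<close> is \<open>A_k\<close> followed by multiplication with
    \<open>w\<close>, which therefore factors out of the sum.\<close>
  have Sw: "alg_sum A s L s Y (\<lambda>k Z. T k Z * w) ?X = amat_mult A S (tensor A w \<one>)"
  proof -
    have "mat L s (\<lambda>rc. - (\<Sum>k\<in>UNIV. (T k (Y k) * w) $$ rc))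
        = mat L L (\<lambda>rc. - (\<Sum>k\<in>UNIV. T k (Y k) $$ rc)) * w"
    proof (rule eq_matI)
      fix i j assume "i < dim_row (mat L L (\<lambda>rc. - (\<Sum>k\<in>UNIV. T k (Y k) $$ rc)) * w)"
        "j < dim_col (mat L L (\<lambda>rc. - (\<Sum>k\<in>UNIV. T k (Y k) $$ rc)) * w)"
      then have ij: "i < L" "j < s" using c by auto
      have "(\<Sum>k\<in>UNIV. (T k (Y k) * w) $$ (i, j)) = (\<Sum>k\<in>UNIV. \<Sum>l<L. T k (Y k) $$ (i, l) * w $$ (l, j))"
        using ij c Td [OF Y] by (auto simp: scalar_prod_def atLeast0LessThan)
      also have "\<dots> = (\<Sum>l<L. \<Sum>k\<in>UNIV. T k (Y k) $$ (i, l) * w $$ (l, j))"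
        by (rule sum.swap)
      finally show "mat L s (\<lambda>rc. - (\<Sum>k\<in>UNIV. (T k (Y k) * w) $$ rc)) $$ (i, j)
        = (mat L L (\<lambda>rc. - (\<Sum>k\<in>UNIV. T k (Y k) $$ rc)) * w) $$ (i, j)"
        using ij c by (auto simp: scalar_prod_def atLeast0LessThan sum_distrib_right sum_negf)
    qed (use c in auto)
    then show ?thesis
      unfolding S alg_sum_scalar [OF B Y a]
      using c a Td [OF one_carrier_mat] by (subst linear_form_mult_tensor) auto
  qed
  define G where "G = amat_kron A s (lr_form A \<rho> a)"
  have G: "G = linear_form A P (\<lambda>k. kron (lr_lin \<rho> k) (1\<^sub>m s)) a"
    unfolding G_def P_def using d a by (intro amat_kron_linear_form) auto
  define M where "M = alg_pencil A s Y \<R> ?X"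
  have M_minus: "M = amat_minus A (tensor A (1\<^sub>m L) \<one>) S"
    by (simp add: M_def alg_pencil_def \<R> S_def)
  \<comment> \<open>Both sides are pencils in \<open>a\<close> with the same linear coefficients.
    Their constant terms agree by \<open>W N = 1\<close>, used through
    \<open>pencil_normalization\<close> with \<open>t = 1\<close> and zero for the family
    \<open>Q\<close>.\<close>
  have M: "M = amat_mult A (tensor A W \<one>) G"
  proof -
    have "1\<^sub>m L - mat L L (\<lambda>rc. - (\<Sum>k\<in>UNIV. T k (Y k) $$ rc)) = W * P"
    proof (rule eq_matI)
      fix i j assume "i < dim_row (W * P)" "j < dim_col (W * P)"
      then have ij: "i < L" "j < L" using c W' by auto
      have inv: "W * mat L L (\<lambda>ij. P $$ ij + (\<Sum>k\<in>UNIV. kron (lr_lin \<rho> k) (Y k) $$ ij)) = 1\<^sub>m L"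
        using W'(2) by (simp add: N_def rep_pencil_def L_def P_def)
      have "(\<Sum>k\<in>UNIV. T k (Y k) $$ (i, j)) = - (\<Sum>k\<in>UNIV. (W * kron (lr_lin \<rho> k) (Y k)) $$ (i, j))"
      proof -
        have "T k (Y k) $$ (i, j) = - (W * kron (lr_lin \<rho> k) (Y k)) $$ (i, j)" for k
          unfolding T_def using ij mult_carrier_mat [OF W'(1) K [OF Y, of k k]]
          by (intro index_uminus_mat(1)) (metis carrier_matD)+
        then show ?thesis by (simp add: sum_negf)
      qed
      then show "(1\<^sub>m L - mat L L (\<lambda>rc. - (\<Sum>k\<in>UNIV. T k (Y k) $$ rc))) $$ (i, j) = (W * P) $$ (i, j)"
        using ij pencil_normalization [OF W'(1) c(1) K [OF Y] zero_carrier_mat inv ij, of 1]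
          W' by (simp add: sum_negf)
    qed (use c W' in auto)
    moreover have "- T k (1\<^sub>m s) = W * kron (lr_lin \<rho> k) (1\<^sub>m s)" for k
      by (simp add: T_def)
    moreover have "M = linear_form A (1\<^sub>m L - mat L L (\<lambda>rc. - (\<Sum>k\<in>UNIV. T k (Y k) $$ rc)))
        (\<lambda>k. - T k (1\<^sub>m s)) a"
      unfolding M_minus S using a Tc [OF one_carrier_mat] by (intro tensor_one_minus_linear_form) auto
    moreover have "amat_mult A (tensor A W \<one>) G = linear_form A (W * P) (\<lambda>k. W * kron (lr_lin \<rho> k) (1\<^sub>m s)) a"
      unfolding G using a W' c d by (intro tensor_mult_linear_form) (auto simp: L_def)
    ultimately show ?thesis by simp
  qed
  obtain V where V: "V \<in> amat_carrier A (lr_dim \<rho>) (lr_dim \<rho>)"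
    "amat_mult A (lr_form A \<rho> a) V = amat_one A (lr_dim \<rho>)"
    "amat_mult A V (lr_form A \<rho> a) = amat_one A (lr_dim \<rho>)"
    "amat_mult A (amat_mult A (tensor A (lr_row \<rho>) \<one>) V) (tensor A (lr_col \<rho>) \<one>) = mat 1 1 (\<lambda>_. r)"
    using rep unfolding represents_def by blast
  note [simp] = entries_in_amat entries_in_tensor entries_in_amat_kron
  have [simp]: "dim_row V = lr_dim \<rho>" "dim_col V = lr_dim \<rho>" "entries_in A V"
    using V(1) by (auto simp: amat_carrier_iff)
  define U where "U = amat_kron A s V"
  have [simp]: "entries_in A (lr_form A \<rho> a)"
    using a by (rule entries_in_linear_form)
  have [simp]: "entries_in A G" "entries_in A U" "dim_row G = L" "dim_col G = L" "dim_row U = L" "dim_col U = L"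
    using d by (auto simp: G_def U_def L_def)
  have GU: "amat_mult A G U = amat_one A L" "amat_mult A U G = amat_one A L"
    using V(2,3) d by (simp_all add: G_def U_def amat_kron_mult amat_kron_one L_def)
  have [simp]: "dim_row W = L" "dim_col W = L" "dim_row N = L" "dim_col N = L"
     "dim_row C = s" "dim_col C = L" "dim_row b = L" "dim_col b = s" "dim_row w = L" "dim_col w = s"
    using W' N c by auto
  have WN: "amat_mult A (tensor A W \<one>) (tensor A N \<one>) = amat_one A L"
      "amat_mult A (tensor A N \<one>) (tensor A W \<one>) = amat_one A L"
    using W' by (simp_all add: tensor_mult tensor_one)
  \<comment> \<open>\<open>M = W G\<close> is inverted factor by factor.\<close>
  define J where "J = amat_mult A U (tensor A N \<one>)"
  have [simp]: "entries_in A M" "dim_row M = L" "dim_col M = L" "entries_in A J" "dim_row J = L" "dim_col J = L"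
    by (simp_all add: M J_def)
  have MJ: "amat_mult A M J = amat_one A L" "amat_mult A J M = amat_one A L"
    by (simp_all add: M J_def amat_mult_assoc amat_inverse_cancel [OF GU(1)]
        amat_inverse_cancel [OF WN(2)] WN GU)
  have M_unit: "M \<in> Units (amat_ring A L)" "inv\<^bsub>amat_ring A L\<^esub> M = J"
    using MJ by (auto intro!: amat_ring_UnitsI simp: amat_carrier_iff)
  show "?X \<in> alg_fm_dom A s Y \<R>"
    using M_unit(1) a by (auto simp: alg_fm_dom_def \<R> M_def amat_carrier_iff)
  have [simp]: "entries_in A S" "dim_row S = L" "dim_col S = L"
    using a by (auto simp: S intro!: entries_in_linear_form)
  have MS: "amat_add A M S = amat_one A L"
    unfolding M_minus by (intro eq_matI) (auto simp: entries_inD minus_eq a_assoc l_neg)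
  define C' where "C' = tensor A C \<one>"
  define w' where "w' = tensor A w \<one>"
  have [simp]: "entries_in A C'" "dim_row C' = s" "dim_col C' = L" "entries_in A w'" "dim_row w' = L" "dim_col w' = s"
    by (simp_all add: C'_def w'_def)
  have "alg_fm_eval A s Y \<R> ?X
      = amat_add A (tensor A (C * w) \<one>) (amat_mult A (amat_mult A C' J) (amat_mult A S w'))"
    by (simp add: alg_fm_eval_def \<R> Sw C'_def w'_def M_unit(2) flip: M_def)
  \<comment> \<open>The constant term is expanded to \<open>C J M w\<close> by
    \<open>J M = 1\<close>, so that it merges with \<open>C J S w\<close> into
    \<open>C J (M + S) w = C J w\<close>.\<close>
  also have "tensor A (C * w) \<one> = amat_mult A C' (amat_mult A J (amat_mult A M w'))"
    using amat_inverse_cancel [OF MJ(2), of w'] by (simp add: C'_def w'_def tensor_mult)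
  also have "amat_add A \<dots> (amat_mult A (amat_mult A C' J) (amat_mult A S w'))
      = amat_mult A C' (amat_mult A J (amat_mult A (amat_add A M S) w'))"
    by (simp add: amat_mult_assoc amat_add_mult_distrib)
  also have "\<dots> = amat_mult A C' (amat_mult A J w')"
    by (simp add: MS amat_mult_one)
  also have "w' = amat_mult A (tensor A W \<one>) (tensor A b \<one>)"
    by (simp add: w'_def w_def tensor_mult)
  also have "amat_mult A C' (amat_mult A J \<dots>) = amat_mult A C' (amat_mult A U (tensor A b \<one>))"
    by (simp add: J_def amat_mult_assoc amat_inverse_cancel [OF WN(2)])
  \<comment> \<open>All three factors are amplifications by \<open>I_s\<close>, so their product is
    the amplified value \<open>c V b\<close>.\<close>
  also have "\<dots> = amat_kron A s (mat 1 1 (\<lambda>_. r))"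
    using d unfolding V(4) [symmetric]
    by (simp add: C'_def C_def b_def U_def amat_mult_assoc flip: amat_kron_mult amat_kron_tensor)
  also have "\<dots> = tensor A (1\<^sub>m s) r"
    using r by (intro eq_matI) (auto simp: amat_kron_def)
  finally show "alg_fm_eval A s Y \<R> ?X = tensor A (1\<^sub>m s) r" .
qed


section \<open>Evaluation on block matrices\<close>

lemma assoc_mult_mat_dim:
  fixes M N P :: "'k::semiring_0 mat"
  shows "dim_col M = dim_row N \<Longrightarrow> dim_col N = dim_row P \<Longrightarrow> M * N * P = M * (N * P)"
  by (rule assoc_mult_mat [of _ "dim_row M" "dim_row N" _ "dim_row P" _ "dim_col P"]) auto

lemma sum_lessThan_mult:
  fixes n s :: nat
  shows "sum f {..<n * s} = (\<Sum>i<n. \<Sum>p<s. f (i * s + p))"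
proof -
  have "sum f {i * s..<i * s + s} = (\<Sum>p<s. f (i * s + p))" for i
    using sum.shift_bounds_nat_ivl [of f 0 "i * s" s] by (simp add: atLeast0LessThan add.commute)
  then show ?thesis
    by (simp flip: sum.nat_group)
qed

lemma kron_one_mult_index:
  fixes W M :: "'k::comm_ring_1 mat"
  assumes "dim_row M = m * dim_col W" "i < m * dim_row W" "j < dim_col M"
  shows "(kron (1\<^sub>m m) W * M) $$ (i, j)
    = (\<Sum>l<dim_col W. W $$ (i mod dim_row W, l) * M $$ (i div dim_row W * dim_col W + l, j))"
proof -
  note i = div_mod_lessThan_mult [OF assms(2)]
  have "(kron (1\<^sub>m m) W * M) $$ (i, j) = (\<Sum>l<m * dim_col W. kron (1\<^sub>m m) W $$ (i, l) * M $$ (l, j))"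
    using assms by (simp add: scalar_prod_def atLeast0LessThan)
  also have "\<dots> = (\<Sum>h<m. \<Sum>l<dim_col W. kron (1\<^sub>m m) W $$ (i, h * dim_col W + l) * M $$ (h * dim_col W + l, j))"
    by (rule sum_lessThan_mult)
  also have "\<dots> = (\<Sum>h<m. if i div dim_row W = h then
      (\<Sum>l<dim_col W. W $$ (i mod dim_row W, l) * M $$ (h * dim_col W + l, j)) else 0)"
    using assms i by (intro sum.cong) (auto simp: kron_index mult_add_less_mult)
  also have "\<dots> = (\<Sum>l<dim_col W. W $$ (i mod dim_row W, l) * M $$ (i div dim_row W * dim_col W + l, j))"
    using i by simp
  finally show ?thesis .
qed

lemma mult_kron_one_index:
  fixes W M :: "'k::comm_ring_1 mat"
  assumes "dim_col M = m * dim_row W" "i < dim_row M" "j < m * dim_col W"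
  shows "(M * kron (1\<^sub>m m) W) $$ (i, j)
    = (\<Sum>l<dim_row W. M $$ (i, j div dim_col W * dim_row W + l) * W $$ (l, j mod dim_col W))"
proof -
  note j = div_mod_lessThan_mult [OF assms(3)]
  have "(M * kron (1\<^sub>m m) W) $$ (i, j) = (\<Sum>l<m * dim_row W. M $$ (i, l) * kron (1\<^sub>m m) W $$ (l, j))"
    using assms by (simp add: scalar_prod_def atLeast0LessThan)
  also have "\<dots> = (\<Sum>h<m. \<Sum>l<dim_row W. M $$ (i, h * dim_row W + l) * kron (1\<^sub>m m) W $$ (h * dim_row W + l, j))"
    by (rule sum_lessThan_mult)
  also have "\<dots> = (\<Sum>h<m. if h = j div dim_col W then
      (\<Sum>l<dim_row W. M $$ (i, h * dim_row W + l) * W $$ (l, j mod dim_col W)) else 0)"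
    using assms j by (intro sum.cong) (auto simp: kron_index mult_add_less_mult)
  also have "\<dots> = (\<Sum>l<dim_row W. M $$ (i, j div dim_col W * dim_row W + l) * W $$ (l, j mod dim_col W))"
    using j by simp
  finally show ?thesis .
qed

lemma kron_one_mult:
  fixes M N :: "'k::comm_ring_1 mat"
  assumes "dim_col M = dim_row N"
  shows "kron (1\<^sub>m m) M * kron (1\<^sub>m m) N = kron (1\<^sub>m m) (M * N)"
proof (rule eq_matI)
  fix i j assume "i < dim_row (kron (1\<^sub>m m) (M * N))" "j < dim_col (kron (1\<^sub>m m) (M * N))"
  then have ij: "i < m * dim_row M" "j < m * dim_col N" by auto
  then show "(kron (1\<^sub>m m) M * kron (1\<^sub>m m) N) $$ (i, j) = kron (1\<^sub>m m) (M * N) $$ (i, j)"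
    using assms div_mod_lessThan_mult [OF ij(1)] div_mod_lessThan_mult [OF ij(2)]
    by (subst kron_one_mult_index)
       (auto simp: kron_index scalar_prod_def atLeast0LessThan mult_add_less_mult)
qed auto

lemma kron_one_one: "kron (1\<^sub>m m) (1\<^sub>m n :: 'k::comm_ring_1 mat) = 1\<^sub>m (m * n)"
proof (rule eq_matI)
  fix i j assume "i < dim_row (1\<^sub>m (m * n) :: 'k mat)" "j < dim_col (1\<^sub>m (m * n) :: 'k mat)"
  then have ij: "i < m * n" "j < m * n" by auto
  have "i = j \<longleftrightarrow> i div n = j div n \<and> i mod n = j mod n"
    by (metis div_mult_mod_eq)
  then show "kron (1\<^sub>m m) (1\<^sub>m n) $$ (i, j) = (1\<^sub>m (m * n) :: 'k mat) $$ (i, j)"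
    using ij div_mod_lessThan_mult [OF ij(1)] div_mod_lessThan_mult [OF ij(2)]
    by (auto simp: kron_index)
qed auto


text \<open>A \<open>p \<times> q\<close> matrix with entries in \<open>K\<^sup>m\<^sup>s\<^sup>\<times>\<^sup>m\<^sup>s\<close> is a \<open>p \<times> q\<close> matrix of \<open>m \<times> m\<close> matrices of
  \<open>s \<times> s\<close> blocks. Flattening moves the \<open>m \<times> m\<close> structure to the outside, so that it becomes
  an \<open>m \<times> m\<close> matrix of \<open>ps \<times> qs\<close> blocks, as in the evaluation of a realization.\<close>

definition flatten :: "nat \<Rightarrow> nat \<Rightarrow> 'k mat mat \<Rightarrow> 'k mat" where
  "flatten m s M = mat (m * (dim_row M * s)) (m * (dim_col M * s))
     (\<lambda>(i, j). M $$ (i mod (dim_row M * s) div s, j mod (dim_col M * s) div s) $$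
       (i div (dim_row M * s) * s + i mod (dim_row M * s) mod s,
        j div (dim_col M * s) * s + j mod (dim_col M * s) mod s))"

lemma flatten_dims [simp]:
  "dim_row (flatten m s M) = m * (dim_row M * s)" "dim_col (flatten m s M) = m * (dim_col M * s)"
  by (simp_all add: flatten_def)

lemma flatten_index:
  "i < m * (dim_row M * s) \<Longrightarrow> j < m * (dim_col M * s) \<Longrightarrow> flatten m s M $$ (i, j)
    = M $$ (i mod (dim_row M * s) div s, j mod (dim_col M * s) div s) $$
       (i div (dim_row M * s) * s + i mod (dim_row M * s) mod s,
        j div (dim_col M * s) * s + j mod (dim_col M * s) mod s)"
  by (simp add: flatten_def)

lemma flatten_bounds:
  fixes i m n s :: nat
  assumes "i < m * (n * s)"
  shows "i div (n * s) < m" "i mod (n * s) div s < n" "i mod (n * s) mod s < s"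
    "i div (n * s) * s + i mod (n * s) mod s < s * m"
proof -
  note a = div_mod_lessThan_mult [OF assms]
  note b = div_mod_lessThan_mult [OF a(2)]
  show "i div (n * s) < m" "i mod (n * s) div s < n" "i mod (n * s) mod s < s"
    using a b by auto
  then show "i div (n * s) * s + i mod (n * s) mod s < s * m"
    by (metis mult.commute mult_add_less_mult)
qed

lemma div_mod_mult_add:
  fixes p s i :: nat
  assumes "p < s"
  shows "(i * s + p) div s = i" "(i * s + p) mod s = p"
  using assms by auto

lemma mat_alg_finsum_index:
  assumes "finite F" "\<And>k. k \<in> F \<Longrightarrow> f k \<in> carrier_mat n n" "i < n" "j < n"
  shows "(\<Oplus>\<^bsub>mat_alg n :: ('k::field, 'k mat) module\<^esub>k\<in>F. f k) $$ (i, j) = (\<Sum>k\<in>F. f k $$ (i, j))"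
proof -
  interpret unital_algebra "mat_alg n :: ('k, 'k mat) module"
    by (rule unital_algebra_mat_alg)
  show ?thesis
    using assms(1,2)
  proof (induction F rule: finite_induct)
    case empty
    then show ?case using assms(3,4) by (simp add: module_mat_simps)
  next
    case (insert k F)
    then have F: "f \<in> F \<rightarrow> carrier (mat_alg n)" "f k \<in> carrier (mat_alg n)"
      by (auto simp: module_mat_simps)
    then have "finsum (mat_alg n) f F \<in> carrier (mat_alg n)"
      by (intro finsum_closed)
    then have "finsum (mat_alg n) f F \<in> carrier_mat n n"
      by (simp add: module_mat_simps)
    moreover have "finsum (mat_alg n) f (insert k F) = f k + finsum (mat_alg n) f F"
      using insert F by (simp add: finsum_insert module_mat_simps)
    ultimately show ?case
      using insert assms(3,4) by simp
  qed
qed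

text \<open>Flattening relabels: row \<open>h * s + p\<close> inside an entry of block row
  \<open>u\<close> becomes row \<open>h * (n * s) + (u * s + p)\<close>, where \<open>n\<close> is
  the number of block rows, and likewise for columns. The columns of \<open>M\<close> and the rows
  of \<open>N\<close> are relabelled alike, so products survive.\<close>

lemma flatten_mult:
  fixes M N :: "'k::field mat mat"
  assumes M: "entries_in (mat_alg (s * m)) M" and N: "entries_in (mat_alg (s * m)) N"
    and MN: "dim_col M = dim_row N"
  shows "flatten m s M * flatten m s N = flatten m s (amat_mult (mat_alg (s * m)) M N)"
proof (rule eq_matI)
  let ?A = "mat_alg (s * m) :: ('k, 'k mat) module"
  fix i j
  assume "i < dim_row (flatten m s (amat_mult ?A M N))" "j < dim_col (flatten m s (amat_mult ?A M N))"
  then have ij: "i < m * (dim_row M * s)" "j < m * (dim_col N * s)" by auto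
  define u where "u = i mod (dim_row M * s) div s"
  define v where "v = j mod (dim_col N * s) div s"
  define x where "x = i div (dim_row M * s) * s + i mod (dim_row M * s) mod s"
  define y where "y = j div (dim_col N * s) * s + j mod (dim_col N * s) mod s"
  let ?t = "dim_row N"
  have b: "u < dim_row M" "v < dim_col N" "x < s * m" "y < s * m"
    using flatten_bounds [OF ij(1)] flatten_bounds [OF ij(2)] by (auto simp: u_def v_def x_def y_def)
  have Mc: "M $$ (u, t) \<in> carrier_mat (s * m) (s * m)" if "t < ?t" for t
    using entries_inD [OF M b(1), of t] that MN by (simp add: module_mat_simps)
  have Nc: "N $$ (t, v) \<in> carrier_mat (s * m) (s * m)" if "t < ?t" for t
    using entries_inD [OF N _ b(2), of t] that by (simp add: module_mat_simps)
  have MNc: "M $$ (u, t) * N $$ (t, v) \<in> carrier_mat (s * m) (s * m)" if "t < ?t" for t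
    using Mc [OF that] Nc [OF that] by simp
  have "flatten m s (amat_mult ?A M N) $$ (i, j) = amat_mult ?A M N $$ (u, v) $$ (x, y)"
    using ij by (simp add: flatten_index u_def v_def x_def y_def)
  also have "\<dots> = (\<Sum>t<?t. (M $$ (u, t) * N $$ (t, v)) $$ (x, y))"
    unfolding amat_mult_index [OF b(1,2)] MN module_mat_simps(1)
    by (rule mat_alg_finsum_index) (use b MNc in auto)
  also have "\<dots> = (\<Sum>t<?t. \<Sum>l<m * s. M $$ (u, t) $$ (x, l) * N $$ (t, v) $$ (l, y))"
  proof (intro sum.cong refl)
    fix t assume "t \<in> {..<?t}"
    then have "t < ?t" by simp
    then show "(M $$ (u, t) * N $$ (t, v)) $$ (x, y) = (\<Sum>l<m * s. M $$ (u, t) $$ (x, l) * N $$ (t, v) $$ (l, y))"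
      using b Mc [of t] Nc [of t]
      by (auto simp: scalar_prod_def atLeast0LessThan mult.commute [of s m])
  qed
  also have "\<dots> = (\<Sum>t<?t. \<Sum>h<m. \<Sum>q<s. M $$ (u, t) $$ (x, h * s + q) * N $$ (t, v) $$ (h * s + q, y))"
    by (simp add: sum_lessThan_mult)
  \<comment> \<open>Exchanging the sums over \<open>t\<close> and \<open>h\<close> is the reordering
    of factors that flattening performs.\<close>
  also have "\<dots> = (\<Sum>h<m. \<Sum>t<?t. \<Sum>q<s. M $$ (u, t) $$ (x, h * s + q) * N $$ (t, v) $$ (h * s + q, y))"
    by (rule sum.swap)
  also have "\<dots> = (\<Sum>h<m. \<Sum>t<?t. \<Sum>q<s. flatten m s M $$ (i, h * (?t * s) + (t * s + q))
      * flatten m s N $$ (h * (?t * s) + (t * s + q), j))"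
  proof (intro sum.cong refl)
    fix h t q assume "h \<in> {..<m}" "t \<in> {..<?t}" "q \<in> {..<s}"
    then have *: "h < m" "t < ?t" "q < s" "t * s + q < ?t * s" by (auto simp: mult_add_less_mult)
    then have "h * (?t * s) + (t * s + q) < m * (?t * s)"
      by (intro mult_add_less_mult)
    then show "M $$ (u, t) $$ (x, h * s + q) * N $$ (t, v) $$ (h * s + q, y)
        = flatten m s M $$ (i, h * (?t * s) + (t * s + q)) * flatten m s N $$ (h * (?t * s) + (t * s + q), j)"
      using ij MN * by (simp add: flatten_index u_def v_def x_def y_def div_mod_mult_add
          del: div_mult_self3 mod_mult_self3)
  qed
  also have "\<dots> = (\<Sum>l<m * (?t * s). flatten m s M $$ (i, l) * flatten m s N $$ (l, j))"
    by (simp add: sum_lessThan_mult)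
  also have "\<dots> = (flatten m s M * flatten m s N) $$ (i, j)"
    using ij MN by (simp add: scalar_prod_def atLeast0LessThan)
  finally show "(flatten m s M * flatten m s N) $$ (i, j) = flatten m s (amat_mult ?A M N) $$ (i, j)"
    by simp
qed (use MN in auto)

lemma mult_add_eq_iff:
  fixes p q s i j :: nat
  assumes "p < s" "q < s"
  shows "i * s + p = j * s + q \<longleftrightarrow> i = j \<and> p = q"
  using assms by (metis div_mod_mult_add)

lemma flatten_tensor_one:
  fixes M :: "'k::field mat"
  shows "flatten m s (tensor (mat_alg (s * m)) M (1\<^sub>m (s * m))) = kron (1\<^sub>m m) (kron M (1\<^sub>m s))"
proof (rule eq_matI)
  fix i j assume "i < dim_row (kron (1\<^sub>m m) (kron M (1\<^sub>m s)))" "j < dim_col (kron (1\<^sub>m m) (kron M (1\<^sub>m s)))"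
  then have ij: "i < m * (dim_row M * s)" "j < m * (dim_col M * s)" by auto
  note b = flatten_bounds [OF ij(1)] flatten_bounds [OF ij(2)]
  note c = div_mod_lessThan_mult [OF ij(1)] div_mod_lessThan_mult [OF ij(2)]
  show "flatten m s (tensor (mat_alg (s * m)) M (1\<^sub>m (s * m))) $$ (i, j)
      = kron (1\<^sub>m m) (kron M (1\<^sub>m s)) $$ (i, j)"
    using ij b c by (simp add: flatten_index module_mat_simps(6) kron_index mult_add_eq_iff)
qed auto

text \<open>Block \<open>(h, h')\<close> of the flattened pencil is built from the
  \<open>(h, h')\<close> blocks of the identity and of the \<open>X k\<close>. This is the form in
  which \<open>block_ext\<close> evaluates a realization.\<close>

lemma flatten_linear_form:
  fixes P :: "'k::field mat" and Q :: "'d::finite \<Rightarrow> 'k mat"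
  assumes X: "\<And>k. X k \<in> carrier_mat (s * m) (s * m)"
    and P: "P \<in> carrier_mat p q" and Q: "\<And>k. Q k \<in> carrier_mat p q"
    and ij: "i < m * (p * s)" "j < m * (q * s)"
  defines "h \<equiv> i div (p * s)" and "h' \<equiv> j div (q * s)"
  shows "flatten m s (linear_form (mat_alg (s * m)) P Q X) $$ (i, j)
    = (1\<^sub>m m) $$ (h, h') * kron P (1\<^sub>m s) $$ (i mod (p * s), j mod (q * s))
      + (\<Sum>k\<in>UNIV. kron (Q k) (block s (X k) h h') $$ (i mod (p * s), j mod (q * s)))"
proof -
  let ?A = "mat_alg (s * m) :: ('k, 'k mat) module"
  note b = flatten_bounds [OF ij(1)] flatten_bounds [OF ij(2)]
  note c = div_mod_lessThan_mult [OF ij(1)] div_mod_lessThan_mult [OF ij(2)]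
  define u where "u = i mod (p * s) div s"
  define v where "v = j mod (q * s) div s"
  define x where "x = h * s + i mod (p * s) mod s"
  define y where "y = h' * s + j mod (q * s) mod s"
  have xy: "x < s * m" "y < s * m" using b by (auto simp: x_def y_def h_def h'_def)
  have d: "dim_row (Q k) = p" "dim_col (Q k) = q" for k using Q [of k] by auto
  interpret unital_algebra ?A by (rule unital_algebra_mat_alg)
  have sm: "Q k $$ (u, v) \<cdot>\<^sub>m X k \<in> carrier_mat (s * m) (s * m)" for k
    using X by simp
  have dX: "dim_row (X k) = s * m" "dim_col (X k) = s * m" for k using X [of k] by auto
  have "finsum ?A (\<lambda>k. Q k $$ (u, v) \<cdot>\<^sub>m X k) UNIV \<in> carrier ?A"
    using sm by (intro finsum_closed) (auto simp: module_mat_simps)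
  then have fc: "finsum ?A (\<lambda>k. Q k $$ (u, v) \<cdot>\<^sub>m X k) UNIV \<in> carrier_mat (s * m) (s * m)"
    by (simp add: module_mat_simps)
  have "flatten m s (linear_form ?A P Q X) $$ (i, j) = linear_form ?A P Q X $$ (u, v) $$ (x, y)"
    using ij P by (simp add: flatten_index u_def v_def x_def y_def h_def h'_def)
  also have "\<dots> = P $$ (u, v) * (1\<^sub>m (s * m)) $$ (x, y) + (\<Sum>k\<in>UNIV. Q k $$ (u, v) * X k $$ (x, y))"
    using b xy P fc sm dX unfolding linear_form_def
    by (simp add: module_mat_simps mat_alg_finsum_index u_def v_def)
  also have "P $$ (u, v) * (1\<^sub>m (s * m)) $$ (x, y)
      = (1\<^sub>m m) $$ (h, h') * kron P (1\<^sub>m s) $$ (i mod (p * s), j mod (q * s))"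
    using b c xy P by (simp add: kron_index u_def v_def x_def y_def h_def h'_def mult_add_eq_iff)
  also have "(\<Sum>k\<in>UNIV. Q k $$ (u, v) * X k $$ (x, y))
      = (\<Sum>k\<in>UNIV. kron (Q k) (block s (X k) h h') $$ (i mod (p * s), j mod (q * s)))"
    using b c d by (intro sum.cong refl) (simp add: kron_index block_def u_def v_def x_def y_def)
  finally show ?thesis .
qed


lemma flatten_amat_one: "flatten m s (amat_one (mat_alg (s * m) :: ('k::field, 'k mat) module) n) = 1\<^sub>m (m * (n * s))"
proof -
  interpret unital_algebra "mat_alg (s * m) :: ('k, 'k mat) module"
    by (rule unital_algebra_mat_alg)
  show ?thesis
    using flatten_tensor_one [of m s "1\<^sub>m n :: 'k mat"] tensor_one [of n]
    by (simp add: module_mat_simps(3) kron_one_one)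
qed

text \<open>For \<open>m = 1\<close> there is a single block, and flattening merely merges nested
  matrices. Writing \<open>s * 1\<close> keeps the algebra in the form
  \<open>mat_alg (s * m)\<close> of the general lemmas.\<close>

lemma rep_pencil_eq_flatten:
  assumes wf: "lin_rep_wf \<rho>" and Y: "\<And>k. Y k \<in> carrier_mat s s"
  shows "flatten 1 s (lr_form (mat_alg (s * 1)) \<rho> Y) = rep_pencil s \<rho> Y"
proof (rule eq_matI)
  note d = lin_rep_wf_dims [OF wf]
  fix i j assume "i < dim_row (rep_pencil s \<rho> Y)" "j < dim_col (rep_pencil s \<rho> Y)"
  then have ij: "i < 1 * (lr_dim \<rho> * s)" "j < 1 * (lr_dim \<rho> * s)" by (auto simp: rep_pencil_def)
  have [simp]: "block s (Y k) 0 0 = Y k" for k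
    using Y [of k] by (intro eq_matI) (auto simp: block_def)
  have c: "lr_const \<rho> \<in> carrier_mat (lr_dim \<rho>) (lr_dim \<rho>)" "lr_lin \<rho> k \<in> carrier_mat (lr_dim \<rho>) (lr_dim \<rho>)" for k
    using wf by (auto simp: lin_rep_wf_def)
  have "Y k \<in> carrier_mat (s * 1) (s * 1)" for k using Y [of k] by simp
  from flatten_linear_form [OF this c ij]
  show "flatten 1 s (lr_form (mat_alg (s * 1)) \<rho> Y) $$ (i, j) = rep_pencil s \<rho> Y $$ (i, j)"
    using ij by (simp add: rep_pencil_def)
qed (use lin_rep_wf_dims [OF wf] in \<open>auto simp: rep_pencil_def\<close>)

text \<open>The pencil is invertible at \<open>Y\<close> over the algebra of
  \<open>s \<times> s\<close> matrices; flattening, being multiplicative, carries the inverse to a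
  scalar matrix \<open>W\<close>.\<close>

lemma rep_pencil_invertible:
  assumes wf: "lin_rep_wf \<rho>" and Y: "\<And>k. Y k \<in> carrier_mat s s"
    and rep: "represents (mat_alg s) \<rho> Y r"
  obtains W where "W \<in> carrier_mat (lr_dim \<rho> * s) (lr_dim \<rho> * s)"
    "W * rep_pencil s \<rho> Y = 1\<^sub>m (lr_dim \<rho> * s)" "rep_pencil s \<rho> Y * W = 1\<^sub>m (lr_dim \<rho> * s)"
proof -
  let ?A = "mat_alg (s * 1) :: ('a, 'a mat) module"
  interpret unital_algebra ?A by (rule unital_algebra_mat_alg)
  obtain V where V: "V \<in> amat_carrier ?A (lr_dim \<rho>) (lr_dim \<rho>)"
    "amat_mult ?A (lr_form ?A \<rho> Y) V = amat_one ?A (lr_dim \<rho>)"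
    "amat_mult ?A V (lr_form ?A \<rho> Y) = amat_one ?A (lr_dim \<rho>)"
    using rep unfolding represents_def by auto
  have L: "entries_in ?A (lr_form ?A \<rho> Y)"
    using Y by (intro entries_in_linear_form) (simp add: module_mat_simps)
  have V': "dim_row V = lr_dim \<rho>" "dim_col V = lr_dim \<rho>" "entries_in ?A V"
    using V(1) by (auto simp: amat_carrier_iff)
  note d = lin_rep_wf_dims [OF wf]
  show thesis
  proof
    show "flatten 1 s V \<in> carrier_mat (lr_dim \<rho> * s) (lr_dim \<rho> * s)"
      using V' by (intro carrier_matI) auto
    show "flatten 1 s V * rep_pencil s \<rho> Y = 1\<^sub>m (lr_dim \<rho> * s)"
      "rep_pencil s \<rho> Y * flatten 1 s V = 1\<^sub>m (lr_dim \<rho> * s)"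
      unfolding rep_pencil_eq_flatten [OF wf Y, symmetric]
      using flatten_mult [OF L V'(3)] flatten_mult [OF V'(3) L] V V' d
        flatten_amat_one [of 1 s "lr_dim \<rho>"] by auto
  qed
qed

text \<open>Parallel to \<open>realization_wrt_rep\<close>, but the \<open>X k\<close> are arbitrary
  and need not have the form \<open>I_s \<otimes> a\<close>. The algebra is
  \<open>mat_alg (s * m)\<close>, flattening replaces amplification, and
  \<open>M = (I_m \<otimes> W) F\<close> is verified block by block.\<close>

lemma realization_of_rep:
  fixes \<rho> :: "('k::field, 'd::finite) lin_rep"
  assumes wf: "lin_rep_wf \<rho>" and Y: "\<And>k. Y k \<in> carrier_mat s s"
    and s: "s \<ge> 1"
    and W: "W \<in> carrier_mat (lr_dim \<rho> * s) (lr_dim \<rho> * s)"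
      "W * rep_pencil s \<rho> Y = 1\<^sub>m (lr_dim \<rho> * s)" "rep_pencil s \<rho> Y * W = 1\<^sub>m (lr_dim \<rho> * s)"
    and X: "\<And>k. X k \<in> carrier_mat (s * m) (s * m)" and r: "r \<in> carrier_mat (s * m) (s * m)"
    and rep: "represents (mat_alg (s * m)) \<rho> X r"
  defines "\<R> \<equiv> rep_realization s \<rho> W"
  shows "X \<in> fm_dom m s Y \<R>" and "fm_eval m s Y \<R> X = r"
proof -
  let ?A = "mat_alg (s * m) :: ('k, 'k mat) module"
  define L where "L = lr_dim \<rho> * s"
  define P where "P = kron (lr_const \<rho>) (1\<^sub>m s)"
  define C where "C = kron (lr_row \<rho>) (1\<^sub>m s)"
  define b where "b = kron (lr_col \<rho>) (1\<^sub>m s)"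
  define w where "w = W * b"
  define T where "T = (\<lambda>k Z. - (W * kron (lr_lin \<rho> k) Z))"
  define N where "N = rep_pencil s \<rho> Y"
  note d = lin_rep_wf_dims [OF wf]
  note W' = W [folded L_def N_def]
  have N: "N \<in> carrier_mat L L" by (simp add: N_def L_def)
  have \<R>: "fm_L \<R> = L" "fm_A \<R> = T" "fm_B \<R> = (\<lambda>k Z. T k Z * w)" "fm_C \<R> = C" "fm_D \<R> = C * w"
    by (simp_all add: \<R>_def rep_realization_def L_def T_def C_def b_def w_def)
  have fm: "fm_realization s \<R>"
    unfolding \<R>_def by (rule fm_realization_rep [OF wf W(1) s])
  have c: "P \<in> carrier_mat L L" "C \<in> carrier_mat s L" "b \<in> carrier_mat L s" "w \<in> carrier_mat L s"
    using d W' by (auto simp: P_def C_def b_def w_def L_def intro!: carrier_matI)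
  have K: "kron (lr_lin \<rho> k) Z \<in> carrier_mat L L" if "Z \<in> carrier_mat s s" for k Z
    using d that by (auto simp: L_def intro!: carrier_matI)
  have T: "linear_on_mats s L L (T k)" for k
    using fm \<R> unfolding fm_realization_def by auto
  have Tc: "T k Z \<in> carrier_mat L L" if "Z \<in> carrier_mat s s" for k Z
    by (rule linear_on_matsD(1) [OF T that])
  have Bc: "block s M i j \<in> carrier_mat s s" for M :: "'k mat" and i j
    by (simp add: block_def)
  define F where "F = flatten m s (lr_form ?A \<rho> X)"
  have [simp]: "dim_row F = m * L" "dim_col F = m * L"
    using d by (auto simp: F_def L_def)
  define S where "S = block_sum m s L L Y T X"
  define M where "M = fm_pencil m s Y \<R> X"
  have M_minus: "M = 1\<^sub>m (m * L) - S"
    by (simp add: M_def fm_pencil_def \<R> S_def)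
  have S: "S \<in> carrier_mat (m * L) (m * L)"
    by (simp add: S_def block_sum_def)
  have M: "M = kron (1\<^sub>m m) W * F"
  proof (rule eq_matI)
    fix i j assume "i < dim_row (kron (1\<^sub>m m) W * F)" "j < dim_col (kron (1\<^sub>m m) W * F)"
    then have ij: "i < m * L" "j < m * L" using W' by auto
    define h h' where "h = i div L" and "h' = j div L"
    define i' j' where "i' = i mod L" and "j' = j mod L"
    note ij' = div_mod_lessThan_mult [OF ij(1), folded h_def i'_def]
      div_mod_lessThan_mult [OF ij(2), folded h'_def j'_def]
    \<comment> \<open>The identity and the centre contribute to the diagonal blocks only;
      \<open>t\<close> is 1 there and 0 elsewhere, so both kinds of block are treated
      together.\<close>
    define t :: 'k where "t = (1\<^sub>m m) $$ (h, h')"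
    define Q where "Q k = kron (lr_lin \<rho> k) (block s (X k) h h')" for k
    have Q: "Q k \<in> carrier_mat L L" for k
      unfolding Q_def by (rule K [OF Bc])
    have X_block: "T k (block s (X k - kron (1\<^sub>m m) (Y k)) h h') $$ (i', j')
        = - ((W * Q k) $$ (i', j') - t * (W * kron (lr_lin \<rho> k) (Y k)) $$ (i', j'))" for k
    proof -
      have "block s (X k - kron (1\<^sub>m m) (Y k)) h h' = block s (X k) h h' + (- t) \<cdot>\<^sub>m Y k"
      proof (rule eq_matI)
        fix p q assume "p < dim_row (block s (X k) h h' + (- t) \<cdot>\<^sub>m Y k)"
          "q < dim_col (block s (X k) h h' + (- t) \<cdot>\<^sub>m Y k)"
        then have pq: "p < s" "q < s" using Y [of k] by auto
        then have "h * s + p < m * s" "h' * s + q < m * s"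
          using ij' by (auto simp: mult_add_less_mult)
        then show "block s (X k - kron (1\<^sub>m m) (Y k)) h h' $$ (p, q)
            = (block s (X k) h h' + (- t) \<cdot>\<^sub>m Y k) $$ (p, q)"
          using pq X [of k] Y [of k] by (simp add: block_def kron_index t_def)
      qed (use Y [of k] in \<open>auto simp: block_def\<close>)
      then have "T k (block s (X k - kron (1\<^sub>m m) (Y k)) h h') = T k (block s (X k) h h') + (- t) \<cdot>\<^sub>m T k (Y k)"
        using linear_on_matsD [OF T Bc] linear_on_matsD [OF T Y] Y by simp
      moreover have "T k Z $$ (i', j') = - (W * kron (lr_lin \<rho> k) Z) $$ (i', j')"
        if "Z \<in> carrier_mat s s" for Z
        unfolding T_def using ij' mult_carrier_mat [OF W'(1) K [OF that, of k]]
        by (intro index_uminus_mat(1)) (metis carrier_matD)+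
      ultimately show ?thesis
        using ij' Tc [OF Bc, of k "X k" h h'] Tc [OF Y, of k k] Bc Y by (simp add: Q_def)
    qed
    have inv: "W * mat L L (\<lambda>ij. P $$ ij + (\<Sum>k\<in>UNIV. kron (lr_lin \<rho> k) (Y k) $$ ij)) = 1\<^sub>m L"
      using W'(2) by (simp add: N_def rep_pencil_def L_def P_def)
    have one: "(1\<^sub>m (m * L)) $$ (i, j) = t * (1\<^sub>m L) $$ (i', j')"
    proof -
      have "i = j \<longleftrightarrow> h = h' \<and> i' = j'"
        unfolding h_def h'_def i'_def j'_def by (metis div_mult_mod_eq)
      then show ?thesis using ij ij' by (auto simp: t_def)
    qed
    have "M $$ (i, j) = t * (1\<^sub>m L) $$ (i', j')
        - (\<Sum>k\<in>UNIV. T k (block s (X k - kron (1\<^sub>m m) (Y k)) h h') $$ (i', j'))"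
      unfolding M_minus using ij S one
      by (simp add: S_def block_sum_def block_ext_def h_def h'_def i'_def j'_def)
    also have "\<dots> = t * (1\<^sub>m L) $$ (i', j')
        + (\<Sum>k\<in>UNIV. (W * Q k) $$ (i', j') - t * (W * kron (lr_lin \<rho> k) (Y k)) $$ (i', j'))"
      unfolding X_block by (simp add: sum_negf del: minus_diff_eq)
    also have "\<dots> = t * (W * P) $$ (i', j') + (\<Sum>k\<in>UNIV. (W * Q k) $$ (i', j'))"
      using ij' by (intro pencil_normalization [OF W'(1) c(1) K [OF Y] Q inv])
    also have "\<dots> = (W * mat L L (\<lambda>ij. (t \<cdot>\<^sub>m P) $$ ij + (\<Sum>k\<in>UNIV. Q k $$ ij))) $$ (i', j')"
      using ij' W' c by (subst mult_mat_sum [OF W'(1) _ Q]) (auto simp: mult_smult_distrib [OF W'(1) c(1)])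
    also have "\<dots> = (\<Sum>l<L. W $$ (i', l) * (t * P $$ (l, j') + (\<Sum>k\<in>UNIV. Q k $$ (l, j'))))"
      using ij' W' c by (simp add: scalar_prod_def atLeast0LessThan)
    also have "\<dots> = (\<Sum>l<L. W $$ (i', l) * F $$ (h * L + l, j))"
    proof (intro sum.cong refl)
      fix l assume "l \<in> {..<L}"
      then have l: "l < L" by simp
      then have hl: "h * L + l < m * L" using ij' by (auto simp: mult_add_less_mult)
      have cc: "lr_const \<rho> \<in> carrier_mat (lr_dim \<rho>) (lr_dim \<rho>)" "lr_lin \<rho> k \<in> carrier_mat (lr_dim \<rho>) (lr_dim \<rho>)" for k
        using wf by (auto simp: lin_rep_wf_def)
      show "W $$ (i', l) * (t * P $$ (l, j') + (\<Sum>k\<in>UNIV. Q k $$ (l, j'))) = W $$ (i', l) * F $$ (h * L + l, j)"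
        unfolding F_def
        using flatten_linear_form [where X = X and Q = "lr_lin \<rho>", OF X cc hl [unfolded L_def] ij(2) [unfolded L_def]] l
        by (simp add: t_def P_def Q_def h'_def j'_def div_mod_mult_add
          del: div_mult_self3 mod_mult_self3 flip: L_def)
    qed
    also have "\<dots> = (kron (1\<^sub>m m) W * F) $$ (i, j)"
      using W' ij by (subst kron_one_mult_index) (auto simp: h_def i'_def)
    finally show "M $$ (i, j) = (kron (1\<^sub>m m) W * F) $$ (i, j)" .
  qed (use W' S in \<open>auto simp: M_minus\<close>)
  have Sw: "block_sum m s L s Y (\<lambda>k Z. T k Z * w) X = S * kron (1\<^sub>m m) w"
  proof (rule eq_matI)
    fix i j assume "i < dim_row (S * kron (1\<^sub>m m) w)" "j < dim_col (S * kron (1\<^sub>m m) w)"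
    then have ij: "i < m * L" "j < m * s" using S c by auto
    note ij' = div_mod_lessThan_mult [OF ij(1)] div_mod_lessThan_mult [OF ij(2)]
    let ?Z = "\<lambda>k. block s (X k - kron (1\<^sub>m m) (Y k)) (i div L) (j div s)"
    have Z: "dim_row (T k (?Z k)) = L" "dim_col (T k (?Z k)) = L" for k
      using Tc [OF Bc, of k "X k - kron (1\<^sub>m m) (Y k)" "i div L" "j div s"] by auto
    have "block_sum m s L s Y (\<lambda>k Z. T k Z * w) X $$ (i, j)
        = (\<Sum>k\<in>UNIV. \<Sum>l<L. T k (?Z k) $$ (i mod L, l) * w $$ (l, j mod s))"
      using ij ij' c Z by (simp add: block_sum_def block_ext_def scalar_prod_def atLeast0LessThan)
    also have "\<dots> = (\<Sum>l<L. \<Sum>k\<in>UNIV. T k (?Z k) $$ (i mod L, l) * w $$ (l, j mod s))"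
      by (rule sum.swap)
    also have "\<dots> = (\<Sum>l<L. S $$ (i, j div s * L + l) * w $$ (l, j mod s))"
      using ij ij' by (intro sum.cong refl)
        (simp add: S_def block_sum_def block_ext_def mult_add_less_mult sum_distrib_right)
    also have "\<dots> = (S * kron (1\<^sub>m m) w) $$ (i, j)"
      using ij S c by (subst mult_kron_one_index) auto
    finally show "block_sum m s L s Y (\<lambda>k Z. T k Z * w) X $$ (i, j) = (S * kron (1\<^sub>m m) w) $$ (i, j)" .
  qed (use S c in \<open>auto simp: block_sum_def\<close>)
  interpret unital_algebra ?A by (rule unital_algebra_mat_alg)
  obtain V where V: "V \<in> amat_carrier ?A (lr_dim \<rho>) (lr_dim \<rho>)"
    "amat_mult ?A (lr_form ?A \<rho> X) V = amat_one ?A (lr_dim \<rho>)"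
    "amat_mult ?A V (lr_form ?A \<rho> X) = amat_one ?A (lr_dim \<rho>)"
    "amat_mult ?A (amat_mult ?A (tensor ?A (lr_row \<rho>) \<one>\<^bsub>?A\<^esub>) V) (tensor ?A (lr_col \<rho>) \<one>\<^bsub>?A\<^esub>)
      = mat 1 1 (\<lambda>_. r)"
    using rep unfolding represents_def by blast
  have V': "dim_row V = lr_dim \<rho>" "dim_col V = lr_dim \<rho>" "entries_in ?A V"
    using V(1) by (auto simp: amat_carrier_iff)
  have LX: "entries_in ?A (lr_form ?A \<rho> X)"
    using X by (intro entries_in_linear_form) (simp add: module_mat_simps)
  define G where "G = flatten m s V"
  have FG: "F * G = 1\<^sub>m (m * L)" "G * F = 1\<^sub>m (m * L)"
    using flatten_mult [OF LX V'(3)] flatten_mult [OF V'(3) LX] V V' d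
      flatten_amat_one [of m s "lr_dim \<rho>"] by (auto simp: F_def G_def L_def)
  have Fc: "F \<in> carrier_mat (m * L) (m * L)" "G \<in> carrier_mat (m * L) (m * L)"
    using V' d by (auto simp: F_def G_def L_def intro!: carrier_matI)
  have kc: "kron (1\<^sub>m m) W \<in> carrier_mat (m * L) (m * L)" "kron (1\<^sub>m m) N \<in> carrier_mat (m * L) (m * L)"
    "kron (1\<^sub>m m) w \<in> carrier_mat (m * L) (m * s)" "kron (1\<^sub>m m) b \<in> carrier_mat (m * L) (m * s)"
    "kron (1\<^sub>m m) C \<in> carrier_mat (m * s) (m * L)"
    using W' N c by (auto intro!: carrier_matI)
  have WN: "kron (1\<^sub>m m) W * kron (1\<^sub>m m) N = 1\<^sub>m (m * L)" "kron (1\<^sub>m m) N * kron (1\<^sub>m m) W = 1\<^sub>m (m * L)"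
    using W' N by (simp_all add: kron_one_mult kron_one_one)
  have [simp]: "dim_row W = L" "dim_col W = L" "dim_row N = L" "dim_col N = L"
    "dim_row C = s" "dim_col C = L" "dim_row b = L" "dim_col b = s" "dim_row w = L" "dim_col w = s"
    "dim_row G = m * L" "dim_col G = m * L"
    using W' N c Fc by auto
  define J where "J = G * kron (1\<^sub>m m) N"
  have Jc: "J \<in> carrier_mat (m * L) (m * L)" "M \<in> carrier_mat (m * L) (m * L)"
    using Fc kc by (auto simp: J_def M)
  have MJ: "M * J = 1\<^sub>m (m * L)" "J * M = 1\<^sub>m (m * L)"
  proof -
    have "M * J = kron (1\<^sub>m m) W * (F * G) * kron (1\<^sub>m m) N"
      by (simp add: M J_def assoc_mult_mat_dim)
    then show "M * J = 1\<^sub>m (m * L)"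
      using kc WN FG by simp
    have "J * M = G * (kron (1\<^sub>m m) N * kron (1\<^sub>m m) W) * F"
      by (simp add: M J_def assoc_mult_mat_dim)
    then show "J * M = 1\<^sub>m (m * L)"
      using Fc WN FG by simp
  qed
  have "det M * det J = 1"
    using det_mult [OF Jc(2,1)] MJ(1) by simp
  then show "X \<in> fm_dom m s Y \<R>"
    using X by (auto simp: fm_dom_def M_def)
  interpret P: unital_algebra "mat_alg (m * L) :: ('k, 'k mat) module" by (rule unital_algebra_mat_alg)
  have inv: "inv\<^bsub>mat_alg (m * L)\<^esub> M = J"
    using MJ Jc by (intro P.inv_unique' [symmetric]) (auto simp: module_mat_simps)
  have "fm_eval m s Y \<R> X = kron (1\<^sub>m m) (C * w) + kron (1\<^sub>m m) C * J * (S * kron (1\<^sub>m m) w)"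
    by (simp add: fm_eval_def \<R> Sw inv flip: M_def)
  also have "kron (1\<^sub>m m) (C * w) = kron (1\<^sub>m m) C * kron (1\<^sub>m m) w"
    using c by (simp add: kron_one_mult)
  \<comment> \<open>As over an algebra, \<open>J M = 1\<close> is inserted so that the constant term
    merges with the term in \<open>S\<close>, and then \<open>M + S = 1\<close> applies.\<close>
  also have "\<dots> = kron (1\<^sub>m m) C * J * (M * kron (1\<^sub>m m) w)"
  proof -
    have "kron (1\<^sub>m m) C * J * (M * kron (1\<^sub>m m) w) = kron (1\<^sub>m m) C * ((J * M) * kron (1\<^sub>m m) w)"
      using Jc by (simp add: assoc_mult_mat_dim)
    then show ?thesis using MJ(2) kc by simp
  qed
  also have "\<dots> + kron (1\<^sub>m m) C * J * (S * kron (1\<^sub>m m) w)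
      = kron (1\<^sub>m m) C * J * (M * kron (1\<^sub>m m) w + S * kron (1\<^sub>m m) w)"
    using Jc kc S by (intro mult_add_distrib_mat [symmetric]) auto
  also have "M * kron (1\<^sub>m m) w + S * kron (1\<^sub>m m) w = (M + S) * kron (1\<^sub>m m) w"
    using Jc kc S by (intro add_mult_distrib_mat [symmetric])
  also have "M + S = 1\<^sub>m (m * L)"
    unfolding M_minus using S by (intro eq_matI) auto
  also have "1\<^sub>m (m * L) * kron (1\<^sub>m m) w = kron (1\<^sub>m m) W * kron (1\<^sub>m m) b"
    using kc W' c by (simp add: w_def kron_one_mult)
  also have "kron (1\<^sub>m m) C * J * \<dots> = kron (1\<^sub>m m) C * (G * ((kron (1\<^sub>m m) N * kron (1\<^sub>m m) W) * kron (1\<^sub>m m) b))"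
    by (simp add: J_def assoc_mult_mat_dim)
  also have "\<dots> = kron (1\<^sub>m m) C * G * kron (1\<^sub>m m) b"
    using kc Fc WN by simp
  \<comment> \<open>The three factors are flattenings of \<open>c\<close>, \<open>V\<close> and
    \<open>b\<close>, hence the product is the flattening of \<open>c V b\<close>; flattening a 1 by
    1 matrix returns its entry.\<close>
  also have "\<dots> = flatten m s (mat 1 1 (\<lambda>_. r))"
  proof -
    have tensor: "flatten m s (tensor ?A Z \<one>\<^bsub>?A\<^esub>) = kron (1\<^sub>m m) (kron Z (1\<^sub>m s))" for Z
      using flatten_tensor_one [of m s Z] by (simp only: module_mat_simps(3))
    have e: "entries_in ?A (tensor ?A (lr_row \<rho>) \<one>\<^bsub>?A\<^esub>)" "entries_in ?A (tensor ?A (lr_col \<rho>) \<one>\<^bsub>?A\<^esub>)"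
      by (auto intro!: entries_in_tensor)
    show ?thesis
      unfolding V(4) [symmetric] C_def b_def G_def
      using d V' e by (simp add: entries_in_amat tensor flip: flatten_mult)
  qed
  also have "\<dots> = r"
    using r by (intro eq_matI) (auto simp: flatten_index mult.commute div_mod_lessThan_mult)
  finally show "fm_eval m s Y \<R> X = r" .
qed


section \<open>Transfer between algebras\<close>

locale unital_algebra_hom = A: unital_algebra A + B: unital_algebra B
  for A :: "('k::field, 'a, 'm) module_scheme" and B :: "('k, 'b, 'n) module_scheme" +
  fixes h :: "'a \<Rightarrow> 'b"
  assumes hom_closed: "x \<in> carrier A \<Longrightarrow> h x \<in> carrier B"
    and hom_add: "x \<in> carrier A \<Longrightarrow> y \<in> carrier A \<Longrightarrow> h (x \<oplus>\<^bsub>A\<^esub> y) = h x \<oplus>\<^bsub>B\<^esub> h y"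
    and hom_mult: "x \<in> carrier A \<Longrightarrow> y \<in> carrier A \<Longrightarrow> h (x \<otimes>\<^bsub>A\<^esub> y) = h x \<otimes>\<^bsub>B\<^esub> h y"
    and hom_smult: "x \<in> carrier A \<Longrightarrow> h (c \<odot>\<^bsub>A\<^esub> x) = c \<odot>\<^bsub>B\<^esub> h x"
    and hom_one: "h \<one>\<^bsub>A\<^esub> = \<one>\<^bsub>B\<^esub>"
begin

lemma hom_zero: "h \<zero>\<^bsub>A\<^esub> = \<zero>\<^bsub>B\<^esub>"
  using hom_smult [of "\<one>\<^bsub>A\<^esub>" 0] by (simp add: hom_one)

text \<open>Subtraction is the addition of a multiple by -1, which the homomorphism
  respects.\<close>

lemma hom_minus:
  assumes "x \<in> carrier A" "y \<in> carrier A"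
  shows "h (x \<ominus>\<^bsub>A\<^esub> y) = h x \<ominus>\<^bsub>B\<^esub> h y"
proof -
  have "x \<ominus>\<^bsub>A\<^esub> y = x \<oplus>\<^bsub>A\<^esub> (- 1) \<odot>\<^bsub>A\<^esub> y"
    using assms by (simp add: A.smult_uminus A.minus_eq)
  moreover have "h x \<ominus>\<^bsub>B\<^esub> h y = h x \<oplus>\<^bsub>B\<^esub> (- 1) \<odot>\<^bsub>B\<^esub> h y"
    using assms hom_closed by (simp add: B.smult_uminus B.minus_eq)
  ultimately show ?thesis
    using assms by (simp add: hom_add hom_smult)
qed

lemma hom_finsum:
  assumes "finite F" "\<And>i. i \<in> F \<Longrightarrow> f i \<in> carrier A"
  shows "h (\<Oplus>\<^bsub>A\<^esub>i\<in>F. f i) = (\<Oplus>\<^bsub>B\<^esub>i\<in>F. h (f i))"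
  using assms
  by (induction F rule: finite_induct)
     (simp_all add: hom_zero hom_add hom_closed A.finsum_insert B.finsum_insert Pi_iff A.finsum_closed)

lemma map_amat_add:
  assumes "entries_in A M" "entries_in A N" "dim_row M = dim_row N" "dim_col M = dim_col N"
  shows "map_mat h (amat_add A M N) = amat_add B (map_mat h M) (map_mat h N)"
  using assms by (intro eq_matI) (auto simp: entries_in_def hom_add)

lemma map_amat_minus:
  assumes "entries_in A M" "entries_in A N" "dim_row M = dim_row N" "dim_col M = dim_col N"
  shows "map_mat h (amat_minus A M N) = amat_minus B (map_mat h M) (map_mat h N)"
  using assms by (intro eq_matI) (auto simp: entries_in_def hom_minus)

lemma map_amat_mult:
  assumes "entries_in A M" "entries_in A N" "dim_col M = dim_row N"
  shows "map_mat h (amat_mult A M N) = amat_mult B (map_mat h M) (map_mat h N)"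
proof (rule eq_matI)
  fix i j assume "i < dim_row (amat_mult B (map_mat h M) (map_mat h N))"
    "j < dim_col (amat_mult B (map_mat h M) (map_mat h N))"
  then have ij: "i < dim_row M" "j < dim_col N" by auto
  note c = entries_inD [OF assms(1)] entries_inD [OF assms(2)]
  have "h (\<Oplus>\<^bsub>A\<^esub>l\<in>{..<dim_row N}. M $$ (i, l) \<otimes>\<^bsub>A\<^esub> N $$ (l, j))
      = (\<Oplus>\<^bsub>B\<^esub>l\<in>{..<dim_row N}. h (M $$ (i, l) \<otimes>\<^bsub>A\<^esub> N $$ (l, j)))"
    using ij c assms by (intro hom_finsum) auto
  also have "\<dots> = (\<Oplus>\<^bsub>B\<^esub>l\<in>{..<dim_row N}. h (M $$ (i, l)) \<otimes>\<^bsub>B\<^esub> h (N $$ (l, j)))"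
    using ij c assms by (intro B.finsum_cong') (auto simp: hom_mult hom_closed)
  also have "\<dots> = amat_mult B (map_mat h M) (map_mat h N) $$ (i, j)"
    using ij assms by (auto simp: amat_mult_index hom_closed c intro!: B.finsum_cong')
  finally show "map_mat h (amat_mult A M N) $$ (i, j)
      = amat_mult B (map_mat h M) (map_mat h N) $$ (i, j)"
    using ij assms by (simp add: amat_mult_index)
qed auto

lemma map_amat_one: "map_mat h (amat_one A n) = amat_one B n"
  by (intro eq_matI) (auto simp: hom_one hom_zero)

lemma map_tensor: "x \<in> carrier A \<Longrightarrow> map_mat h (tensor A M x) = tensor B M (h x)"
  by (intro eq_matI) (auto simp: hom_smult)

lemma entries_in_map: "entries_in A M \<Longrightarrow> entries_in B (map_mat h M)"
  by (auto simp: entries_in_def hom_closed)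

lemma alg_ext_hom:
  assumes T: "linear_on_mats s p q T" and M: "M \<in> amat_carrier A s s" and rc: "r < p" "c < q"
  shows "alg_ext A s p q T M $$ (r, c) \<in> carrier A"
    and "h (alg_ext A s p q T M $$ (r, c)) = alg_ext B s p q T (map_mat h M) $$ (r, c)"
proof -
  let ?f = "\<lambda>ij. tensor A (T (unit_mat s (fst ij) (snd ij))) (M $$ ij) $$ (r, c)"
  have "T (unit_mat s i j) \<in> carrier_mat p q" for i j
    by (rule linear_on_matsD(1) [OF T]) (simp add: unit_mat_def)
  then have d: "r < dim_row (T (unit_mat s i j))" "c < dim_col (T (unit_mat s i j))" for i j
    using rc by (metis carrier_matD)+
  have Mc: "M $$ ij \<in> carrier A" if "ij \<in> {..<s} \<times> {..<s}" for ij
    using M that by (auto simp: amat_carrier_iff entries_in_def)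
  have M_map: "map_mat h M $$ ij = h (M $$ ij)" if "ij \<in> {..<s} \<times> {..<s}" for ij
    using M that by (auto simp: amat_carrier_iff)
  have f: "?f ij \<in> carrier A" if "ij \<in> {..<s} \<times> {..<s}" for ij
    using Mc [OF that] d by simp
  show "alg_ext A s p q T M $$ (r, c) \<in> carrier A"
    using rc f by (auto simp: alg_ext_def intro!: A.finsum_closed)
  have "h (alg_ext A s p q T M $$ (r, c)) = (\<Oplus>\<^bsub>B\<^esub>ij\<in>{..<s} \<times> {..<s}. h (?f ij))"
    using rc f by (simp add: alg_ext_def hom_finsum)
  also have "\<dots> = (\<Oplus>\<^bsub>B\<^esub>ij\<in>{..<s} \<times> {..<s}.
      tensor B (T (unit_mat s (fst ij) (snd ij))) (map_mat h M $$ ij) $$ (r, c))"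
  proof (rule B.finsum_cong')
    fix ij assume ij: "ij \<in> {..<s} \<times> {..<s}"
    show "h (?f ij) = tensor B (T (unit_mat s (fst ij) (snd ij))) (map_mat h M $$ ij) $$ (r, c)"
      using Mc [OF ij] M_map [OF ij] d by (simp add: hom_smult)
  qed (use Mc M_map d in \<open>auto simp: hom_closed\<close>)
  finally show "h (alg_ext A s p q T M $$ (r, c)) = alg_ext B s p q T (map_mat h M) $$ (r, c)"
    using rc by (simp add: alg_ext_def)
qed

lemma alg_sum_hom:
  assumes T: "\<And>k. linear_on_mats s p q (T k)" and Y: "\<And>k. Y k \<in> carrier_mat s s"
    and M: "\<And>k. M k \<in> amat_carrier A s s"
  shows "entries_in A (alg_sum A s p q Y T M)"
    and "map_mat h (alg_sum A s p q Y T M) = alg_sum B s p q Y T (\<lambda>k. map_mat h (M k))"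
proof -
  let ?D = "\<lambda>k. amat_minus A (M k) (tensor A (Y k) \<one>\<^bsub>A\<^esub>)"
  have Y': "dim_row (Y k) = s" "dim_col (Y k) = s" for k using Y [of k] by auto
  have M': "dim_row (M k) = s" "dim_col (M k) = s" "entries_in A (M k)" for k
    using M [of k] by (auto simp: amat_carrier_iff)
  have D: "?D k \<in> amat_carrier A s s" for k
    using M' Y' by (simp add: amat_carrier_iff A.entries_in_amat A.entries_in_tensor)
  have D_map: "map_mat h (?D k) = amat_minus B (map_mat h (M k)) (tensor B (Y k) \<one>\<^bsub>B\<^esub>)" for k
    using M' Y' by (simp add: map_amat_minus A.entries_in_tensor map_tensor hom_one)
  show "entries_in A (alg_sum A s p q Y T M)"
    unfolding alg_sum_def
    by (intro entries_in_mat A.finsum_closed) (auto intro!: alg_ext_hom(1) [OF T D])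
  show "map_mat h (alg_sum A s p q Y T M) = alg_sum B s p q Y T (\<lambda>k. map_mat h (M k))"
  proof (rule eq_matI)
    fix r c assume "r < dim_row (alg_sum B s p q Y T (\<lambda>k. map_mat h (M k)))"
      "c < dim_col (alg_sum B s p q Y T (\<lambda>k. map_mat h (M k)))"
    then have rc: "r < p" "c < q" by (auto simp: alg_sum_def)
    show "map_mat h (alg_sum A s p q Y T M) $$ (r, c)
        = alg_sum B s p q Y T (\<lambda>k. map_mat h (M k)) $$ (r, c)"
      using rc by (simp add: alg_sum_def hom_finsum alg_ext_hom [OF T D rc] D_map)
  qed (auto simp: alg_sum_def)
qed

text \<open>Applying \<open>h\<close> entrywise commutes with all operations of the evaluation, and
  the image of the inverse of the pencil is inverse to the image of the pencil. So correctness at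
  one point passes to the image point.\<close>

lemma realization_hom:
  assumes fm: "fm_realization s \<R>" and Y: "\<And>k. Y k \<in> carrier_mat s s"
    and a: "\<And>k. a k \<in> carrier A" and r: "r \<in> carrier A"
    and dom: "(\<lambda>k. tensor A (1\<^sub>m s) (a k)) \<in> alg_fm_dom A s Y \<R>"
    and ev: "tensor A (1\<^sub>m s) r = alg_fm_eval A s Y \<R> (\<lambda>k. tensor A (1\<^sub>m s) (a k))"
  shows "(\<lambda>k. tensor B (1\<^sub>m s) (h (a k))) \<in> alg_fm_dom B s Y \<R>"
    and "tensor B (1\<^sub>m s) (h r) = alg_fm_eval B s Y \<R> (\<lambda>k. tensor B (1\<^sub>m s) (h (a k)))"
proof -
  let ?X = "\<lambda>k. tensor A (1\<^sub>m s) (a k)" and ?X' = "\<lambda>k. tensor B (1\<^sub>m s) (h (a k))"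
  define L where "L = fm_L \<R>"
  define M where "M = alg_pencil A s Y \<R> ?X"
  define J where "J = inv\<^bsub>amat_ring A L\<^esub> M"
  have T: "linear_on_mats s L L (fm_A \<R> k)" "linear_on_mats s L s (fm_B \<R> k)" for k
    using fm by (auto simp: fm_realization_def L_def)
  have CD: "fm_C \<R> \<in> carrier_mat s L" "fm_D \<R> \<in> carrier_mat s s"
    using fm by (auto simp: fm_realization_def L_def)
  have X: "?X k \<in> amat_carrier A s s" for k
    using a by (simp add: amat_carrier_iff A.entries_in_tensor)
  have X_map: "map_mat h (?X k) = ?X' k" for k
    using a by (simp add: map_tensor)
  let ?SA = "alg_sum A s L L Y (fm_A \<R>) ?X" and ?SB = "alg_sum A s L s Y (fm_B \<R>) ?X"
  have SA: "entries_in A ?SA" "map_mat h ?SA = alg_sum B s L L Y (fm_A \<R>) ?X'"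
    using alg_sum_hom [OF T(1) Y X] by (simp_all add: X_map)
  have SB: "entries_in A ?SB" "map_mat h ?SB = alg_sum B s L s Y (fm_B \<R>) ?X'"
    using alg_sum_hom [OF T(2) Y X] by (simp_all add: X_map)
  have [simp]: "dim_row (alg_sum A s p q Y Q Z) = p" "dim_col (alg_sum A s p q Y Q Z) = q" for p q Q Z
    by (simp_all add: alg_sum_def)
  have M_map: "map_mat h M = alg_pencil B s Y \<R> ?X'"
    unfolding M_def alg_pencil_def using SA
    by (simp add: map_amat_minus A.entries_in_tensor map_tensor hom_one flip: L_def)
  interpret AL: monoid "amat_ring A L" by (rule A.monoid_amat_ring)
  have "M \<in> Units (amat_ring A L)"
    using dom by (simp add: alg_fm_dom_def M_def L_def)
  then have "M \<in> carrier (amat_ring A L)" "J \<in> carrier (amat_ring A L)"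
    "M \<otimes>\<^bsub>amat_ring A L\<^esub> J = \<one>\<^bsub>amat_ring A L\<^esub>" "J \<otimes>\<^bsub>amat_ring A L\<^esub> M = \<one>\<^bsub>amat_ring A L\<^esub>"
    by (simp_all add: J_def AL.Units_closed)
  then have MJ: "M \<in> amat_carrier A L L" "J \<in> amat_carrier A L L"
      "amat_mult A M J = amat_one A L" "amat_mult A J M = amat_one A L"
    by (simp_all add: amat_ring_def)
  have d: "dim_row M = L" "dim_col M = L" "dim_row J = L" "dim_col J = L" "entries_in A M" "entries_in A J"
    using MJ(1,2) by (auto simp: amat_carrier_iff)
  have "amat_mult B (map_mat h M) (map_mat h J) = amat_one B L"
    "amat_mult B (map_mat h J) (map_mat h M) = amat_one B L"
    using MJ(3,4) d by (simp_all add: map_amat_one flip: map_amat_mult)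
  then have inv: "map_mat h M \<in> Units (amat_ring B L)" "inv\<^bsub>amat_ring B L\<^esub> map_mat h M = map_mat h J"
    using d by (auto intro!: B.amat_ring_UnitsI simp: amat_carrier_iff entries_in_map)
  show "?X' \<in> alg_fm_dom B s Y \<R>"
    using inv(1) a
    by (simp add: alg_fm_dom_def M_map amat_carrier_iff B.entries_in_tensor hom_closed flip: L_def)
  have "tensor B (1\<^sub>m s) (h r) = map_mat h (alg_fm_eval A s Y \<R> ?X)"
    using r ev by (simp flip: map_tensor)
  also have "\<dots> = alg_fm_eval B s Y \<R> ?X'"
    unfolding alg_fm_eval_def M_map [symmetric] L_def [symmetric] inv(2)
      M_def [symmetric] J_def [symmetric]
    using d SA SB CD
    by (simp add: map_amat_add map_amat_mult map_tensor hom_one A.entries_in_amat A.entries_in_tensor)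
  finally show "tensor B (1\<^sub>m s) (h r) = alg_fm_eval B s Y \<R> ?X'" .
qed

lemma word_eval_hom:
  assumes a: "\<And>k. a k \<in> carrier A"
  shows "h (word_eval A a w) = word_eval B (\<lambda>k. h (a k)) w"
proof (induction w)
  case (Cons k w)
  have "word_eval A a w \<in> carrier A"
    by (rule A.word_eval_closed [OF a])
  with Cons show ?case using a by (simp add: word_eval_def hom_mult)
qed (simp add: word_eval_def hom_one)

lemma poly_eval_hom:
  assumes a: "\<And>k. a k \<in> carrier A"
  shows "h (poly_eval A a p) = poly_eval B (\<lambda>k. h (a k)) p"
proof -
  have "word_eval A a w \<in> carrier A" for w
    by (rule A.word_eval_closed [OF a])
  then show ?thesis
    unfolding poly_eval_def by (simp add: hom_finsum hom_smult word_eval_hom [OF a])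
qed

end


section \<open>Copying a subalgebra to another type\<close>

text \<open>The structure of \<open>S\<close> is carried along the injection \<open>g\<close>. What
  is used afterwards is the homomorphism \<open>e\<close> back into \<open>A\<close>, through which
  realizations return from the copy.\<close>

lemma unital_algebra_transport:
  fixes A :: "('k::field, 'a, 'm) module_scheme" and B :: "('k, 'b) module"
  assumes A: "unital_algebra A"
    and closed: "\<zero>\<^bsub>A\<^esub> \<in> S" "\<one>\<^bsub>A\<^esub> \<in> S" "\<And>x y. x \<in> S \<Longrightarrow> y \<in> S \<Longrightarrow> x \<oplus>\<^bsub>A\<^esub> y \<in> S"
      "\<And>x y. x \<in> S \<Longrightarrow> y \<in> S \<Longrightarrow> x \<otimes>\<^bsub>A\<^esub> y \<in> S" "\<And>c x. x \<in> S \<Longrightarrow> c \<odot>\<^bsub>A\<^esub> x \<in> S"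
    and S: "S \<subseteq> carrier A" and inj: "inj_on g S"
  defines "e \<equiv> inv_into S g"
  defines "B \<equiv> \<lparr>carrier = g ` S, mult = \<lambda>x y. g (e x \<otimes>\<^bsub>A\<^esub> e y), one = g \<one>\<^bsub>A\<^esub>,
    zero = g \<zero>\<^bsub>A\<^esub>, add = \<lambda>x y. g (e x \<oplus>\<^bsub>A\<^esub> e y), smult = \<lambda>c x. g (c \<odot>\<^bsub>A\<^esub> e x)\<rparr>"
  shows "unital_algebra_hom B A e"
proof -
  interpret A: unital_algebra A by fact
  have e: "e (g x) = x" if "x \<in> S" for x
    using inj that by (simp add: e_def)
  have c: "x \<in> S \<Longrightarrow> x \<in> carrier A" for x using S by blast
  \<comment> \<open>Closure under scalar multiples contains closure under negatives, by the scalar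
    -1.\<close>
  have neg: "\<exists>y\<in>S. x \<oplus>\<^bsub>A\<^esub> y = \<zero>\<^bsub>A\<^esub>" if "x \<in> S" for x
    using that c closed(5) [of x "- 1"] by (intro bexI [of _ "(- 1) \<odot>\<^bsub>A\<^esub> x"])
      (auto simp: A.smult_uminus A.r_neg)
  have add: "abelian_group B"
    by (rule abelian_groupI) (auto simp: B_def e closed c A.a_ac, metis neg)
  have "monoid B"
    by (rule monoidI) (auto simp: B_def e closed c A.m_assoc)
  with add have "ring B"
    by (intro ringI) (auto simp: B_def e closed c A.l_distr A.r_distr)
  moreover have "Module.module class_ring B"
    by (intro moduleI Module.module.axioms(1) [OF A.module_axioms] add)
       (auto simp: B_def e closed c A.smult_class_distrib class_ring_simps)
  ultimately have "unital_algebra B"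
    by (intro unital_algebra.intro unital_algebra_axioms.intro)
       (auto simp: B_def e closed c A.smult_mult_left A.smult_mult_right)
  then interpret B: unital_algebra B .
  show ?thesis
    by unfold_locales (auto simp: B_def e closed c)
qed

text \<open>Homomorphisms preserve units, but need not reflect them. Here \<open>A\<close> is the
  smaller algebra: the inverse found in \<open>B\<close> has a preimage by \<open>inv\<close>, and
  injectivity pulls both inverse identities back to \<open>A\<close>.\<close>

lemma (in unital_algebra_hom) rat_eval_hom_reflect:
  assumes inj: "inj_on h (carrier A)"
    and inv: "\<And>Q x. b \<in> rat_dom B (Inv Q) \<Longrightarrow> rat_eval B (Inv Q) b \<in> h ` carrier A"
    and a: "\<And>k. a k \<in> carrier A" "\<And>k. h (a k) = b k"
    and b: "b \<in> rat_dom B Q"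
  shows "a \<in> rat_dom A Q \<and> h (rat_eval A Q a) = rat_eval B Q b"
  using b
proof (induction Q)
  case (Poly p)
  then show ?case using a poly_eval_hom [of a p] by simp
next
  case (Inv Q)
  then have IH: "a \<in> rat_dom A Q" "h (rat_eval A Q a) = rat_eval B Q b"
    and U: "rat_eval B Q b \<in> Units B"
    by auto
  define x where "x = rat_eval A Q a"
  have x: "x \<in> carrier A" "h x = rat_eval B Q b"
    using IH A.rat_eval_closed by (auto simp: x_def)
  obtain y where y: "y \<in> carrier A" "h y = inv\<^bsub>B\<^esub> (h x)"
    using inv [OF Inv.prems] x by auto
  have "h (x \<otimes>\<^bsub>A\<^esub> y) = h \<one>\<^bsub>A\<^esub>" "h (y \<otimes>\<^bsub>A\<^esub> x) = h \<one>\<^bsub>A\<^esub>"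
    using x y U by (simp_all add: hom_mult hom_one)
  then have xy: "x \<otimes>\<^bsub>A\<^esub> y = \<one>\<^bsub>A\<^esub>" "y \<otimes>\<^bsub>A\<^esub> x = \<one>\<^bsub>A\<^esub>"
    using inj x y by (auto dest: inj_onD)
  then have "x \<in> Units A" "inv\<^bsub>A\<^esub> x = y"
    using x y by (auto simp: Units_def intro: A.inv_unique' [symmetric])
  then show ?case
    using IH x y by (simp add: x_def)
qed (auto simp: hom_add hom_mult A.rat_eval_closed)

lemma realization_wrt_transfer:
  fixes R :: "('k::field, 'd::finite) nc_rat" and A :: "('k, 'a) module"
  assumes fm: "fm_realization s \<R>" and Y: "\<And>k. Y k \<in> carrier_mat s s"
    and univ: "\<And>B :: ('k, ('k, 'd) nc_rat) module. unital_algebra B \<Longrightarrow> realization_wrt B s Y \<R> R"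
    and A: "unital_algebra A"
  shows "realization_wrt A s Y \<R> R"
  unfolding realization_wrt_def
proof
  fix a assume aR: "a \<in> rat_dom A R"
  interpret A: unital_algebra A by fact
  have a: "a k \<in> carrier A" for k by (rule rat_dom_carrier [OF aR])
  define D :: "('k, 'd) nc_rat set" where "D = {Q. a \<in> rat_dom A Q}"
  define S where "S = (\<lambda>Q. rat_eval A Q a) ` D"
  have S: "rat_eval A Q a \<in> S" if "a \<in> rat_dom A Q" for Q
    using that by (auto simp: S_def D_def)
  \<comment> \<open>For each value, \<open>g\<close> chooses one expression that attains it; this is
    the injection into the type of expressions.\<close>
  define g where "g = inv_into D (\<lambda>Q. rat_eval A Q a)"
  have inj: "inj_on g S"
    unfolding g_def S_def by (rule inj_on_inv_into) simp
  have monom: "poly_eval A a (Poly_Mapping.single w c) = c \<odot>\<^bsub>A\<^esub> word_eval A a w" for w c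
  proof -
    have "word_eval A a w \<in> carrier A" by (rule A.word_eval_closed [OF a])
    then show ?thesis by (cases "c = 0") (simp_all add: poly_eval_def)
  qed
  \<comment> \<open>Constants come from the empty word; zero, one and closure under scalar multiples
    are reduced to them.\<close>
  have const: "c \<odot>\<^bsub>A\<^esub> \<one>\<^bsub>A\<^esub> \<in> S" for c
    using S [of "Poly (Poly_Mapping.single [] c)"] a by (simp add: monom word_eval_def)
  have add: "x \<oplus>\<^bsub>A\<^esub> y \<in> S" and mult: "x \<otimes>\<^bsub>A\<^esub> y \<in> S" if xy: "x \<in> S" "y \<in> S" for x y
  proof -
    obtain P Q where "a \<in> rat_dom A P" "a \<in> rat_dom A Q" "x = rat_eval A P a" "y = rat_eval A Q a"
      using xy by (auto simp: S_def D_def)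
    then show "x \<oplus>\<^bsub>A\<^esub> y \<in> S" "x \<otimes>\<^bsub>A\<^esub> y \<in> S"
      using S [of "Add P Q"] S [of "Mul P Q"] by auto
  qed
  have S_carrier: "S \<subseteq> carrier A"
    by (auto simp: S_def D_def A.rat_eval_closed)
  have smult: "c \<odot>\<^bsub>A\<^esub> x \<in> S" if "x \<in> S" for c x
  proof -
    have "c \<odot>\<^bsub>A\<^esub> x = (c \<odot>\<^bsub>A\<^esub> \<one>\<^bsub>A\<^esub>) \<otimes>\<^bsub>A\<^esub> x"
      using that S_carrier by (auto simp: A.smult_mult_left)
    then show ?thesis using mult [OF const that] by simp
  qed
  have S0: "\<zero>\<^bsub>A\<^esub> \<in> S" and S1: "\<one>\<^bsub>A\<^esub> \<in> S"
    using const [of 0] const [of 1] by simp_all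
  have var: "a k \<in> S" for k
    using S [of "Poly (Poly_Mapping.single [k] 1)"] a by (simp add: monom word_eval_def)
  define e where "e = inv_into S g"
  define B :: "('k, ('k, 'd) nc_rat) module" where
    "B = \<lparr>carrier = g ` S, mult = \<lambda>x y. g (e x \<otimes>\<^bsub>A\<^esub> e y), one = g \<one>\<^bsub>A\<^esub>,
      zero = g \<zero>\<^bsub>A\<^esub>, add = \<lambda>x y. g (e x \<oplus>\<^bsub>A\<^esub> e y), smult = \<lambda>c x. g (c \<odot>\<^bsub>A\<^esub> e x)\<rparr>"
  interpret H: unital_algebra_hom B A e
    unfolding B_def e_def
    by (rule unital_algebra_transport [OF A S0 S1 add mult smult S_carrier inj])
  have eg: "e (g x) = x" if "x \<in> S" for x
    using inj that by (simp add: e_def)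
  have B_carrier: "carrier B = g ` S" by (simp add: B_def)
  have e_inj: "inj_on e (carrier B)"
    by (auto simp: inj_on_def B_carrier eg)
  have e_image: "e ` carrier B = S"
    by (auto simp: B_carrier eg image_iff)
  define a' where "a' k = g (a k)" for k
  have a': "a' k \<in> carrier B" "e (a' k) = a k" for k
    using var by (simp_all add: a'_def B_carrier eg)
  \<comment> \<open>If \<open>Inv Q\<close> is defined at \<open>a\<close>, its value lies in
    \<open>S\<close> because \<open>Inv Q\<close> is itself an expression; this discharges the
    assumption on inverses.\<close>
  have refl: "a' \<in> rat_dom B R \<and> e (rat_eval B R a') = rat_eval A R a"
    by (rule H.rat_eval_hom_reflect [OF e_inj _ a' aR]) (simp only: e_image S)
  then have "(\<lambda>k. tensor B (1\<^sub>m s) (a' k)) \<in> alg_fm_dom B s Y \<R>"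
    "tensor B (1\<^sub>m s) (rat_eval B R a') = alg_fm_eval B s Y \<R> (\<lambda>k. tensor B (1\<^sub>m s) (a' k))"
    using univ [OF H.A.unital_algebra_axioms] by (auto simp: realization_wrt_def)
  from H.realization_hom [OF fm Y a'(1) H.A.rat_eval_closed this] refl
  show "(\<lambda>k. tensor A (1\<^sub>m s) (a k)) \<in> alg_fm_dom A s Y \<R> \<and>
      tensor A (1\<^sub>m s) (rat_eval A R a) = alg_fm_eval A s Y \<R> (\<lambda>k. tensor A (1\<^sub>m s) (a k))"
    by (simp add: a'(2))
qed

theorem theorem2p4:
  fixes R :: "('k::field, 'd::finite) nc_rat" and s :: nat and Y :: "'d \<Rightarrow> 'k mat"
  assumes "s \<ge> 1" and "Y \<in> rat_dom (mat_alg s) R"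
  shows "(\<exists>\<R>. fm_realization s \<R> \<and> realization_of s Y \<R> R \<and>
            (\<forall>A :: ('k, ('k, 'd) nc_rat) module.
               unital_algebra A \<longrightarrow> realization_wrt A s Y \<R> R)) \<and>
         (\<forall>\<R>. fm_realization s \<R> \<and> realization_of s Y \<R> R \<and>
            (\<forall>A :: ('k, ('k, 'd) nc_rat) module.
               unital_algebra A \<longrightarrow> realization_wrt A s Y \<R> R) \<longrightarrow>
            (\<forall>A :: ('k, 'a) module. unital_algebra A \<longrightarrow> realization_wrt A s Y \<R> R))"
proof -
  have Y: "Y k \<in> carrier_mat s s" for k
    using rat_dom_carrier [OF assms(2)] by (simp add: module_mat_simps)
  have wf: "lin_rep_wf (rep_rat R)" by (rule lin_rep_wf_rat)
  \<comment> \<open>The domain condition on the centre turns into invertibility of the pencil at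
    \<open>Y\<close>, from which \<open>W\<close> is extracted.\<close>
  have rep: "represents (mat_alg s) (rep_rat R) Y (rat_eval (mat_alg s) R Y)"
    by (rule unital_algebra.represents_rat [OF unital_algebra_mat_alg assms(2)])
  obtain W where W: "W \<in> carrier_mat (lr_dim (rep_rat R) * s) (lr_dim (rep_rat R) * s)"
    "W * rep_pencil s (rep_rat R) Y = 1\<^sub>m (lr_dim (rep_rat R) * s)"
    "rep_pencil s (rep_rat R) Y * W = 1\<^sub>m (lr_dim (rep_rat R) * s)"
    by (rule rep_pencil_invertible [OF wf Y rep])
  define \<R> where "\<R> = rep_realization s (rep_rat R) W"
  have fm: "fm_realization s \<R>"
    unfolding \<R>_def by (rule fm_realization_rep [OF wf W(1) assms(1)])
  have "X \<in> fm_dom m s Y \<R> \<and> rat_eval (mat_alg (s * m)) R X = fm_eval m s Y \<R> X"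
    if X: "X \<in> rat_dom (mat_alg (s * m)) R" for m X
  proof -
    interpret unital_algebra "mat_alg (s * m) :: ('k, 'k mat) module"
      by (rule unital_algebra_mat_alg)
    have "X k \<in> carrier_mat (s * m) (s * m)" for k
      using rat_dom_carrier [OF X] by (simp add: module_mat_simps)
    moreover have "rat_eval (mat_alg (s * m)) R X \<in> carrier_mat (s * m) (s * m)"
      using rat_eval_closed [OF X] by (simp add: module_mat_simps)
    ultimately show ?thesis
      using realization_of_rep [OF wf Y assms(1) W _ _ represents_rat [OF X]]
      unfolding \<R>_def by simp
  qed
  then have "realization_of s Y \<R> R"
    by (auto simp: realization_of_def)
  moreover have "realization_wrt A s Y \<R> R" if "unital_algebra A"
    for A :: "('k, ('k, 'd) nc_rat) module"
  proof -
    interpret unital_algebra A by fact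
    show ?thesis
      unfolding realization_wrt_def
    proof (intro ballI conjI)
      fix a assume a: "a \<in> rat_dom A R"
      note * = realization_wrt_rep [OF wf Y assms(1) W rat_dom_carrier [OF a] rat_eval_closed [OF a]
          represents_rat [OF a], folded \<R>_def]
      show "(\<lambda>k. tensor A (1\<^sub>m s) (a k)) \<in> alg_fm_dom A s Y \<R>"
        by (rule *(1))
      show "tensor A (1\<^sub>m s) (rat_eval A R a) = alg_fm_eval A s Y \<R> (\<lambda>k. tensor A (1\<^sub>m s) (a k))"
        by (rule *(2) [symmetric])
    qed
  qed
  \<comment> \<open>The second claim concerns every realization with the stated properties, so the
    transfer is applied to an arbitrary \<open>\<S>\<close> and not just to the one
    constructed.\<close>
  moreover have "realization_wrt A s Y \<S> R"
    if "fm_realization s \<S> \<and> realization_of s Y \<S> R \<and>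
        (\<forall>A :: ('k, ('k, 'd) nc_rat) module. unital_algebra A \<longrightarrow> realization_wrt A s Y \<S> R)"
      and "unital_algebra A" for \<S> and A :: "('k, 'a) module"
    by (rule realization_wrt_transfer [OF _ Y _ that(2)]) (use that(1) in auto)
  ultimately show ?thesis
    using fm by blast
qed

end
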